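(* There exists a strictly stationary sequence $X := (X_k, k \in \mathbf{Z})$ of random variables (on some probability space $(\Omega, \mathcal{F}, P)$) with the following six properties: (A) The random variables $X_k$ take just the values $-1$ and $1$, with $P(X_0 = -1) = P(X_0 = 1) = 1/2$ (and hence $EX_0 = 0$ and $EX_0^2 = 1$). (B) For every five distinct integers $k(1), k(2), k(3), k(4), k(5)$, the five random variables $X_{k(1)}, X_{k(2)}, X_{k(3)}, X_{k(4)}, X_{k(5)}$ are independent. (C) There exist a sequence $(\eta_k, k \in \mathbf{Z})$ of independent, identically distributed real-valued random variables (on $(\Omega, \mathcal{F}, P)$) and a Borel function $f : \mathbf{R} \times \mathbf{R} \times \mathbf{R} \times \cdots \to \{-1,1\}$ such that for every $k \in \mathbf{Z}$, $X_k = f(\eta_k, \eta_{k-1}, \eta_{k-2}, \dots)$ a.s. (D) The double tail $\sigma$-field of $X$ is trivial (that is, $P(A) = 0$ or $1$ for every $A \in \mathcal{T}_{\rm double}(X)$). (E) $\limsup_{n \to \infty} E(S_n/\sqrt{n})^6 < 15$. (F) For every infinite set $Q \subset \mathbf{N}$, there exist an infinite set $T \subset Q$ and a nondegenerate, non-normal probability measure $\mu$ on $(\mathbf{R}, \mathcal{R})$ such that $S_n/\sqrt{n} \Rightarrow \mu$ as $n \to \infty$, $n \in T$.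
   Context: $\mathbf{N}$ is the set of positive integers; $\mathcal{R}$ is the Borel $\sigma$-field on $\mathbf{R}$; $\Rightarrow$ denotes convergence in distribution. For a sequence $X := (X_k, k\in\mathbf{Z})$ of random variables on $(\Omega,\mathcal{F},P)$ and $n\in\mathbf{N}$, $S_n := X_1 + X_2 + \dots + X_n$. For $-\infty \le J \le L \le \infty$, $\mathcal{F}_J^L$ denotes the $\sigma$-field generated by the random variables $X_k$, $J \le k \le L$ ($k\in\mathbf{Z}$). The double tail $\sigma$-field of $X$ is $\mathcal{T}_{\rm double}(X) := \bigcap_{n\in\mathbf{N}} (\mathcal{F}_{-\infty}^{-n} \vee \mathcal{F}_n^{\infty})$, where $\vee$ denotes the $\sigma$-field generated by the union. *)

theory Defs
  imports "HOL-Probability.Probability"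
begin

definition strictly_stationary :: "'a measure \<Rightarrow> (int \<Rightarrow> 'a \<Rightarrow> real) \<Rightarrow> bool" where
  "strictly_stationary M X \<longleftrightarrow>
     (\<forall>k. X k \<in> borel_measurable M) \<and>
     (\<forall>m::int. distr M (\<Pi>\<^sub>M k\<in>(UNIV::int set). borel) (\<lambda>\<omega> k. X (k + m) \<omega>)
             = distr M (\<Pi>\<^sub>M k\<in>(UNIV::int set). borel) (\<lambda>\<omega> k. X k \<omega>))"

definition iid :: "'a measure \<Rightarrow> (int \<Rightarrow> 'a \<Rightarrow> real) \<Rightarrow> bool" where
  "iid M \<eta> \<longleftrightarrow>
     prob_space.indep_vars M (\<lambda>_. borel) \<eta> UNIV \<and>
     (\<forall>j k. distr M borel (\<eta> j) = distr M borel (\<eta> k))"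

definition partial_sum :: "(int \<Rightarrow> 'a \<Rightarrow> real) \<Rightarrow> nat \<Rightarrow> 'a \<Rightarrow> real" where
  "partial_sum X n \<omega> = (\<Sum>k=1..n. X (int k) \<omega>)"

(* The sigma-field generated by the X k with k in K; F_J^L is the case where K is the set of
   integers between J and L, so J = -\<infinity> or L = \<infinity> gives a half-line. *)
definition generated_field :: "'a measure \<Rightarrow> (int \<Rightarrow> 'a \<Rightarrow> real) \<Rightarrow> int set \<Rightarrow> 'a set set" where
  "generated_field M X K =
     sigma_sets (space M) {X k -` B \<inter> space M | k B. k \<in> K \<and> B \<in> sets borel}"

definition double_tail :: "'a measure \<Rightarrow> (int \<Rightarrow> 'a \<Rightarrow> real) \<Rightarrow> 'a set set" where
  "double_tail M X =
     (\<Inter>n\<in>{1::nat..}. sigma_sets (space M)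
        (generated_field M X {..- int n} \<union> generated_field M X {int n..}))"

definition nondegenerate :: "real measure \<Rightarrow> bool" where
  "nondegenerate \<mu> \<longleftrightarrow> \<not> (\<exists>c. \<mu> = return borel c)"

definition normal_law :: "real measure \<Rightarrow> bool" where
  "normal_law \<mu> \<longleftrightarrow> (\<exists>m \<sigma>. \<sigma> > 0 \<and> \<mu> = density lborel (\<lambda>x. ennreal (normal_density m \<sigma> x)))"

(* Convergence in distribution of Y n to \<mu> as n tends to infinity through the infinite set T;
   enumerate T lists T in increasing order. *)
definition converges_in_distribution_along ::
  "'a measure \<Rightarrow> (nat \<Rightarrow> 'a \<Rightarrow> real) \<Rightarrow> nat set \<Rightarrow> real measure \<Rightarrow> bool" where
  "converges_in_distribution_along M Y T \<mu> \<longleftrightarrow>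
     weak_conv_m (\<lambda>i. distr M borel (Y (enumerate T i))) \<mu>"

end

theory Submission
  imports Defs
begin

text \<open>
  The variable \<open>X k\<close> is a sign with conditional mean \<open>sin (Y k)\<close>, where \<open>Y\<close> is a white noise with
  standard normal marginals that is built from infinitely many scales. The scale of length
  \<open>l = 36 ^ m\<close> filters independent Gaussian noises through all differences of averages over two of
  \<open>36\<close> consecutive windows of length \<open>l\<close> preceding the point; the covariances produced by these filters
  telescope over \<open>m\<close>. At sparse random sites the block averages of six of the noises are
  replaced by six standard normal variables of which any five are independent, while the product of
  the six signs is \<open>-1\<close>. The six filters have disjoint supports, so five points never see all six
  hidden variables at once: they see independent Gaussians, and any five of the \<open>X k\<close> are independent.

  Six points do see the dependence. Each filter is a pair of tents of opposite signs, and these pairs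
  are nested, so that after summation over the points \<open>1, \<dots>, n\<close> the six contributions of a site have a
  common sign. Hence every scale lowers the sixth moment of \<open>S n\<close>, and the scale comparable to \<open>n\<close>
  lowers it by a multiple of \<open>n ^ 3\<close>. The other moments up to order five being those of independent
  signs, every weak limit of \<open>S n / sqrt n\<close> has mean 0, variance 1 and a sixth moment below the
  Gaussian value 15.

  If only the scales up to \<open>N\<close> are kept, \<open>X k\<close> depends on finitely many sites of the noise, and the error
  vanishes as \<open>N\<close> grows; this makes every event of the double tail independent of itself.
\<close>

section \<open>Sixth powers of sums of signs\<close>

text \<open>Five-wise independence fixes the moments up to order five, so the sixth is the first
  that can separate the limits from normal laws, and it must stay below 15 along all large n.
  Dependence at one length l cannot achieve this: sites inside the range cancel, those at its two
  ends contribute at most a multiple of l^3, and n^3 outgrows it. So every n needs a scale within a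
  bounded factor. There a point carries a weight of order l^(-1/2), each kernel sums to order
  l^(1/2), and sites have density of order 1/l: the contribution is of order l^3 whatever l is. The
  sine is chosen because a product of sines is a finite combination of exponentials of signed sums
  of the \<open>Y k\<close>: product moments become values of the joint characteristic function,
  which is Gaussian up to one factor 1 + (product of six tilts) per active site. The number 36
  leaves room for six tents at the odd offsets 1, ..., 11 and six mirror images at 25, ..., 35, with
  a central gap into which the end point n can fall. It also separates the lengths so well that six
  points feel at most one scale.\<close>

definition esym :: "'a set \<Rightarrow> ('a \<Rightarrow> real) \<Rightarrow> nat \<Rightarrow> real" where
  "esym W f j = (\<Sum>S | S \<subseteq> W \<and> card S = j. \<Prod>k\<in>S. f k)"

lemma esym_0: "finite W \<Longrightarrow> esym W f 0 = 1"
proof -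
  assume "finite W"
  then have "{S. S \<subseteq> W \<and> card S = 0} = {{}}"
    by (auto dest: finite_subset)
  then show ?thesis by (simp add: esym_def)
qed

lemma esym_insert:
  assumes W: "finite W" and a: "a \<notin> W"
  shows "esym (insert a W) f (Suc j) = esym W f (Suc j) + f a * esym W f j"
proof -
  let ?A = "{S. S \<subseteq> W \<and> card S = Suc j}" and ?B = "{S. S \<subseteq> W \<and> card S = j}"
  have eq: "{S. S \<subseteq> insert a W \<and> card S = Suc j} = ?A \<union> insert a ` ?B"
  proof (intro set_eqI iffI)
    fix S assume S: "S \<in> {S. S \<subseteq> insert a W \<and> card S = Suc j}"
    show "S \<in> ?A \<union> insert a ` ?B"
    proof (cases "a \<in> S")
      case True
      have "finite S" using S W by (auto intro: finite_subset)
      then have "card (S - {a}) = j" using S True by simp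
      moreover have "S - {a} \<subseteq> W" "S = insert a (S - {a})" using S True by auto
      ultimately show ?thesis by blast
    next
      case False then show ?thesis using S by auto
    qed
  next
    fix S assume S: "S \<in> ?A \<union> insert a ` ?B"
    then show "S \<in> {S. S \<subseteq> insert a W \<and> card S = Suc j}"
    proof
      assume "S \<in> ?A" then show ?thesis by auto
    next
      assume "S \<in> insert a ` ?B"
      then obtain S' where S': "S = insert a S'" "S' \<subseteq> W" "card S' = j" by auto
      then have "finite S'" "a \<notin> S'" using W a by (auto intro: finite_subset)
      then show ?thesis using S' by auto
    qed
  qed
  have inj: "inj_on (insert a) ?B"
    by (rule inj_on_inverseI[where g = "\<lambda>S. S - {a}"]) (use a in auto)
  have "(\<Sum>S\<in>insert a ` ?B. \<Prod>k\<in>S. f k) = (\<Sum>S\<in>?B. f a * (\<Prod>k\<in>S. f k))"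
    unfolding sum.reindex[OF inj] comp_def
  proof (rule sum.cong[OF refl])
    fix S assume "S \<in> ?B"
    then have "finite S" "a \<notin> S" using W a by (auto intro: finite_subset)
    then show "(\<Prod>k\<in>insert a S. f k) = f a * (\<Prod>k\<in>S. f k)" by simp
  qed
  then show ?thesis unfolding esym_def eq
    using W a by (subst sum.union_disjoint) (auto simp: sum_distrib_left)
qed

lemma esym_1: "finite W \<Longrightarrow> esym W f 1 = (\<Sum>k\<in>W. f k)"
proof (induction W rule: finite_induct)
  case empty
  have "{S::'a set. S \<subseteq> {} \<and> card S = 1} = {}" by auto
  then show ?case by (simp add: esym_def)
next
  case (insert a W)
  then show ?case using esym_insert[of W a f 0] by (simp add: esym_0)
qed

text \<open>For signs the elementary symmetric functions obey the three-term recursion of the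
  Krawtchouk polynomials, because squares drop out.\<close>

lemma sum_times_esym:
  assumes "finite W" and "\<And>k. k \<in> W \<Longrightarrow> (f k)\<^sup>2 = 1"
  shows "(\<Sum>k\<in>W. f k) * esym W f (Suc j) =
    real (j + 2) * esym W f (Suc (Suc j)) + (real (card W) - real j) * esym W f j"
  using assms
proof (induction W arbitrary: j rule: finite_induct)
  case empty
  have "esym {} f (Suc i) = 0" for i
  proof -
    have "{S::'a set. S \<subseteq> {} \<and> card S = Suc i} = {}" by auto
    then show ?thesis by (simp add: esym_def)
  qed
  moreover have "real j * esym {} f j = 0"
  proof (cases j)
    case (Suc i)
    have "{S::'a set. S \<subseteq> {} \<and> card S = Suc i} = {}" by auto
    then show ?thesis by (simp add: esym_def Suc)
  qed auto
  ultimately show ?case by simp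
next
  case (insert a W)
  have x: "f a * f a = 1" using insert.prems[of a] by (simp add: power2_eq_square)
  have IH: "(\<Sum>k\<in>W. f k) * esym W f (Suc j) =
    real (j + 2) * esym W f (Suc (Suc j)) + (real (card W) - real j) * esym W f j" for j
    using insert by blast
  let ?S = "\<Sum>k\<in>W. f k" and ?e = "esym W f" and ?x = "f a"
  have "(\<Sum>k\<in>insert a W. f k) * esym (insert a W) f (Suc j) = (?x + ?S) * (?e (Suc j) + ?x * ?e j)"
    using insert by (simp add: esym_insert)
  also have "\<dots> = ?x * ?e (Suc j) + (?x * ?x) * ?e j + ?S * ?e (Suc j) + ?x * (?S * ?e j)"
    by (simp add: algebra_simps)
  also have "\<dots> = ?x * ?e (Suc j) + ?e j + ?S * ?e (Suc j) + ?x * (?S * ?e j)" by (simp only: x mult_1)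
  also have "\<dots> = real (j + 2) * esym (insert a W) f (Suc (Suc j)) +
      (real (card (insert a W)) - real j) * esym (insert a W) f j"
  proof (cases j)
    case 0
    then show ?thesis using insert IH[of 0]
      by (simp add: esym_insert esym_0 esym_1[unfolded One_nat_def] algebra_simps)
  next
    case (Suc i)
    have P: "?S * ?e j = real (i + 2) * ?e (Suc j) + (real (card W) - real i) * ?e i"
      using IH[of i] Suc by simp
    have ins: "esym (insert a W) f (Suc (Suc j)) = ?e (Suc (Suc j)) + ?x * ?e (Suc j)"
      "esym (insert a W) f j = ?e j + ?x * ?e i" "card (insert a W) = Suc (card W)"
      using insert(1,2) by (simp_all add: esym_insert Suc)
    have arith: "x * u + v + (real (j + 2) * w + (c - real j) * v) + x * (real (i + 2) * u + (c - real i) * t)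
      = real (j + 2) * (w + x * u) + (real (Suc n) - real j) * (v + x * t)"
      if "c = real n" for x u v w t c :: real and n
      using that Suc by (simp add: algebra_simps)
    show ?thesis unfolding IH[of j] P ins by (rule arith) simp
  qed
  finally show ?case .
qed

text \<open>Repeated use of \<open>sum_times_esym\<close>; only symmetric functions of even order
  enter even powers. When signs are independent five at a time, orders 2 and 4 have mean zero, so
  the mean of order 6 alone decides how far the sixth moment is from the Gaussian leading term
  \<open>15 * n ^ 3\<close>.\<close>

lemma sixth_power_sum_signs:
  fixes f :: "'a \<Rightarrow> real"
  assumes W: "finite W" and f: "\<And>k. k \<in> W \<Longrightarrow> (f k)\<^sup>2 = 1"
  defines "n \<equiv> real (card W)"
  shows "(\<Sum>k\<in>W. f k) ^ 2 = 2 * esym W f 2 + n"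
    and "(\<Sum>k\<in>W. f k) ^ 6 = 720 * esym W f 6
      + (120 * (n - 4) + 4 * (60 * n - 120)) * esym W f 4
      + ((60 * n - 120) * (n - 2) + 2 * (15 * n\<^sup>2 - 30 * n + 16)) * esym W f 2
      + (15 * n ^ 3 - 30 * n\<^sup>2 + 16 * n)"
proof -
  define s where "s = (\<Sum>k\<in>W. f k)"
  define e where "e = esym W f"
  have e0: "e 0 = 1" and e1: "e 1 = s" using W by (simp_all add: e_def s_def esym_0 esym_1 del: One_nat_def)
  have r: "s * e (Suc j) = real (j + 2) * e (Suc (Suc j)) + (n - real j) * e j" for j
    unfolding s_def e_def n_def by (rule sum_times_esym[OF W f])
  have r1: "s * e 1 = 2 * e 2 + n" using r[of 0] e0 by (simp add: numeral_eq_Suc)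
  have r2: "s * e 2 = 3 * e 3 + (n - 1) * e 1" using r[of 1] by (simp add: numeral_eq_Suc)
  have r3: "s * e 3 = 4 * e 4 + (n - 2) * e 2" using r[of 2] by (simp add: numeral_eq_Suc)
  have r4: "s * e 4 = 5 * e 5 + (n - 3) * e 3" using r[of 3] by (simp add: numeral_eq_Suc)
  have r5: "s * e 5 = 6 * e 6 + (n - 4) * e 4" using r[of 4] by (simp add: numeral_eq_Suc)
  have s2: "s ^ 2 = 2 * e 2 + n" using r1 e1 by (simp add: power2_eq_square)
  have s3: "s ^ 3 = 6 * e 3 + (3 * n - 2) * e 1"
  proof -
    have "s ^ 3 = 2 * (s * e 2) + n * s" using s2 by (simp add: power2_eq_square power3_eq_cube algebra_simps)
    then show ?thesis unfolding r2 using e1 by (simp add: algebra_simps)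
  qed
  have s4: "s ^ 4 = 24 * e 4 + (12 * n - 16) * e 2 + (3 * n\<^sup>2 - 2 * n)"
  proof -
    have "s ^ 4 = s * s ^ 3" by (simp add: numeral_eq_Suc)
    also have "\<dots> = 6 * (s * e 3) + (3 * n - 2) * (s * e 1)" unfolding s3 by (simp add: algebra_simps)
    finally show ?thesis unfolding r3 r1 by (simp add: algebra_simps power2_eq_square)
  qed
  have s5: "s ^ 5 = 120 * e 5 + (60 * n - 120) * e 3 + (15 * n\<^sup>2 - 30 * n + 16) * e 1"
  proof -
    have "s ^ 5 = s * s ^ 4" by (simp add: numeral_eq_Suc)
    also have "\<dots> = 24 * (s * e 4) + (12 * n - 16) * (s * e 2) + (3 * n\<^sup>2 - 2 * n) * s"
      unfolding s4 by (simp add: algebra_simps)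
    finally show ?thesis unfolding r4 r2 using e1 by (simp add: algebra_simps power2_eq_square)
  qed
  have s6: "s ^ 6 = 720 * e 6 + (120 * (n - 4) + 4 * (60 * n - 120)) * e 4
      + ((60 * n - 120) * (n - 2) + 2 * (15 * n\<^sup>2 - 30 * n + 16)) * e 2
      + (15 * n ^ 3 - 30 * n\<^sup>2 + 16 * n)"
  proof -
    have "s ^ 6 = s * s ^ 5" by (simp add: numeral_eq_Suc)
    also have "\<dots> = 120 * (s * e 5) + (60 * n - 120) * (s * e 3) + (15 * n\<^sup>2 - 30 * n + 16) * (s * e 1)"
      unfolding s5 by (simp add: algebra_simps)
    finally show ?thesis unfolding r5 r3 r1
      by (simp add: algebra_simps power2_eq_square power3_eq_cube)
  qed
  show "(\<Sum>k\<in>W. f k) ^ 2 = 2 * esym W f 2 + n" using s2 by (simp add: s_def e_def)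
  show "(\<Sum>k\<in>W. f k) ^ 6 = 720 * esym W f 6
      + (120 * (n - 4) + 4 * (60 * n - 120)) * esym W f 4
      + ((60 * n - 120) * (n - 2) + 2 * (15 * n\<^sup>2 - 30 * n + 16)) * esym W f 2
      + (15 * n ^ 3 - 30 * n\<^sup>2 + 16 * n)" using s6 by (simp add: s_def e_def)
qed

section \<open>Kernels with disjoint supports\<close>

text \<open>Pigeonhole: if no kernel vanishes on \<open>S\<close>, pick a point in the support of
  each. Disjoint supports make the picks distinct, so \<open>r\<close> picks exhaust a set of at
  most \<open>r\<close> points and every point meets only its own kernel.\<close>

lemma disjoint_kernels_cases:
  fixes \<sigma> :: "nat \<Rightarrow> 'a \<Rightarrow> real"
  assumes S: "finite S" "card S \<le> r"
    and disj: "\<And>i i' k. i < r \<Longrightarrow> i' < r \<Longrightarrow> i \<noteq> i' \<Longrightarrow> \<sigma> i k = 0 \<or> \<sigma> i' k = 0"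
  obtains i where "i < r" "\<And>k. k \<in> S \<Longrightarrow> \<sigma> i k = 0"
  | \<kappa> where "card S = r" "bij_betw \<kappa> {..<r} S" "\<And>i k. i < r \<Longrightarrow> k \<in> S \<Longrightarrow> k \<noteq> \<kappa> i \<Longrightarrow> \<sigma> i k = 0"
proof (cases "\<exists>i<r. \<forall>k\<in>S. \<sigma> i k = 0")
  case True then show ?thesis using that(1) by blast
next
  case False
  then have "\<forall>i\<in>{..<r}. \<exists>k. k \<in> S \<and> \<sigma> i k \<noteq> 0" by auto
  then obtain \<kappa> where \<kappa>: "\<And>i. i < r \<Longrightarrow> \<kappa> i \<in> S \<and> \<sigma> i (\<kappa> i) \<noteq> 0" by (metis lessThan_iff)
  have inj: "inj_on \<kappa> {..<r}"
    by (rule inj_onI) (metis \<kappa> disj lessThan_iff)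
  have sub: "\<kappa> ` {..<r} \<subseteq> S" using \<kappa> by auto
  have "card (\<kappa> ` {..<r}) = r" using card_image[OF inj] by simp
  then have im: "\<kappa> ` {..<r} = S" and c: "card S = r"
    using S sub by (metis card_seteq) (metis S \<open>card (\<kappa> ` {..<r}) = r\<close> card_mono le_antisym sub)
  have "\<sigma> i k = 0" if "i < r" "k \<in> S" "k \<noteq> \<kappa> i" for i k
  proof -
    obtain i' where "i' < r" "k = \<kappa> i'" using \<open>k \<in> S\<close> im by (metis imageE lessThan_iff)
    then show ?thesis using that \<kappa>[of i'] disj[of i i' k] by auto
  qed
  with c inj im show ?thesis using that(2) by (auto simp: bij_betw_def)
qed

text \<open>Both sides expand into choices of one point per factor. Disjoint supports kill the
  choices that are not injective, and an injective one lives in exactly one subset of size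
  \<open>r\<close>, its own range.\<close>

lemma sum_subsets_prod_disjoint:
  fixes \<tau> :: "nat \<Rightarrow> 'a \<Rightarrow> real"
  assumes W: "finite W"
    and disj: "\<And>i i' k. i < r \<Longrightarrow> i' < r \<Longrightarrow> i \<noteq> i' \<Longrightarrow> \<tau> i k = 0 \<or> \<tau> i' k = 0"
  shows "(\<Sum>S | S \<subseteq> W \<and> card S = r. \<Prod>i<r. \<Sum>k\<in>S. \<tau> i k) = (\<Prod>i<r. \<Sum>k\<in>W. \<tau> i k)"
proof -
  have expand: "(\<Prod>i<r. \<Sum>k\<in>S. \<tau> i k) =
      (\<Sum>g\<in>{g \<in> PiE {..<r} (\<lambda>_. S). inj_on g {..<r}}. \<Prod>i<r. \<tau> i (g i))" if "finite S" for S
  proof -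
    have "(\<Prod>i<r. \<Sum>k\<in>S. \<tau> i k) = (\<Sum>g\<in>PiE {..<r} (\<lambda>_. S). \<Prod>i<r. \<tau> i (g i))"
      using that by (subst prod_sum_PiE) auto
    also have "\<dots> = (\<Sum>g\<in>{g \<in> PiE {..<r} (\<lambda>_. S). inj_on g {..<r}}. \<Prod>i<r. \<tau> i (g i))"
    proof (rule sum.mono_neutral_right)
      show "finite (PiE {..<r} (\<lambda>_. S))" using that by (auto intro: finite_PiE)
      show "\<forall>g\<in>PiE {..<r} (\<lambda>_. S) - {g \<in> PiE {..<r} (\<lambda>_. S). inj_on g {..<r}}. (\<Prod>i<r. \<tau> i (g i)) = 0"
      proof
        fix g assume "g \<in> PiE {..<r} (\<lambda>_. S) - {g \<in> PiE {..<r} (\<lambda>_. S). inj_on g {..<r}}"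
        then have "\<not> inj_on g {..<r}" by auto
        then obtain i i' where "i < r" "i' < r" "i \<noteq> i'" "g i = g i'" by (auto simp: inj_on_def)
        then have "\<tau> i (g i) = 0 \<or> \<tau> i' (g i') = 0" using disj by metis
        then show "(\<Prod>i<r. \<tau> i (g i)) = 0" using \<open>i < r\<close> \<open>i' < r\<close> by auto
      qed
    qed auto
    finally show ?thesis .
  qed
  let ?G = "\<lambda>S. {g \<in> PiE {..<r} (\<lambda>_. S). inj_on g {..<r}}"
  let ?\<S> = "{S. S \<subseteq> W \<and> card S = r}"
  have im: "g ` {..<r} = S" if "S \<in> ?\<S>" "g \<in> ?G S" for S g
  proof -
    have "g ` {..<r} \<subseteq> S" "card (g ` {..<r}) = r" using that by (auto simp: card_image)
    then show ?thesis using that W by (metis (mono_tags) card_subset_eq finite_subset mem_Collect_eq)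
  qed
  have un: "?G W = (\<Union>S\<in>?\<S>. ?G S)"
  proof (intro set_eqI iffI)
    fix g assume g: "g \<in> ?G W"
    then have "g ` {..<r} \<in> ?\<S>" "g \<in> ?G (g ` {..<r})"
      by (auto simp: card_image PiE_def Pi_def)
    then show "g \<in> (\<Union>S\<in>?\<S>. ?G S)" by blast
  qed (auto simp: PiE_def Pi_def)
  have "(\<Sum>S\<in>?\<S>. \<Prod>i<r. \<Sum>k\<in>S. \<tau> i k) = (\<Sum>S\<in>?\<S>. \<Sum>g\<in>?G S. \<Prod>i<r. \<tau> i (g i))"
  proof (rule sum.cong[OF refl])
    fix S assume "S \<in> ?\<S>"
    then have "finite S" using W by (auto intro: finite_subset)
    then show "(\<Prod>i<r. \<Sum>k\<in>S. \<tau> i k) = (\<Sum>g\<in>?G S. \<Prod>i<r. \<tau> i (g i))" by (rule expand)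
  qed
  also have "\<dots> = (\<Sum>g\<in>(\<Union>S\<in>?\<S>. ?G S). \<Prod>i<r. \<tau> i (g i))"
  proof (rule sum.UNION_disjoint[symmetric])
    show "finite ?\<S>" using W by simp
    show "\<forall>S\<in>?\<S>. finite (?G S)"
    proof
      fix S assume "S \<in> ?\<S>"
      then have "finite S" using W by (auto intro: finite_subset)
      then have "finite (PiE {..<r} (\<lambda>_. S))" by (auto intro: finite_PiE)
      then show "finite (?G S)" by (rule rev_finite_subset) blast
    qed
    show "\<forall>S\<in>?\<S>. \<forall>S'\<in>?\<S>. S \<noteq> S' \<longrightarrow> ?G S \<inter> ?G S' = {}"
    proof (intro ballI impI)
      fix S S' assume S: "S \<in> ?\<S>" "S' \<in> ?\<S>" "S \<noteq> S'"
      have False if "g \<in> ?G S" "g \<in> ?G S'" for g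
        using im[OF S(1) that(1)] im[OF S(2) that(2)] S(3) by simp
      then show "?G S \<inter> ?G S' = {}" by blast
    qed
  qed
  also have "\<dots> = (\<Prod>i<r. \<Sum>k\<in>W. \<tau> i k)" unfolding un[symmetric] using W by (rule expand[symmetric])
  finally show ?thesis .
qed

section \<open>Independence of signs from vanishing product moments\<close>

lemma (in prob_space) expectation_prod_affine_signs:
  assumes J: "finite J" and X: "\<And>k. k \<in> J \<Longrightarrow> X k \<in> borel_measurable M"
    and val: "\<And>k \<omega>. k \<in> J \<Longrightarrow> \<omega> \<in> space M \<Longrightarrow> X k \<omega> \<in> {-1, 1::real}"
    and zero: "\<And>S. S \<subseteq> J \<Longrightarrow> S \<noteq> {} \<Longrightarrow> expectation (\<lambda>\<omega>. \<Prod>k\<in>S. X k \<omega>) = 0"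
  shows "expectation (\<lambda>\<omega>. \<Prod>k\<in>J. (a k + b k * X k \<omega>)) = (\<Prod>k\<in>J. a k)"
proof -
  have int: "integrable M (\<lambda>\<omega>. \<Prod>k\<in>S. X k \<omega>)" if "S \<subseteq> J" for S
  proof (rule integrable_const_bound[where B = 1])
    show "AE \<omega> in M. norm (\<Prod>k\<in>S. X k \<omega>) \<le> 1"
    proof (rule AE_I2)
      fix \<omega> assume "\<omega> \<in> space M"
      then have "\<bar>X k \<omega>\<bar> = 1" if "k \<in> S" for k
        using val[of k \<omega>] subsetD[OF \<open>S \<subseteq> J\<close> that] by auto
      then show "norm (\<Prod>k\<in>S. X k \<omega>) \<le> 1" by (simp add: abs_prod)
    qed
    show "(\<lambda>\<omega>. \<Prod>k\<in>S. X k \<omega>) \<in> borel_measurable M"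
      using X that by (intro borel_measurable_prod) auto
  qed
  have "(\<Prod>k\<in>J. (a k + b k * X k \<omega>)) =
      (\<Sum>S\<in>Pow J. ((\<Prod>k\<in>J - S. a k) * (\<Prod>k\<in>S. b k)) * (\<Prod>k\<in>S. X k \<omega>))" for \<omega>
  proof -
    have "(\<Prod>k\<in>J. (b k * X k \<omega> + a k)) = (\<Sum>S\<in>Pow J. (\<Prod>k\<in>S. b k * X k \<omega>) * (\<Prod>k\<in>J - S. a k))"
      by (rule prod_add[OF J])
    then show ?thesis by (simp add: prod.distrib ac_simps)
  qed
  then have "expectation (\<lambda>\<omega>. \<Prod>k\<in>J. (a k + b k * X k \<omega>)) =
      (\<Sum>S\<in>Pow J. ((\<Prod>k\<in>J - S. a k) * (\<Prod>k\<in>S. b k)) * expectation (\<lambda>\<omega>. \<Prod>k\<in>S. X k \<omega>))"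
    using int by (simp add: Bochner_Integration.integral_sum)
  also have "\<dots> = (\<Sum>S\<in>{{}}. ((\<Prod>k\<in>J - S. a k) * (\<Prod>k\<in>S. b k)) * expectation (\<lambda>\<omega>. \<Prod>k\<in>S. X k \<omega>))"
    by (rule sum.mono_neutral_right) (use J zero in auto)
  finally show ?thesis by (simp add: prob_space)
qed

text \<open>Every function of a sign is affine in it. The indicator of a joint event is therefore a
  polynomial in the signs, and all its nonconstant monomials have mean zero.\<close>

lemma (in prob_space) indep_vars_signs:
  assumes X: "\<And>k. k \<in> K \<Longrightarrow> X k \<in> borel_measurable M"
    and val: "\<And>k \<omega>. k \<in> K \<Longrightarrow> \<omega> \<in> space M \<Longrightarrow> X k \<omega> \<in> {-1, 1::real}"
    and zero: "\<And>S. finite S \<Longrightarrow> S \<subseteq> K \<Longrightarrow> S \<noteq> {} \<Longrightarrow> expectation (\<lambda>\<omega>. \<Prod>k\<in>S. X k \<omega>) = 0"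
  shows "indep_vars (\<lambda>_. borel) X K"
  unfolding indep_vars_def2
proof (intro conjI ballI indep_setsI)
  fix k assume k: "k \<in> K"
  then show "random_variable borel (X k)" by (rule X)
  then show "{X k -` A \<inter> space M |A. A \<in> sets borel} \<subseteq> events" by auto
next
  fix A J assume J: "J \<noteq> {}" "J \<subseteq> K" "finite J"
    and A: "\<forall>j\<in>J. A j \<in> {X j -` A \<inter> space M |A. A \<in> sets borel}"
  from A have "\<forall>j\<in>J. \<exists>B. A j = X j -` B \<inter> space M \<and> B \<in> sets borel" by auto
  then obtain B where B: "\<And>j. j \<in> J \<Longrightarrow> A j = X j -` B j \<inter> space M \<and> B j \<in> sets borel" by metis
  \<comment> \<open>Interpolation of the indicator at the two values 1 and -1; the constant part
    \<open>a j\<close> turns out to be the probability of the event.\<close>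
  define a where "a j = (indicator (B j) 1 + indicator (B j) (-1) :: real) / 2" for j
  define b where "b j = (indicator (B j) 1 - indicator (B j) (-1) :: real) / 2" for j
  have ev: "A j \<in> events" if "j \<in> J" for j using B[OF that] X J that by (auto intro: measurable_sets)
  have ind: "indicator (A j) \<omega> = a j + b j * X j \<omega>" if "j \<in> J" "\<omega> \<in> space M" for j \<omega>
    using B[OF that(1)] val[OF subsetD[OF J(2) that(1)] that(2)] that(2)
    by (auto simp: a_def b_def indicator_def)
  have key: "prob (\<Inter>j\<in>L. A j) = (\<Prod>j\<in>L. a j)" if L: "L \<subseteq> J" "L \<noteq> {}" for L
  proof -
    have fin: "finite L" using L J(3) finite_subset by blast
    have sub: "(\<Inter>j\<in>L. A j) \<in> events" using fin L ev by (intro sets.finite_INT) auto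
    have "prob (\<Inter>j\<in>L. A j) = expectation (indicator (\<Inter>j\<in>L. A j))"
      using sub by (simp add: sets.Int_space_eq2)
    also have "\<dots> = expectation (\<lambda>\<omega>. \<Prod>j\<in>L. (a j + b j * X j \<omega>))"
    proof (rule Bochner_Integration.integral_cong[OF refl])
      fix \<omega> assume "\<omega> \<in> space M"
      then have "(\<Prod>j\<in>L. (a j + b j * X j \<omega>)) = (\<Prod>j\<in>L. indicator (A j) \<omega>)"
        using ind L by (intro prod.cong) auto
      also have "\<dots> = indicator (\<Inter>j\<in>L. A j) \<omega>"
        using fin by (induction L rule: finite_induct) (auto simp: indicator_def)
      finally show "indicator (\<Inter>j\<in>L. A j) \<omega> = (\<Prod>j\<in>L. (a j + b j * X j \<omega>))" by simp
    qed
    also have "\<dots> = (\<Prod>j\<in>L. a j)"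
    proof (rule expectation_prod_affine_signs[OF fin])
      have LK: "L \<subseteq> K" using L J by blast
      show "X k \<in> borel_measurable M" if "k \<in> L" for k using X subsetD[OF LK that] .
      show "X k \<omega> \<in> {-1, 1}" if "k \<in> L" "\<omega> \<in> space M" for k \<omega>
        using val[OF subsetD[OF LK that(1)] that(2)] .
      show "expectation (\<lambda>\<omega>. \<Prod>k\<in>S. X k \<omega>) = 0" if "S \<subseteq> L" "S \<noteq> {}" for S
        using zero[OF finite_subset[OF that(1) fin] subset_trans[OF that(1) LK] that(2)] .
    qed
    finally show ?thesis .
  qed
  have "prob (A j) = a j" if "j \<in> J" for j using key[of "{j}"] that by simp
  then show "prob (\<Inter>j\<in>J. A j) = (\<Prod>j\<in>J. prob (A j))" using key[of J] J by simp
qed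

section \<open>Integrals against the standard normal law\<close>

lemma integral_std_normal_odd:
  fixes f :: "real \<Rightarrow> real"
  assumes [measurable]: "f \<in> borel_measurable borel" and "\<And>x. f (- x) = - f x"
  shows "(LINT x|std_normal_distribution. f x) = 0"
proof -
  let ?I = "LINT x|lborel. std_normal_density x * f x"
  have "?I = (LINT x|lborel. std_normal_density (0 + (-1) * x) * f (0 + (-1) * x))"
    using lborel_integral_real_affine[of "-1" "\<lambda>x. std_normal_density x * f x" 0] by simp
  also have "\<dots> = - ?I" by (simp add: assms std_normal_density_def)
  finally show ?thesis by (simp add: integral_density normal_density_nonneg)
qed

lemma integrable_std_normal_bounded:
  fixes f :: "real \<Rightarrow> 'b::{banach, second_countable_topology}"
  assumes "f \<in> borel_measurable borel" and "\<And>x. norm (f x) \<le> B"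
  shows "integrable std_normal_distribution f"
proof -
  interpret prob_space std_normal_distribution by (rule prob_space_normal_density) simp
  show ?thesis using assms by (intro integrable_const_bound[of _ B]) auto
qed

section \<open>Normal variables with a prescribed sign\<close>

text \<open>Conditionally on its sign being \<open>u\<close>, a standard normal variable has the characteristic function
  \<open>exp (- s\<^sup>2 / 2) * (1 + \<i> u tilt s)\<close>.\<close>

definition half_sine :: "real \<Rightarrow> real" where
  "half_sine s = (LINT x|std_normal_distribution. sgn x * sin (s * x))"

definition tilt :: "real \<Rightarrow> real" where
  "tilt s = exp (s\<^sup>2 / 2) * half_sine s"

lemma tilt_0 [simp]: "tilt 0 = 0"
  by (simp add: tilt_def half_sine_def)

lemma tilt_minus: "tilt (- s) = - tilt s"
  by (simp add: tilt_def half_sine_def)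

lemma sin_ge_minus_square: "x - x\<^sup>2 / 2 \<le> sin x" if "0 \<le> x" for x :: real
proof -
  have c: "1 - t \<le> cos t" if "0 \<le> t" for t :: real
  proof -
    have "\<exists>y. ((\<lambda>t. cos t + t) has_real_derivative y) (at u) \<and> 0 \<le> y" for u :: real
      by (intro exI[of _ "- sin u + 1"] conjI) (auto intro!: derivative_eq_intros)
    then have "cos 0 + 0 \<le> cos t + t"
      using that by (intro DERIV_nonneg_imp_nondecreasing[where f = "\<lambda>t. cos t + t"]) auto
    then show ?thesis by simp
  qed
  have "\<exists>y. ((\<lambda>t. sin t - t + t\<^sup>2 / 2) has_real_derivative y) (at u) \<and> 0 \<le> y" if "0 \<le> u" for u :: real
    using c[OF that] by (intro exI[of _ "cos u - 1 + u"] conjI) (auto intro!: derivative_eq_intros)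
  then have "sin 0 - 0 + 0\<^sup>2 / 2 \<le> sin x - x + x\<^sup>2 / 2"
    using that by (intro DERIV_nonneg_imp_nondecreasing[where f = "\<lambda>t. sin t - t + t\<^sup>2 / 2"]) auto
  then show ?thesis by simp
qed

text \<open>To first order \<open>half_sine s\<close> is \<open>s\<close> times the mean of
  \<bar>x\<bar>, which is \<open>sqrt (2 / pi)\<close> and at least 1/2. The error is at most
  \<open>s\<^sup>2 / 2\<close>, hence at most \<open>s / 4\<close> on this range, and the
  exponential factor of \<open>tilt\<close> is at least 1.\<close>

lemma tilt_ge: "s / 4 \<le> tilt s" if s: "0 \<le> s" "s \<le> 1/2" for s
proof -
  interpret prob_space std_normal_distribution by (rule prob_space_normal_density) simp
  have i1: "integrable std_normal_distribution (\<lambda>x. \<bar>x\<bar>)"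
    using integrable_abs[OF integrable_std_normal_distribution_moment[of 1]] by simp
  have i2: "integrable std_normal_distribution (\<lambda>x. x\<^sup>2)"
    by (rule integrable_std_normal_distribution_moment)
  have m2: "(LINT x|std_normal_distribution. x\<^sup>2) = 1"
    using std_normal_distribution_even_moments_abs[of 1] by (simp add: power_even_abs)
  have m1: "(LINT x|std_normal_distribution. \<bar>x\<bar>) = sqrt (2 / pi)"
    using std_normal_distribution_odd_moments_abs[of 0] by simp
  have "1 / 2 \<le> sqrt (2 / pi)"
  proof (rule real_le_rsqrt)
    show "(1 / 2)\<^sup>2 \<le> 2 / pi" using pi_less_4 pi_gt_zero by (simp add: field_simps power2_eq_square)
  qed
  have "s / 4 \<le> s * (1/2) - s\<^sup>2 / 2 * 1"
    using s mult_left_mono[of s "1/2" s] by (simp add: power2_eq_square)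
  also have "\<dots> \<le> s * (LINT x|std_normal_distribution. \<bar>x\<bar>) - s\<^sup>2 / 2 * (LINT x|std_normal_distribution. x\<^sup>2)"
    unfolding m1 m2 using \<open>1 / 2 \<le> sqrt (2 / pi)\<close> s by (intro diff_right_mono mult_left_mono) auto
  also have "\<dots> = (LINT x|std_normal_distribution. s * \<bar>x\<bar> - s\<^sup>2 / 2 * x\<^sup>2)"
    using i1 i2 by simp
  also have "\<dots> \<le> half_sine s" unfolding half_sine_def
  proof (rule integral_mono)
    show "integrable std_normal_distribution (\<lambda>x. s * \<bar>x\<bar> - s\<^sup>2 / 2 * x\<^sup>2)" using i1 i2 by simp
    show "integrable std_normal_distribution (\<lambda>x. sgn x * sin (s * x))"
      by (rule integrable_std_normal_bounded[of _ 1]) (auto simp: abs_mult sgn_if)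
    fix x :: real
    have "sgn x * sin (s * x) = sin (s * \<bar>x\<bar>)" by (simp add: sgn_if abs_if)
    then show "s * \<bar>x\<bar> - s\<^sup>2 / 2 * x\<^sup>2 \<le> sgn x * sin (s * x)"
      using sin_ge_minus_square[of "s * \<bar>x\<bar>"] s by (simp add: power_mult_distrib)
  qed
  finally have hs: "s / 4 \<le> half_sine s" .
  then have "1 * half_sine s \<le> exp (s\<^sup>2 / 2) * half_sine s"
    using s by (intro mult_right_mono) auto
  then show ?thesis using hs by (simp add: tilt_def)
qed

lemma iexp_conv_cos_sin: "iexp a = of_real (cos a) + \<i> * of_real (sin a)"
  by (simp add: complex_eq_iff Re_exp Im_exp)

lemma integral_std_normal_iexp:
  "(CLINT x|std_normal_distribution. iexp (t * x)) = exp (- (t\<^sup>2) / 2)"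
  using char_std_normal_distribution by (simp add: char_def fun_eq_iff)

lemma integral_std_normal_sgn_iexp:
  "(CLINT x|std_normal_distribution. of_real (sgn x) * iexp (t * x)) = \<i> * of_real (half_sine t)"
proof -
  have "(CLINT x|std_normal_distribution. of_real (sgn x) * iexp (t * x)) =
      (CLINT x|std_normal_distribution. of_real (sgn x * cos (t * x)) + \<i> * of_real (sgn x * sin (t * x)))"
  proof (rule Bochner_Integration.integral_cong[OF refl])
    fix x :: real
    show "of_real (sgn x) * iexp (t * x) = of_real (sgn x * cos (t * x)) + \<i> * of_real (sgn x * sin (t * x))"
      unfolding iexp_conv_cos_sin by (simp add: algebra_simps)
  qed
  also have "\<dots> = of_real (LINT x|std_normal_distribution. sgn x * cos (t * x)) +
      \<i> * of_real (half_sine t)" unfolding half_sine_def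
    by (subst Bochner_Integration.integral_add)
      (auto simp del: of_real_mult intro!: integrable_std_normal_bounded[of _ 1] integrable_mult_right simp: abs_mult sgn_if)
  also have "(LINT x|std_normal_distribution. sgn x * cos (t * x)) = 0"
    by (rule integral_std_normal_odd) auto
  finally show ?thesis by simp
qed

lemma integral_std_normal_cos:
  "(LINT x|std_normal_distribution. cos (t * x)) = exp (- (t\<^sup>2) / 2)"
proof -
  have "of_real (LINT x|std_normal_distribution. cos (t * x)) =
      (CLINT x|std_normal_distribution. of_real (cos (t * x)))" by simp
  also have "\<dots> = (CLINT x|std_normal_distribution. (iexp (t * x) + iexp ((-t) * x)) / 2)"
  proof (rule Bochner_Integration.integral_cong[OF refl])
    fix x :: real
    show "of_real (cos (t * x)) = (iexp (t * x) + iexp ((-t) * x)) / 2"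
      unfolding iexp_conv_cos_sin by simp
  qed
  also have "\<dots> = complex_of_real (exp (- (t\<^sup>2) / 2))"
  proof -
    have "integrable std_normal_distribution (\<lambda>x. iexp (u * x))" for u
      by (rule integrable_std_normal_bounded[of _ 1]) auto
    from Bochner_Integration.integral_add[OF this[of t] this[of "-t"]]
    show ?thesis
      unfolding integral_divide_zero integral_std_normal_iexp by simp
  qed
  finally show ?thesis by (simp only: of_real_eq_iff)
qed

section \<open>Weak limits and moments\<close>

text \<open>Beyond \<open>K\<close> the square is at most \<open>x ^ 6 / K ^ 4\<close>. So a bound
  on sixth moments controls, uniformly over all laws, what truncation takes away from second
  moments.\<close>

lemma min_square_ge:
  fixes x :: real
  assumes "0 < K"
  shows "x\<^sup>2 - x ^ 6 / K ^ 4 \<le> min (x\<^sup>2) (K\<^sup>2)"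
proof (cases "x\<^sup>2 \<le> K\<^sup>2")
  case True
  then show ?thesis by (simp add: min_def)
next
  case False
  then have "K\<^sup>2 * K\<^sup>2 \<le> x\<^sup>2 * x\<^sup>2" by (intro mult_mono) auto
  then have "x\<^sup>2 * K ^ 4 \<le> x\<^sup>2 * (x\<^sup>2 * x\<^sup>2)"
    by (intro mult_left_mono) (auto simp: power2_eq_square numeral_eq_Suc mult.assoc)
  also have "\<dots> = x ^ 6" by (simp add: power2_eq_square numeral_eq_Suc)
  finally have "x\<^sup>2 \<le> x ^ 6 / K ^ 4" using assms by (simp add: field_simps)
  moreover have "0 \<le> min (x\<^sup>2) (K\<^sup>2)" by simp
  ultimately show ?thesis by linarith
qed

lemma clamp_error:
  fixes x :: real
  assumes "0 < K"
  shows "\<bar>x - max (-K) (min x K)\<bar> \<le> x\<^sup>2 / K"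
proof (cases "\<bar>x\<bar> \<le> K")
  case True then show ?thesis using assms by (auto simp: max_def min_def)
next
  case False
  have "\<bar>x - max (-K) (min x K)\<bar> \<le> \<bar>x\<bar>" using assms by (auto simp: max_def min_def)
  also have "\<bar>x\<bar> \<le> \<bar>x\<bar> * \<bar>x\<bar> / K"
    using mult_right_mono[of K "\<bar>x\<bar>" "\<bar>x\<bar>"] False assms by (simp add: field_simps)
  finally show ?thesis by (simp add: power2_eq_square)
qed

lemma (in real_distribution) integrable_power_le_6:
  assumes "integrable M (\<lambda>x. x ^ 6)" and "k \<le> 6"
  shows "integrable M (\<lambda>x. x ^ k)"
proof (rule Bochner_Integration.integrable_bound[where f = "\<lambda>x. 1 + x ^ 6"])
  show "integrable M (\<lambda>x. 1 + x ^ 6)" using assms by simp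
  have "\<bar>x\<bar> ^ k \<le> 1 + \<bar>x\<bar> ^ 6" for x :: real
  proof (cases "\<bar>x\<bar> \<le> 1")
    case True then have "\<bar>x\<bar> ^ k \<le> 1" by (simp add: power_le_one)
    then show ?thesis by (smt (verit) zero_le_power abs_ge_zero)
  next
    case False then have "\<bar>x\<bar> ^ k \<le> \<bar>x\<bar> ^ 6" using assms by (intro power_increasing) auto
    then show ?thesis by simp
  qed
  then show "AE x in M. norm (x ^ k) \<le> norm (1 + x ^ 6)"
    by (simp add: power_abs power_even_abs[of 6])
qed simp

text \<open>Weak convergence only passes bounded continuous integrands. Monotone truncation bounds
  the sixth moment of the limit; this bound makes the truncation errors \<open>C / K ^ 4\<close> for
  the square and \<open>1 / K\<close> for the mean uniform, so these two moments pass exactly, while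
  the sixth may drop.\<close>

lemma weak_limit_moments:
  fixes \<nu> :: "nat \<Rightarrow> real measure"
  assumes \<nu>: "\<And>i. real_distribution (\<nu> i)" and \<mu>: "real_distribution \<mu>"
    and conv: "weak_conv_m \<nu> \<mu>"
    and int: "\<And>i. integrable (\<nu> i) (\<lambda>x. x ^ 6)"
    and mean: "\<And>i. (LINT x|\<nu> i. x) = 0" and var: "\<And>i. (LINT x|\<nu> i. x\<^sup>2) = 1"
    and six: "eventually (\<lambda>i. (LINT x|\<nu> i. x ^ 6) \<le> C) sequentially"
  shows "integrable \<mu> (\<lambda>x. x ^ 6)" "(LINT x|\<mu>. x ^ 6) \<le> C" "(LINT x|\<mu>. x\<^sup>2) = 1" "(LINT x|\<mu>. x) = 0"
proof -
  interpret N: real_distribution "\<nu> i" for i by (rule \<nu>)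
  interpret M: real_distribution \<mu> by (rule \<mu>)
  have conv_int: "(\<lambda>i. LINT x|\<nu> i. f x) \<longlonglongrightarrow> (LINT x|\<mu>. f x)"
    if "\<And>x. isCont f x" "\<And>x. \<bar>f x\<bar> \<le> B" for f :: "real \<Rightarrow> real" and B
    using that by (intro weak_conv_imp_integral_bdd_continuous_conv[OF \<nu> \<mu> conv, of f B]) auto
  have Nint: "integrable (\<nu> i) (\<lambda>x. x)" "integrable (\<nu> i) (\<lambda>x. x\<^sup>2)" for i
    using N.integrable_power_le_6[OF int, of 1] N.integrable_power_le_6[OF int, of 2] by simp_all
  obtain i0 where "(LINT x|\<nu> i0. x ^ 6) \<le> C"
    using eventually_happens[OF six] by auto
  moreover have "0 \<le> (LINT x|\<nu> i0. x ^ 6)" by (intro integral_nonneg_AE) simp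
  ultimately have C: "0 \<le> C" by (rule order_trans[rotated])
  have trunc6: "(LINT x|\<mu>. min (x ^ 6) (real n)) \<le> C" for n :: nat
  proof (rule LIMSEQ_le_const2)
    show "(\<lambda>i. LINT x|\<nu> i. min (x ^ 6) (real n)) \<longlonglongrightarrow> (LINT x|\<mu>. min (x ^ 6) (real n))"
      by (rule conv_int[of _ "real n"]) (intro continuous_min continuous_max continuous_power continuous_ident continuous_const, simp add: min_def)
    have "eventually (\<lambda>i. (LINT x|\<nu> i. min (x ^ 6) (real n)) \<le> C) sequentially"
      using six
    proof eventually_elim
      fix i assume "(LINT x|\<nu> i. x ^ 6) \<le> C"
      moreover have "(LINT x|\<nu> i. min (x ^ 6) (real n)) \<le> (LINT x|\<nu> i. x ^ 6)"
        by (rule integral_mono) (auto intro!: int N.integrable_const_bound[of _ "real n"])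
      ultimately show "(LINT x|\<nu> i. min (x ^ 6) (real n)) \<le> C" by simp
    qed
    then show "\<exists>N. \<forall>i\<ge>N. (LINT x|\<nu> i. min (x ^ 6) (real n)) \<le> C"
      by (simp add: eventually_sequentially)
  qed
  have nn: "(\<integral>\<^sup>+x. ennreal (x ^ 6) \<partial>\<mu>) \<le> ennreal C"
  proof -
    have "(\<integral>\<^sup>+x. ennreal (x ^ 6) \<partial>\<mu>) = (\<integral>\<^sup>+x. (SUP n. ennreal (min (x ^ 6) (real n))) \<partial>\<mu>)"
    proof (rule nn_integral_cong)
      fix x :: real
      obtain n :: nat where n: "x ^ 6 \<le> real n" using real_arch_simple by blast
      have "ennreal (min (x ^ 6) (real n)) \<le> (SUP n. ennreal (min (x ^ 6) (real n)))" by (rule SUP_upper) simp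
      then have "ennreal (x ^ 6) \<le> (SUP n. ennreal (min (x ^ 6) (real n)))" using n by (simp add: min_def)
      moreover have "(SUP n. ennreal (min (x ^ 6) (real n))) \<le> ennreal (x ^ 6)"
        by (rule SUP_least) (auto intro!: ennreal_leI)
      ultimately show "ennreal (x ^ 6) = (SUP n. ennreal (min (x ^ 6) (real n)))" by (rule antisym)
    qed
    also have "\<dots> = (SUP n. \<integral>\<^sup>+x. ennreal (min (x ^ 6) (real n)) \<partial>\<mu>)"
      by (rule nn_integral_monotone_convergence_SUP)
        (auto simp: incseq_def le_fun_def intro!: ennreal_leI)
    also have "\<dots> \<le> ennreal C"
    proof (rule SUP_least)
      fix n :: nat
      have "(\<integral>\<^sup>+x. ennreal (min (x ^ 6) (real n)) \<partial>\<mu>) = ennreal (LINT x|\<mu>. min (x ^ 6) (real n))"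
        by (rule nn_integral_eq_integral) (auto intro!: M.integrable_const_bound[of _ "real n"])
      also have "\<dots> \<le> ennreal C" using trunc6 by (rule ennreal_leI)
      finally show "(\<integral>\<^sup>+x. ennreal (min (x ^ 6) (real n)) \<partial>\<mu>) \<le> ennreal C" .
    qed
    finally show ?thesis .
  qed
  show I6: "integrable \<mu> (\<lambda>x. x ^ 6)"
  proof (rule integrableI_bounded)
    show "(\<integral>\<^sup>+ x. ennreal (norm (x ^ 6)) \<partial>\<mu>) < \<infinity>"
      using nn le_less_trans[OF nn ennreal_less_top] by (simp add: power_even_abs)
  qed simp
  have "ennreal (LINT x|\<mu>. x ^ 6) \<le> ennreal C"
    using nn nn_integral_eq_integral[OF I6] by simp
  then show L6: "(LINT x|\<mu>. x ^ 6) \<le> C" using C by (simp add: ennreal_le_iff)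
  have I1: "integrable \<mu> (\<lambda>x. x)" and I2: "integrable \<mu> (\<lambda>x. x\<^sup>2)"
    using M.integrable_power_le_6[OF I6, of 1] M.integrable_power_le_6[OF I6, of 2] by simp_all
  have near2: "\<bar>(LINT x|\<mu>. x\<^sup>2) - 1\<bar> \<le> C / K ^ 4" if K: "0 < K" for K :: real
  proof -
    let ?f = "\<lambda>x::real. min (x\<^sup>2) (K\<^sup>2)"
    have lim: "(\<lambda>i. LINT x|\<nu> i. ?f x) \<longlonglongrightarrow> (LINT x|\<mu>. ?f x)"
      by (rule conv_int[of _ "K\<^sup>2"]) (intro continuous_min continuous_max continuous_power continuous_ident continuous_const, simp add: min_def)
    have bd: "(LINT x|\<rho>. x\<^sup>2) - D / K ^ 4 \<le> (LINT x|\<rho>. ?f x) \<and> (LINT x|\<rho>. ?f x) \<le> (LINT x|\<rho>. x\<^sup>2)"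
      if R: "real_distribution \<rho>" and i6: "integrable \<rho> (\<lambda>x. x ^ 6)" and D: "(LINT x|\<rho>. x ^ 6) \<le> D" for \<rho> D
    proof -
      interpret R: real_distribution \<rho> by (rule R)
      have i2: "integrable \<rho> (\<lambda>x. x\<^sup>2)" using R.integrable_power_le_6[OF i6, of 2] by simp
      have iK: "integrable \<rho> ?f" by (rule R.integrable_const_bound[of _ "K\<^sup>2"]) auto
      have "(LINT x|\<rho>. x\<^sup>2) - D / K ^ 4 \<le> (LINT x|\<rho>. x\<^sup>2) - (LINT x|\<rho>. x ^ 6) / K ^ 4"
        using D K by (simp add: divide_right_mono)
      also have "\<dots> = (LINT x|\<rho>. x\<^sup>2 - x ^ 6 / K ^ 4)" using i2 i6 by simp
      also have "\<dots> \<le> (LINT x|\<rho>. ?f x)"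
        by (rule integral_mono) (use i2 i6 iK min_square_ge[OF K] in auto)
      finally have "(LINT x|\<rho>. x\<^sup>2) - D / K ^ 4 \<le> (LINT x|\<rho>. ?f x)" .
      moreover have "(LINT x|\<rho>. ?f x) \<le> (LINT x|\<rho>. x\<^sup>2)"
        by (rule integral_mono) (use i2 iK in auto)
      ultimately show ?thesis by simp
    qed
    have "(LINT x|\<mu>. ?f x) \<le> 1"
    proof (rule LIMSEQ_le_const2[OF lim])
      show "\<exists>N. \<forall>i\<ge>N. (LINT x|\<nu> i. ?f x) \<le> 1" using bd[OF \<nu> int order_refl] var by auto
    qed
    moreover have "1 - C / K ^ 4 \<le> (LINT x|\<mu>. ?f x)"
    proof (rule LIMSEQ_le_const[OF lim])
      obtain N where "\<And>i. i \<ge> N \<Longrightarrow> (LINT x|\<nu> i. x ^ 6) \<le> C" using six by (auto simp: eventually_sequentially)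
      then have "1 - C / K ^ 4 \<le> (LINT x|\<nu> i. ?f x)" if "i \<ge> N" for i using bd[OF \<nu> int, of i C] var that by auto
      then show "\<exists>N. \<forall>i\<ge>N. 1 - C / K ^ 4 \<le> (LINT x|\<nu> i. ?f x)" by blast
    qed
    ultimately show ?thesis using bd[OF \<mu> I6 L6] by auto
  qed
  have lim4: "(\<lambda>n. C / real (Suc n) ^ 4) \<longlonglongrightarrow> 0"
  proof -
    have "(\<lambda>n. C * (1 / real (Suc n)) ^ 4) \<longlonglongrightarrow> C * 0 ^ 4"
      using LIMSEQ_inverse_real_of_nat by (intro tendsto_intros) (simp add: inverse_eq_divide)
    then show ?thesis by (simp add: power_divide)
  qed
  have "\<bar>(LINT x|\<mu>. x\<^sup>2) - 1\<bar> \<le> 0"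
    by (rule LIMSEQ_le_const[OF lim4]) (use near2 in \<open>auto intro!: exI[of _ 0]\<close>)
  then show V: "(LINT x|\<mu>. x\<^sup>2) = 1" by simp
  have near1: "\<bar>LINT x|\<mu>. x\<bar> \<le> 2 / K" if K: "0 < K" for K :: real
  proof -
    let ?f = "\<lambda>x::real. max (-K) (min x K)"
    have lim: "(\<lambda>i. LINT x|\<nu> i. ?f x) \<longlonglongrightarrow> (LINT x|\<mu>. ?f x)"
      by (rule conv_int[of _ K]) (intro continuous_min continuous_max continuous_power continuous_ident continuous_const, use K in \<open>auto simp: min_def max_def\<close>)
    have bd: "\<bar>(LINT x|\<rho>. x) - (LINT x|\<rho>. ?f x)\<bar> \<le> 1 / K"
      if R: "real_distribution \<rho>" and i1: "integrable \<rho> (\<lambda>x. x)" and i2: "integrable \<rho> (\<lambda>x. x\<^sup>2)"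
        and v: "(LINT x|\<rho>. x\<^sup>2) = 1" for \<rho>
    proof -
      interpret R: real_distribution \<rho> by (rule R)
      have iK: "integrable \<rho> ?f"
        by (rule R.integrable_const_bound[of _ K]) (use K in \<open>auto simp: min_def max_def\<close>)
      have "\<bar>(LINT x|\<rho>. x) - (LINT x|\<rho>. ?f x)\<bar> = \<bar>LINT x|\<rho>. x - ?f x\<bar>" using i1 iK by simp
      also have "\<dots> \<le> (LINT x|\<rho>. \<bar>x - ?f x\<bar>)" by (rule integral_abs_bound)
      also have "\<dots> \<le> (LINT x|\<rho>. x\<^sup>2 / K)"
        by (rule integral_mono) (use i1 i2 iK clamp_error[OF K] in auto)
      also have "\<dots> = 1 / K" using v by simp
      finally show ?thesis .
    qed
    have "\<bar>LINT x|\<mu>. ?f x\<bar> \<le> 1 / K"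
      by (rule LIMSEQ_le_const2[OF tendsto_rabs[OF lim]])
        (use bd[OF \<nu> Nint var] mean in \<open>auto intro!: exI[of _ 0]\<close>)
    then show ?thesis using bd[OF \<mu> I1 I2 V] by (simp add: field_simps)
  qed
  have lim1: "(\<lambda>n. 2 / real (Suc n)) \<longlonglongrightarrow> 0"
    using tendsto_mult[OF tendsto_const[of 2] LIMSEQ_inverse_real_of_nat] by (simp add: inverse_eq_divide)
  have "\<bar>LINT x|\<mu>. x\<bar> \<le> 0"
    by (rule LIMSEQ_le_const[OF lim1]) (use near1 in \<open>auto intro!: exI[of _ 0]\<close>)
  then show "(LINT x|\<mu>. x) = 0" by simp
qed

text \<open>A point mass with mean 0 has second moment 0, and the only normal law with mean 0 and
  variance 1 has sixth moment 15.\<close>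

lemma nondegenerate_not_normal_if_moments:
  assumes "(LINT x|\<mu>. x) = 0" "(LINT x|\<mu>. x\<^sup>2) = 1" "(LINT x|\<mu>. x ^ 6) < 15"
  shows "nondegenerate \<mu>" "\<not> normal_law \<mu>"
proof -
  show "nondegenerate \<mu>" unfolding nondegenerate_def
  proof
    assume "\<exists>c. \<mu> = return borel c"
    then obtain c where "\<mu> = return borel c" ..
    then have "(LINT x|\<mu>. x) = c" "(LINT x|\<mu>. x\<^sup>2) = c\<^sup>2" by (simp_all add: integral_return)
    then show False using assms by simp
  qed
  show "\<not> normal_law \<mu>" unfolding normal_law_def
  proof
    assume "\<exists>m \<sigma>. \<sigma> > 0 \<and> \<mu> = density lborel (\<lambda>x. ennreal (normal_density m \<sigma> x))"
    then obtain m \<sigma> :: real where \<sigma>: "0 < \<sigma>" and \<mu>: "\<mu> = density lborel (\<lambda>x. ennreal (normal_density m \<sigma> x))"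
      by blast
    have eq: "(LINT x|\<mu>. f x) = (LINT x|lborel. normal_density m \<sigma> x * f x)"
      if "f \<in> borel_measurable borel" for f :: "real \<Rightarrow> real"
      using that unfolding \<mu> by (simp add: integral_density normal_density_nonneg)
    have "m = 0" using eq[of "\<lambda>x. x"] integral_normal_moment_nz_1[OF \<sigma>, of m] assms(1) by simp
    have "(LINT x|lborel. normal_density m \<sigma> x * x\<^sup>2) = \<sigma>\<^sup>2"
      using integral_normal_moment_even[OF \<sigma>, of m 1] \<open>m = 0\<close> \<sigma>
      by (simp add: field_simps power2_eq_square)
    then have "\<sigma>\<^sup>2 = 1" using eq[of "\<lambda>x. x\<^sup>2"] assms(2) by simp
    have "(LINT x|lborel. normal_density m \<sigma> x * x ^ 6) = 15"
      using integral_normal_moment_even[OF \<sigma>, of m 3] \<open>m = 0\<close> \<open>\<sigma>\<^sup>2 = 1\<close> by (simp add: fact_numeral)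
    then show False using eq[of "\<lambda>x. x ^ 6"] assms(3) by simp
  qed
qed

lemma tight_if_second_moment:
  fixes \<nu> :: "nat \<Rightarrow> real measure"
  assumes \<nu>: "\<And>i. real_distribution (\<nu> i)" and int: "\<And>i. integrable (\<nu> i) (\<lambda>x. x\<^sup>2)"
    and var: "\<And>i. (LINT x|\<nu> i. x\<^sup>2) \<le> 1"
  shows "tight \<nu>"
  unfolding tight_def
proof (intro conjI allI impI)
  fix \<epsilon> :: real assume \<epsilon>: "0 < \<epsilon>"
  \<comment> \<open>Chosen so that Chebyshev's inequality bounds the tail by
    \<open>\<epsilon> / 2\<close>, which leaves room for the strict inequality.\<close>
  define K where "K = sqrt (2 / \<epsilon>)"
  have K: "0 < K" "K\<^sup>2 = 2 / \<epsilon>" using \<epsilon> by (simp_all add: K_def)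
  have "1 - \<epsilon> < measure (\<nu> i) {-K - 1<..K}" for i
  proof -
    interpret N: real_distribution "\<nu> i" by (rule \<nu>)
    have "N.prob {x \<in> space (\<nu> i). x\<^sup>2 \<ge> K\<^sup>2} \<le> (LINT x|\<nu> i. x\<^sup>2) / K\<^sup>2"
      by (rule integral_Markov_inequality_measure[where A = "space (\<nu> i)"]) (use int K \<epsilon> in auto)
    also have "\<dots> \<le> \<epsilon> / 2" using var[of i] \<epsilon> unfolding K by (simp add: field_simps)
    finally have P: "N.prob {x. x\<^sup>2 \<ge> K\<^sup>2} \<le> \<epsilon> / 2" by simp
    have "1 - N.prob {x. x\<^sup>2 \<ge> K\<^sup>2} = N.prob (space (\<nu> i) - {x. x\<^sup>2 \<ge> K\<^sup>2})"
      by (rule N.prob_compl[symmetric]) simp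
    also have "\<dots> \<le> N.prob {-K - 1<..K}"
    proof (rule N.finite_measure_mono)
      show "space (\<nu> i) - {x. x\<^sup>2 \<ge> K\<^sup>2} \<subseteq> {-K - 1<..K}"
      proof
        fix x assume "x \<in> space (\<nu> i) - {x. x\<^sup>2 \<ge> K\<^sup>2}"
        then have "x\<^sup>2 < K\<^sup>2" by simp
        then have "\<bar>x\<bar> < K" using K(1) power2_less_imp_less[of "\<bar>x\<bar>" K] by simp
        then show "x \<in> {-K - 1<..K}" by auto
      qed
    qed simp
    finally show ?thesis using P \<epsilon> by simp
  qed
  then show "\<exists>a b. a < b \<and> (\<forall>n. 1 - \<epsilon> < measure (\<nu> n) {a<..b})"
    using K(1) by (intro exI[of _ "-K - 1"] exI[of _ K]) auto
qed (rule \<nu>)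

text \<open>Convergence along a set is stated through \<open>enumerate\<close>; this recovers a
  subsequence from its range.\<close>

lemma enumerate_range_strict_mono:
  assumes "strict_mono (s :: nat \<Rightarrow> nat)"
  shows "enumerate (range s) i = s i"
proof (induction i rule: less_induct)
  case (less i)
  have inf: "infinite (range s)" using assms by (simp add: range_inj_infinite strict_mono_imp_inj_on)
  show ?case
  proof (cases i)
    case 0
    have "(LEAST x. x \<in> range s) = s 0"
      by (rule Least_equality) (use assms in \<open>auto simp: strict_mono_less_eq\<close>)
    then show ?thesis by (simp add: enumerate_0 0)
  next
    case (Suc j)
    have "(LEAST x. x \<in> range s \<and> enumerate (range s) j < x) = s (Suc j)"
      by (rule Least_equality)
        (use assms less[of j] in \<open>auto simp: Suc strict_mono_less strict_mono_less_eq\<close>)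
    then show ?thesis using enumerate_Suc''[OF inf, of j] by (simp add: Suc)
  qed
qed

section \<open>Window sums\<close>

definition win :: "nat \<Rightarrow> int \<Rightarrow> real" where
  "win l x = of_bool (0 \<le> x \<and> x < int l)"

lemma win_reflect: "win l x = win l (int l - 1 - x)"
  by (auto simp: win_def)

lemma sum_backward_window:
  assumes "finite J" "\<And>t. t < l \<Longrightarrow> x - int t \<in> J"
  shows "(\<Sum>t<l. f (x - int t)) = (\<Sum>j\<in>J. win l (x - j) * f j)"
proof -
  have "(\<Sum>t<l. f (x - int t)) = (\<Sum>j\<in>(\<lambda>t. x - int t) ` {..<l}. f j)"
    by (subst sum.reindex) (auto simp: inj_on_def)
  also have "\<dots> = (\<Sum>j\<in>(\<lambda>t. x - int t) ` {..<l}. win l (x - j) * f j)"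
    by (intro sum.cong) (auto simp: win_def)
  also have "\<dots> = (\<Sum>j\<in>J. win l (x - j) * f j)"
  proof (rule sum.mono_neutral_left)
    show "\<forall>j\<in>J - (\<lambda>t. x - int t) ` {..<l}. win l (x - j) * f j = 0"
    proof
      fix j assume j: "j \<in> J - (\<lambda>t. x - int t) ` {..<l}"
      have "\<not> (0 \<le> x - j \<and> x - j < int l)"
      proof
        assume "0 \<le> x - j \<and> x - j < int l"
        then have "j = x - int (nat (x - j))" "nat (x - j) < l" by auto
        then show False using j by blast
      qed
      then show "win l (x - j) * f j = 0" by (simp add: win_def)
    qed
  qed (use assms in auto)
  finally show ?thesis .
qed

lemma sum_forward_window:
  assumes "finite J" "\<And>t. t < l \<Longrightarrow> x + int t \<in> J"
  shows "(\<Sum>t<l. f (x + int t)) = (\<Sum>j\<in>J. win l (j - x) * f j)"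
proof -
  have "(\<Sum>t<l. f (x + int t)) = (\<Sum>j\<in>(\<lambda>t. x + int t) ` {..<l}. f j)"
    by (subst sum.reindex) (auto simp: inj_on_def)
  also have "\<dots> = (\<Sum>j\<in>(\<lambda>t. x + int t) ` {..<l}. win l (j - x) * f j)"
    by (intro sum.cong) (auto simp: win_def)
  also have "\<dots> = (\<Sum>j\<in>J. win l (j - x) * f j)"
  proof (rule sum.mono_neutral_left)
    show "\<forall>j\<in>J - (\<lambda>t. x + int t) ` {..<l}. win l (j - x) * f j = 0"
    proof
      fix j assume j: "j \<in> J - (\<lambda>t. x + int t) ` {..<l}"
      have "\<not> (0 \<le> j - x \<and> j - x < int l)"
      proof
        assume "0 \<le> j - x \<and> j - x < int l"
        then have "j = x + int (nat (j - x))" "nat (j - x) < l" by auto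
        then show False using j by blast
      qed
      then show "win l (j - x) * f j = 0" by (simp add: win_def)
    qed
  qed (use assms in auto)
  finally show ?thesis .
qed

lemma shift_bounds:
  assumes "c < 36"
  shows "k - 36 * int l \<le> k - (int c + 1) * int l" "k - (int c + 1) * int l \<le> k - int l"
proof -
  have "int c * int l \<le> 35 * int l" "0 \<le> int c * int l"
    using assms by (auto intro: mult_right_mono)
  moreover have "(int c + 1) * int l = int c * int l + int l" by (simp add: distrib_right)
  ultimately show "k - 36 * int l \<le> k - (int c + 1) * int l" "k - (int c + 1) * int l \<le> k - int l"
    by linarith+
qed

text \<open>The tent function: the autocorrelation of a window of length \<open>l\<close>, as
  \<open>sum_win_win\<close> shows.\<close>

definition overlap :: "nat \<Rightarrow> int \<Rightarrow> real" where
  "overlap l d = max 0 (real l - \<bar>real_of_int d\<bar>)"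

lemma overlap_nonneg: "0 \<le> overlap l d"
  by (simp add: overlap_def)

lemma sum_win_win:
  assumes "finite J" "\<And>t. t < l \<Longrightarrow> x - int t \<in> J"
  shows "(\<Sum>j\<in>J. win l (x - j) * win l (y - j)) = overlap l (x - y)"
proof -
  have "(\<Sum>j\<in>J. win l (x - j) * win l (y - j)) = (\<Sum>t<l. win l (y - (x - int t)))"
    by (rule sum_backward_window[OF assms, symmetric])
  also have "\<dots> = real (card {t. t < l \<and> 0 \<le> y - x + int t \<and> y - x + int t < int l})"
    unfolding win_def by (subst sum.inter_filter[symmetric, simplified of_bool_def[symmetric]] sum_of_bool_eq)
      (auto intro!: arg_cong[where f = card] simp: algebra_simps)
  also have "{t. t < l \<and> 0 \<le> y - x + int t \<and> y - x + int t < int l} =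
      {nat (x - y)..<nat (int l - max 0 (y - x))}"
    by auto
  also have "real (card \<dots>) = overlap l (x - y)"
    by (auto simp: overlap_def max_def)
  finally show ?thesis .
qed

text \<open>Lagrange's identity for \<open>x\<close> and the constant vector 1.\<close>

lemma sum_squared_differences:
  fixes x :: "nat \<Rightarrow> real"
  shows "(\<Sum>b<n. \<Sum>a<b. (x a - x b)\<^sup>2) = real n * (\<Sum>a<n. (x a)\<^sup>2) - (\<Sum>a<n. x a)\<^sup>2"
proof (induction n)
  case (Suc n)
  have "(\<Sum>a<n. (x a - x n)\<^sup>2) = (\<Sum>a<n. (x a)\<^sup>2) - 2 * x n * (\<Sum>a<n. x a) + real n * (x n)\<^sup>2"
    by (simp add: power2_diff sum.distrib sum_subtractf sum_distrib_left algebra_simps)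
  then show ?case using Suc by (simp add: algebra_simps power2_sum)
qed simp

text \<open>If every point \<open>k\<close> of \<open>S\<close> sums a noise over the
  \<open>l\<close> sites ending at \<open>k\<close>, with weight \<open>\<epsilon> k\<close>, this
  is the total weight that the site \<open>x\<close> receives.\<close>

definition wsum :: "(int \<Rightarrow> real) \<Rightarrow> int set \<Rightarrow> nat \<Rightarrow> int \<Rightarrow> real" where
  "wsum \<epsilon> S l x = (\<Sum>k\<in>S. \<epsilon> k * win l (k - x))"

text \<open>The variance of the weighted sum over \<open>S\<close> of averages of a white noise over
  the \<open>l\<close> sites ending at each point.\<close>

definition energy :: "(int \<Rightarrow> real) \<Rightarrow> int set \<Rightarrow> nat \<Rightarrow> real" where
  "energy \<epsilon> S l = (\<Sum>k\<in>S. \<Sum>k'\<in>S. \<epsilon> k * \<epsilon> k' * overlap l (k - k')) / (real l)\<^sup>2"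

lemma sum_wsum_square:
  assumes "finite J" "\<And>k t. k \<in> S \<Longrightarrow> t < l \<Longrightarrow> k - x - int t \<in> J"
  shows "(\<Sum>j\<in>J. (wsum \<epsilon> S l (j + x))\<^sup>2) = (\<Sum>k\<in>S. \<Sum>k'\<in>S. \<epsilon> k * \<epsilon> k' * overlap l (k - k'))"
proof -
  have "(\<Sum>j\<in>J. (wsum \<epsilon> S l (j + x))\<^sup>2) =
      (\<Sum>j\<in>J. \<Sum>k\<in>S. \<Sum>k'\<in>S. \<epsilon> k * \<epsilon> k' * (win l (k - x - j) * win l (k' - x - j)))"
    by (simp add: wsum_def power2_eq_square sum_product algebra_simps)
  also have "\<dots> = (\<Sum>k\<in>S. \<Sum>k'\<in>S. \<epsilon> k * \<epsilon> k' * (\<Sum>j\<in>J. win l (k - x - j) * win l (k' - x - j)))"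
    by (subst sum.swap, rule sum.cong[OF refl], subst sum.swap) (simp add: sum_distrib_left)
  also have "\<dots> = (\<Sum>k\<in>S. \<Sum>k'\<in>S. \<epsilon> k * \<epsilon> k' * overlap l (k - k'))"
    using assms by (intro sum.cong refl) (subst sum_win_win, auto)
  finally show ?thesis .
qed

lemma win_split:
  "(\<Sum>a<n. win l (x - int a * int l)) = win (n * l) x"
proof (induction n)
  case (Suc n)
  have "win (Suc n * l) x = win (n * l) x + win l (x - int n * int l)"
  proof -
    obtain y where y: "y = int n * int l" "0 \<le> y" by simp
    have "int (n * l) = y" "int (Suc n * l) = y + int l"
      by (simp_all add: distrib_right y)
    then show ?thesis unfolding win_def y(1)[symmetric] using y(2) by auto
  qed
  then show ?case using Suc by simp
qed (simp add: win_def)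

lemma sum_wsum:
  "(\<Sum>a<n. wsum \<epsilon> S l (x + int a * int l)) = wsum \<epsilon> S (n * l) x"
proof -
  have "(\<Sum>a<n. wsum \<epsilon> S l (x + int a * int l)) = (\<Sum>k\<in>S. \<epsilon> k * (\<Sum>a<n. win l (k - x - int a * int l)))"
    unfolding wsum_def by (subst sum.swap) (simp add: sum_distrib_left algebra_simps)
  then show ?thesis by (simp add: win_split wsum_def)
qed

definition pairs :: "(nat \<times> nat) set" where
  "pairs = (SIGMA b:{..<36}. {..<b})"

lemma finite_pairs [simp]: "finite pairs"
  by (simp add: pairs_def)

lemma sum_pairs: "(\<Sum>(b, a)\<in>pairs. f a b) = (\<Sum>b<36. \<Sum>a<b. f a b)"
  unfolding pairs_def by (subst sum.Sigma) auto

definition coef :: "(int \<Rightarrow> real) \<Rightarrow> int set \<Rightarrow> nat \<Rightarrow> nat \<Rightarrow> nat \<Rightarrow> int \<Rightarrow> real" where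
  "coef \<epsilon> S l a b j =
    (wsum \<epsilon> S l (j + (int a + 1) * int l) - wsum \<epsilon> S l (j + (int b + 1) * int l)) / (36 * real l)"

text \<open>Lagrange's identity makes the variances telescope over the lengths \<open>l = 36 ^ m\<close>.\<close>

lemma sum_coef_square:
  assumes J: "finite J" and l: "0 < l"
    and cov: "\<And>k x. k \<in> S \<Longrightarrow> k - 38 * int l \<le> x \<Longrightarrow> x \<le> k \<Longrightarrow> x \<in> J"
  shows "(\<Sum>(b, a)\<in>pairs. \<Sum>j\<in>J. (coef \<epsilon> S l a b j)\<^sup>2) = energy \<epsilon> S l - energy \<epsilon> S (36 * l)"
proof -
  let ?N = "\<lambda>j a. wsum \<epsilon> S l (j + (int a + 1) * int l)"
  have A: "(\<Sum>j\<in>J. (?N j a)\<^sup>2) = (real l)\<^sup>2 * energy \<epsilon> S l" if "a < 36" for a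
  proof -
    have "(\<Sum>j\<in>J. (?N j a)\<^sup>2) = (\<Sum>k\<in>S. \<Sum>k'\<in>S. \<epsilon> k * \<epsilon> k' * overlap l (k - k'))"
    proof (rule sum_wsum_square[OF J])
      fix k t assume "k \<in> S" "t < l"
      then show "k - (int a + 1) * int l - int t \<in> J"
        using shift_bounds[OF that, of k l] by (intro cov[of k]) linarith+
    qed
    then show ?thesis using l by (simp add: energy_def)
  qed
  have cov': "k - int l - int t \<in> J" if "k \<in> S" "t < 36 * l" for k t
    using that by (intro cov[of k]) auto
  \<comment> \<open>The 36 consecutive windows glue to one window of length \<open>36 * l\<close>,
    so the square subtracted in Lagrange's identity is the energy of the next scale.\<close>
  have B: "(\<Sum>j\<in>J. (\<Sum>a<36. ?N j a)\<^sup>2) = (real (36 * l))\<^sup>2 * energy \<epsilon> S (36 * l)"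
  proof -
    have "(\<Sum>a<36. ?N j a) = wsum \<epsilon> S (36 * l) (j + int l)" for j
      using sum_wsum[of \<epsilon> S l "j + int l" 36] by (simp add: algebra_simps)
    then have "(\<Sum>j\<in>J. (\<Sum>a<36. ?N j a)\<^sup>2) = (\<Sum>k\<in>S. \<Sum>k'\<in>S. \<epsilon> k * \<epsilon> k' * overlap (36 * l) (k - k'))"
      by (simp only:) (rule sum_wsum_square[OF J], rule cov')
    then show ?thesis using l by (simp add: energy_def)
  qed
  have "(\<Sum>(b, a)\<in>pairs. \<Sum>j\<in>J. (coef \<epsilon> S l a b j)\<^sup>2) =
      (\<Sum>j\<in>J. \<Sum>b<36. \<Sum>a<b. (?N j a - ?N j b)\<^sup>2) / (36 * real l)\<^sup>2"
    unfolding sum_pairs coef_def power_divide sum_divide_distrib[symmetric]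
    by (simp add: sum.swap[of _ J])
  also have "(\<Sum>j\<in>J. \<Sum>b<36. \<Sum>a<b. (?N j a - ?N j b)\<^sup>2) =
      36 * (\<Sum>a<36. \<Sum>j\<in>J. (?N j a)\<^sup>2) - (\<Sum>j\<in>J. (\<Sum>a<36. ?N j a)\<^sup>2)"
    unfolding sum_squared_differences sum_subtractf sum_distrib_left[symmetric]
    by (subst sum.swap) simp
  also have "\<dots> = 36 * (36 * ((real l)\<^sup>2 * energy \<epsilon> S l)) - (real (36 * l))\<^sup>2 * energy \<epsilon> S (36 * l)"
    unfolding B by (simp add: A)
  also have "\<dots> / (36 * real l)\<^sup>2 = energy \<epsilon> S l - energy \<epsilon> S (36 * l)"
    using l by (simp add: field_simps power2_eq_square)
  finally show ?thesis .
qed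

text \<open>The upper end of the telescoping sum: windows of length one at distinct points do not
  overlap, and the total variance is that of independent standard variables.\<close>

lemma energy_1: "energy \<epsilon> S 1 = (\<Sum>k\<in>S. (\<epsilon> k)\<^sup>2)" if "finite S"
proof -
  have "overlap 1 d = of_bool (d = 0)" for d by (auto simp: overlap_def max_def)
  then have "\<epsilon> k * \<epsilon> k' * overlap 1 (k - k') = (if k' = k then (\<epsilon> k)\<^sup>2 else 0)" for k k'
    by (simp add: power2_eq_square)
  then show ?thesis using that by (simp add: energy_def sum.delta)
qed

lemma energy_singleton: "0 < l \<Longrightarrow> energy \<epsilon> {k} l = (\<epsilon> k)\<^sup>2 / real l"
  by (simp add: energy_def overlap_def power2_eq_square)

lemma energy_bound:
  assumes "finite S" "0 < l"
  shows "\<bar>energy \<epsilon> S l\<bar> \<le> (\<Sum>k\<in>S. \<bar>\<epsilon> k\<bar>)\<^sup>2 / real l"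
proof -
  have "\<bar>\<Sum>k\<in>S. \<Sum>k'\<in>S. \<epsilon> k * \<epsilon> k' * overlap l (k - k')\<bar> \<le>
      (\<Sum>k\<in>S. \<Sum>k'\<in>S. \<bar>\<epsilon> k\<bar> * \<bar>\<epsilon> k'\<bar> * real l)"
    by (intro order_trans[OF sum_abs] sum_mono) (auto simp: abs_mult overlap_def max_def intro!: mult_left_mono)
  also have "\<dots> = (\<Sum>k\<in>S. \<bar>\<epsilon> k\<bar>)\<^sup>2 * real l"
    unfolding power2_eq_square sum_product by (simp add: sum_distrib_right)
  finally show ?thesis using assms
    by (simp add: energy_def field_simps power2_eq_square abs_mult)
qed

section \<open>The filtered noises\<close>

text \<open>Labels of the independent variables at a site: \<open>Inl 0\<close> is the coin that decides the sign,
  \<open>Inl (Suc m)\<close> decides whether the site is marked at scale \<open>m\<close>, and \<open>Inr (m, q)\<close> is a Gaussian of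
  scale \<open>m\<close>: the noise of the window pair \<open>(a, b)\<close> if \<open>q = 36 * a + b < 1296\<close>, and the raw material
  of the six hidden variables if \<open>q = 1296 + i\<close>.\<close>

type_synonym label = "nat + nat \<times> nat"

definition len :: "nat \<Rightarrow> nat" where "len m = 36 ^ m"

lemma len_pos [simp]: "0 < len m" by (simp add: len_def)

lemma len_neq_0 [simp]: "len m \<noteq> 0" by (simp add: len_def)

lemma len_Suc: "len (Suc m) = 36 * len m" by (simp add: len_def)

definition mark :: "nat \<Rightarrow> int \<Rightarrow> (int \<times> label \<Rightarrow> real) \<Rightarrow> bool" where
  "mark m j z \<longleftrightarrow> z (j, Inl (Suc m)) < 1 / (100 * real (len m))"

text \<open>Active sites are more than \<open>50 * len m\<close> apart, so that a point sees at most one of them.\<close>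

definition active :: "nat \<Rightarrow> int \<Rightarrow> (int \<times> label \<Rightarrow> real) \<Rightarrow> bool" where
  "active m j z \<longleftrightarrow> mark m j z \<and> (\<forall>d\<in>{1..50 * len m}. \<not> mark m (j - int d) z)"

lemma active_separated:
  assumes "active m \<gamma> z" "active m \<gamma>' z" "\<gamma> < \<gamma>'"
  shows "50 * int (len m) < \<gamma>' - \<gamma>"
proof (rule ccontr)
  assume "\<not> ?thesis"
  then have "nat (\<gamma>' - \<gamma>) \<in> {1..50 * len m}" "\<gamma> = \<gamma>' - int (nat (\<gamma>' - \<gamma>))" using assms(3) by auto
  then show False using assms by (metis active_def)
qed

definition gauss :: "nat \<Rightarrow> nat \<Rightarrow> int \<Rightarrow> (int \<times> label \<Rightarrow> real) \<Rightarrow> real" where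
  "gauss m q j z = z (j, Inr (m, q))"

text \<open>The sixth variable takes its size from its own Gaussian and its sign, with a minus, from
  the other five; this sign is symmetric and independent of the size, so the law stays standard
  normal.\<close>

definition hid :: "nat \<Rightarrow> nat \<Rightarrow> int \<Rightarrow> (int \<times> label \<Rightarrow> real) \<Rightarrow> real" where
  "hid m i j z = (if i < 5 then gauss m (1296 + i) j z
     else - (\<Prod>i'<5. sgn (gauss m (1296 + i') j z)) * \<bar>gauss m (1296 + 5) j z\<bar>)"

text \<open>On the block of an active site the average of the noise is exchanged for a hidden variable of
  the same law.\<close>

definition wmod :: "nat \<Rightarrow> nat \<Rightarrow> nat \<Rightarrow> int \<Rightarrow> (int \<times> label \<Rightarrow> real) \<Rightarrow> real" where
  "wmod m a b j z = gauss m (36 * a + b) j z +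
    (\<Sum>i<6. if a = 2 * i \<and> b = 34 - 2 * i then
       \<Sum>d<len m. of_bool (active m (j - int d) z) *
         (hid m i (j - int d) z / sqrt (len m)
           - (\<Sum>t<len m. gauss m (36 * a + b) (j - int d + int t) z) / len m)
     else 0)"

text \<open>The windows begin one length behind \<open>k\<close>, hence the \<open>+ 1\<close>: the
  block of an active site covering \<open>j\<close> may extend \<open>len m - 1\<close> sites beyond
  \<open>j\<close>, and this margin keeps all of it at or before \<open>k\<close>. The divisor gives
  variance \<open>35 / (36 * len m)\<close>, and these variances sum to 1 over all
  \<open>m\<close>.\<close>

definition level :: "nat \<Rightarrow> int \<Rightarrow> (int \<times> label \<Rightarrow> real) \<Rightarrow> real" where
  "level m k z = (\<Sum>(b, a)\<in>pairs. \<Sum>t<len m.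
      wmod m a b (k - (int a + 1) * int (len m) - int t) z
    - wmod m a b (k - (int b + 1) * int (len m) - int t) z) / (36 * real (len m))"

text \<open>The weight with which the \<open>i\<close>-th hidden variable of an active site enters the level at
  distance \<open>x\<close> from it.\<close>

definition ker :: "nat \<Rightarrow> nat \<Rightarrow> int \<Rightarrow> real" where
  "ker l i x = (overlap l (int l - 1 - (x - (2 * int i + 1) * int l))
    - overlap l (int l - 1 - (x - (35 - 2 * int i) * int l))) / (36 * real l * sqrt (real l))"

definition kersum :: "(int \<Rightarrow> real) \<Rightarrow> int set \<Rightarrow> nat \<Rightarrow> nat \<Rightarrow> int \<Rightarrow> real" where
  "kersum \<epsilon> S l i \<gamma> = (\<Sum>k\<in>S. \<epsilon> k * ker l i (k - \<gamma>))"

text \<open>The selected window indices are even, with \<open>a\<close> increasing and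
  \<open>b\<close> decreasing in \<open>i\<close>. The tents, of width twice the window length, then
  sit at distinct odd offsets \<open>a + 1\<close> and \<open>b + 1\<close>, each pair nested in the
  one before.\<close>

definition used :: "nat \<Rightarrow> nat \<Rightarrow> nat \<Rightarrow> bool" where
  "used i a b \<longleftrightarrow> i < 6 \<and> a = 2 * i \<and> b = 34 - 2 * i"

lemma used_cases:
  obtains "\<And>i. \<not> used i a b" | i where "used i a b" "\<And>i'. used i' a b \<longleftrightarrow> i' = i"
  by (auto simp: used_def)

lemma sum_used: "(\<Sum>i<6. if a = 2 * i \<and> b = 34 - 2 * i then f i else 0) = (\<Sum>i<6. if used i a b then f i else (0::real))"
  by (rule sum.cong) (auto simp: used_def)

lemma sum_used_single: "used i a b \<Longrightarrow> (\<Sum>i'<6. if used i' a b then f i' else 0) = (f i::real)"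
proof -
  assume u: "used i a b"
  then have "(\<Sum>i'<6. if used i' a b then f i' else 0) = (\<Sum>i'<6. if i' = i then f i' else 0)"
    by (intro sum.cong) (auto simp: used_def)
  also have "\<dots> = f i" using u by (simp add: used_def sum.delta)
  finally show ?thesis .
qed

lemma sum_pairs_used: "(\<Sum>(b, a)\<in>pairs. \<Sum>i<6. if used i a b then f i else 0) = (\<Sum>i<6. f i::real)"
proof -
  have "(\<Sum>(b, a)\<in>pairs. \<Sum>i<6. if used i a b then f i else 0) =
      (\<Sum>i<6. \<Sum>p\<in>pairs. if used i (snd p) (fst p) then f i else 0)"
    unfolding case_prod_beta by (rule sum.swap)
  also have "\<dots> = (\<Sum>i<6. \<Sum>p\<in>pairs. if p = (34 - 2 * i, 2 * i) then f i else 0)"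
    by (intro sum.cong refl if_cong) (auto simp: used_def)
  also have "\<dots> = (\<Sum>i<6. f i)"
    by (intro sum.cong) (auto simp: sum.delta pairs_def)
  finally show ?thesis .
qed

text \<open>The weight left to a Gaussian after the exchange at the active sites \<open>A\<close>:
  the projection of \<open>coef\<close> onto the indicators of their blocks has been
  subtracted.\<close>

definition wcoef :: "(int \<Rightarrow> real) \<Rightarrow> int set \<Rightarrow> nat \<Rightarrow> int set \<Rightarrow> nat \<Rightarrow> nat \<Rightarrow> int \<Rightarrow> real" where
  "wcoef \<epsilon> S l A a b j = coef \<epsilon> S l a b j -
    (\<Sum>i<6. if used i a b then (\<Sum>\<gamma>\<in>A. kersum \<epsilon> S l i \<gamma> * win l (j - \<gamma>)) / sqrt l else 0)"

text \<open>A point reaches back at most \<open>37 * len m\<close> sites and a block needs one more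
  length, so all sums over sites can be taken over the fixed range from \<open>-R\<close> to
  \<open>R\<close>.\<close>

context
  fixes \<epsilon> :: "int \<Rightarrow> real" and S :: "int set" and B :: int and m :: nat and R :: int
  assumes S: "finite S" "\<And>k. k \<in> S \<Longrightarrow> \<bar>k\<bar> \<le> B"
    and R: "B + 40 * int (len m) \<le> R"
begin

lemma coef_eq_0_outside:
  assumes "b < 36" "a < 36" "coef \<epsilon> S (len m) a b j \<noteq> 0"
  shows "- R + 2 * int (len m) \<le> j \<and> j \<le> R - 2 * int (len m)"
proof -
  have "\<exists>k\<in>S. \<exists>c<36. win (len m) (k - (j + (int c + 1) * int (len m))) \<noteq> 0"
  proof (rule ccontr)
    assume "\<not> ?thesis"
    then have "wsum \<epsilon> S (len m) (j + (int c + 1) * int (len m)) = 0" if "c < 36" for c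
      using that by (auto simp: wsum_def intro!: sum.neutral)
    then show False using assms by (simp add: coef_def)
  qed
  then obtain k c where k: "k \<in> S" "c < (36::nat)"
    "0 \<le> k - (j + (int c + 1) * int (len m))" "k - (j + (int c + 1) * int (len m)) < int (len m)"
    by (auto simp: win_def split: if_splits)
  have "k - (int c + 1) * int (len m) - int (len m) < j" "j \<le> k - (int c + 1) * int (len m)"
    using k(3,4) by linarith+
  then show ?thesis using shift_bounds[OF k(2), of k "len m"] S(2)[OF k(1)] R by linarith
qed

text \<open>Pairing the weights with a block convolves two windows, which produces the tents in
  \<open>ker\<close>; \<open>sqrt (len m)\<close> is the Euclidean norm of the indicator of a
  block.\<close>

lemma kersum_conv:
  assumes "used i a b"
  shows "(\<Sum>j\<in>{-R..R}. win (len m) (j - \<gamma>) * coef \<epsilon> S (len m) a b j) =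
    sqrt (len m) * kersum \<epsilon> S (len m) i \<gamma>"
proof -
  let ?l = "len m"
  have u: "i < 6" "a = 2 * i" "b = 34 - 2 * i" using assms by (auto simp: used_def)
  have w: "(\<Sum>j\<in>{-R..R}. win ?l (j - \<gamma>) * win ?l (k - (j + (int c + 1) * int ?l))) =
      overlap ?l (int ?l - 1 - (k - \<gamma> - (int c + 1) * int ?l))" if "c < 36" "k \<in> S" for c k
  proof -
    have "win ?l (j - \<gamma>) = win ?l (\<gamma> + int ?l - 1 - j)" for j
      by (subst win_reflect) (simp add: algebra_simps)
    then have "(\<Sum>j\<in>{-R..R}. win ?l (j - \<gamma>) * win ?l (k - (j + (int c + 1) * int ?l))) =
        (\<Sum>j\<in>{-R..R}. win ?l (k - (int c + 1) * int ?l - j) * win ?l (\<gamma> + int ?l - 1 - j))"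
      by (intro sum.cong refl) (simp add: algebra_simps)
    also have "\<dots> = overlap ?l (k - (int c + 1) * int ?l - (\<gamma> + int ?l - 1))"
    proof (rule sum_win_win)
      fix t assume "t < ?l"
      then show "k - (int c + 1) * int ?l - int t \<in> {-R..R}"
        using shift_bounds[OF that(1), of k ?l] S(2)[OF that(2)] R unfolding atLeastAtMost_iff by linarith
    qed simp
    also have "\<dots> = overlap ?l (int ?l - 1 - (k - \<gamma> - (int c + 1) * int ?l))"
      by (simp add: overlap_def abs_minus_commute algebra_simps)
    finally show ?thesis .
  qed
  have ab: "a < 36" "b < 36" "int a + 1 = 2 * int i + 1" "int b + 1 = 35 - 2 * int i" using u by auto
  have "(\<Sum>j\<in>{-R..R}. win ?l (j - \<gamma>) * coef \<epsilon> S ?l a b j) =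
     (\<Sum>k\<in>S. \<epsilon> k * ((\<Sum>j\<in>{-R..R}. win ?l (j - \<gamma>) * win ?l (k - (j + (int a + 1) * int ?l)))
        - (\<Sum>j\<in>{-R..R}. win ?l (j - \<gamma>) * win ?l (k - (j + (int b + 1) * int ?l))))) / (36 * real ?l)"
    unfolding coef_def wsum_def sum_subtractf[symmetric] times_divide_eq_right sum_divide_distrib[symmetric]
      sum_distrib_left right_diff_distrib
    by (subst sum.swap) (simp add: sum_subtractf sum_distrib_left algebra_simps)
  also have "\<dots> = (\<Sum>k\<in>S. \<epsilon> k * (sqrt ?l * (ker ?l i (k - \<gamma>) * (36 * real ?l)))) / (36 * real ?l)"
    by (intro arg_cong2[where f = "(/)"] sum.cong refl) (simp add: w ab(1,2) ker_def ab(3,4)[symmetric])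
  also have "\<dots> = sqrt ?l * kersum \<epsilon> S ?l i \<gamma>"
    by (simp add: kersum_def sum_distrib_left sum_distrib_right sum_divide_distrib algebra_simps)
  finally show ?thesis .
qed

lemma kersum_eq_0_outside:
  assumes "used i a b" "kersum \<epsilon> S (len m) i \<gamma> \<noteq> 0" "t < len m"
  shows "\<gamma> + int t \<in> {-R..R}"
proof -
  have "(\<Sum>j\<in>{-R..R}. win (len m) (j - \<gamma>) * coef \<epsilon> S (len m) a b j) \<noteq> 0"
    using kersum_conv[OF assms(1)] assms(2) by simp
  then obtain j where j: "win (len m) (j - \<gamma>) * coef \<epsilon> S (len m) a b j \<noteq> 0" by (meson sum.neutral)
  have "a < 36" "b < 36" using assms(1) by (auto simp: used_def)
  then have "- R + 2 * int (len m) \<le> j \<and> j \<le> R - 2 * int (len m)"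
    using j by (intro coef_eq_0_outside[of b a j]) auto
  moreover have "0 \<le> j - \<gamma> \<and> j - \<gamma> < int (len m)" using j by (auto simp: win_def)
  ultimately show ?thesis using assms(3) by auto
qed

text \<open>With the set of active sites frozen, the level becomes a linear form in independent
  objects: the Gaussians with weights \<open>wcoef\<close>, and the hidden variables of each active
  site with weights \<open>kersum\<close>.\<close>

lemma sum_level_expand:
  fixes z :: "int \<times> label \<Rightarrow> real"
  defines "A \<equiv> {\<gamma> \<in> {-R..R}. active m \<gamma> z}"
  shows "(\<Sum>k\<in>S. \<epsilon> k * level m k z) =
    (\<Sum>(b, a)\<in>pairs. \<Sum>j\<in>{-R..R}. wcoef \<epsilon> S (len m) A a b j * gauss m (36 * a + b) j z) +
    (\<Sum>\<gamma>\<in>A. \<Sum>i<6. kersum \<epsilon> S (len m) i \<gamma> * hid m i \<gamma> z)"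
proof -
  let ?l = "len m" and ?J = "{-R..R}" and ?c = "coef \<epsilon> S (len m)" and ?s = "kersum \<epsilon> S (len m)"
  have win_sum: "(\<Sum>k\<in>S. \<epsilon> k * (\<Sum>t<?l. f (k - (int c + 1) * int ?l - int t))) =
      (\<Sum>j\<in>?J. wsum \<epsilon> S ?l (j + (int c + 1) * int ?l) * f j)" if "c < 36" for c f
  proof -
    have "(\<Sum>t<?l. f (k - (int c + 1) * int ?l - int t)) =
        (\<Sum>j\<in>?J. win ?l (k - (j + (int c + 1) * int ?l)) * f j)" if "k \<in> S" for k
    proof -
      have "(\<Sum>t<?l. f (k - (int c + 1) * int ?l - int t)) =
          (\<Sum>j\<in>?J. win ?l (k - (int c + 1) * int ?l - j) * f j)"
      proof (rule sum_backward_window)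
        fix t assume "t < ?l"
        then show "k - (int c + 1) * int ?l - int t \<in> ?J"
          using shift_bounds[OF \<open>c < 36\<close>, of k ?l] S(2)[OF that] R unfolding atLeastAtMost_iff by linarith
      qed simp
      then show ?thesis by (simp add: algebra_simps)
    qed
    then have "(\<Sum>k\<in>S. \<epsilon> k * (\<Sum>t<?l. f (k - (int c + 1) * int ?l - int t))) =
        (\<Sum>k\<in>S. \<Sum>j\<in>?J. \<epsilon> k * win ?l (k - (j + (int c + 1) * int ?l)) * f j)"
      by (intro sum.cong refl) (simp add: sum_distrib_left mult.assoc)
    also have "\<dots> = (\<Sum>j\<in>?J. wsum \<epsilon> S ?l (j + (int c + 1) * int ?l) * f j)"
      by (subst sum.swap) (simp add: wsum_def sum_distrib_right)
    finally show ?thesis .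
  qed
  have pair: "(\<Sum>j\<in>?J. ?c a b j * wmod m a b j z) =
      (\<Sum>j\<in>?J. wcoef \<epsilon> S ?l A a b j * gauss m (36 * a + b) j z) +
      (\<Sum>i<6. if used i a b then \<Sum>\<gamma>\<in>A. ?s i \<gamma> * hid m i \<gamma> z else 0)" if ab: "a < 36" "b < 36" for a b
  proof (cases rule: used_cases[of a b])
    case 1
    then show ?thesis by (simp add: wcoef_def wmod_def sum_used)
  next
    case (2 i)
    let ?g = "\<lambda>j. gauss m (36 * a + b) j z"
    define F where "F \<gamma> = hid m i \<gamma> z / sqrt ?l - (\<Sum>t<?l. ?g (\<gamma> + int t)) / ?l" for \<gamma>
    have wm: "wmod m a b j z = ?g j + (\<Sum>d<?l. of_bool (active m (j - int d) z) * F (j - int d))" for j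
      unfolding wmod_def sum_used sum_used_single[OF 2(1)] F_def ..
    have t1: "?c a b j * (\<Sum>d<?l. of_bool (active m (j - int d) z) * F (j - int d)) =
        (\<Sum>\<gamma>\<in>?J. win ?l (j - \<gamma>) * ?c a b j * (of_bool (active m \<gamma> z) * F \<gamma>))" for j
    proof (cases "?c a b j = 0")
      case False
      then have "- R + 2 * int ?l \<le> j \<and> j \<le> R - 2 * int ?l" using coef_eq_0_outside ab by blast
      then have "(\<Sum>d<?l. of_bool (active m (j - int d) z) * F (j - int d)) =
          (\<Sum>\<gamma>\<in>?J. win ?l (j - \<gamma>) * (of_bool (active m \<gamma> z) * F \<gamma>))"
        by (intro sum_backward_window[where f = "\<lambda>\<gamma>. of_bool (active m \<gamma> z) * F \<gamma>"]) auto
      then show ?thesis by (simp add: sum_distrib_left algebra_simps)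
    qed simp
    have t2: "?s i \<gamma> * sqrt ?l * F \<gamma> =
        ?s i \<gamma> * hid m i \<gamma> z - (\<Sum>j\<in>?J. ?s i \<gamma> * win ?l (j - \<gamma>) * ?g j) / sqrt ?l" for \<gamma>
    proof (cases "?s i \<gamma> = 0")
      case False
      have "(\<Sum>t<?l. ?g (\<gamma> + int t)) = (\<Sum>j\<in>?J. win ?l (j - \<gamma>) * ?g j)"
        by (rule sum_forward_window) (use kersum_eq_0_outside[OF 2(1) False] in auto)
      then have "?s i \<gamma> * sqrt ?l * F \<gamma> = ?s i \<gamma> * hid m i \<gamma> z -
          ?s i \<gamma> * (\<Sum>j\<in>?J. win ?l (j - \<gamma>) * ?g j) * (sqrt ?l / ?l)"
        by (simp add: F_def algebra_simps)
      also have "sqrt ?l / ?l = 1 / sqrt ?l"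
        by (simp add: field_simps)
      finally show ?thesis by (simp add: sum_distrib_left mult.assoc)
    qed simp
    have "(\<Sum>j\<in>?J. ?c a b j * wmod m a b j z) =
        (\<Sum>j\<in>?J. ?c a b j * ?g j) +
        (\<Sum>j\<in>?J. \<Sum>\<gamma>\<in>?J. win ?l (j - \<gamma>) * ?c a b j * (of_bool (active m \<gamma> z) * F \<gamma>))"
      unfolding wm distrib_left sum.distrib t1 ..
    also have "(\<Sum>j\<in>?J. \<Sum>\<gamma>\<in>?J. win ?l (j - \<gamma>) * ?c a b j * (of_bool (active m \<gamma> z) * F \<gamma>)) =
        (\<Sum>\<gamma>\<in>?J. (\<Sum>j\<in>?J. win ?l (j - \<gamma>) * ?c a b j) * (of_bool (active m \<gamma> z) * F \<gamma>))"
      by (subst sum.swap) (simp add: sum_distrib_right)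
    also have "\<dots> = (\<Sum>\<gamma>\<in>?J. if active m \<gamma> z then ?s i \<gamma> * sqrt ?l * F \<gamma> else 0)"
      unfolding kersum_conv[OF 2(1)] by (intro sum.cong) (auto simp: mult.commute)
    also have "\<dots> = (\<Sum>\<gamma>\<in>A. ?s i \<gamma> * sqrt ?l * F \<gamma>)"
      unfolding A_def by (rule sum.inter_filter[symmetric]) simp
    also have "\<dots> = (\<Sum>\<gamma>\<in>A. ?s i \<gamma> * hid m i \<gamma> z) -
        (\<Sum>\<gamma>\<in>A. \<Sum>j\<in>?J. ?s i \<gamma> * win ?l (j - \<gamma>) * ?g j) / sqrt ?l"
      unfolding t2 by (simp add: sum_subtractf sum_divide_distrib)
    also have "(\<Sum>\<gamma>\<in>A. \<Sum>j\<in>?J. ?s i \<gamma> * win ?l (j - \<gamma>) * ?g j) / sqrt ?l =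
        (\<Sum>j\<in>?J. (\<Sum>\<gamma>\<in>A. ?s i \<gamma> * win ?l (j - \<gamma>)) / sqrt ?l * ?g j)"
      by (subst sum.swap) (simp add: sum_distrib_right sum_divide_distrib)
    finally show ?thesis
      unfolding wcoef_def sum_used_single[OF 2(1)] by (simp add: left_diff_distrib sum_subtractf)
  qed
  have "(\<Sum>k\<in>S. \<epsilon> k * level m k z) = (\<Sum>k\<in>S. \<Sum>p\<in>pairs. (case p of (b, a) \<Rightarrow> \<epsilon> k *
      ((\<Sum>t<?l. wmod m a b (k - (int a + 1) * int ?l - int t) z)
       - (\<Sum>t<?l. wmod m a b (k - (int b + 1) * int ?l - int t) z)) / (36 * real ?l)))"
    unfolding level_def case_prod_beta
    by (simp only: sum_subtractf[where A = "{..<len m}"] sum_distrib_left[where A = pairs]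
        sum_divide_distrib[where A = pairs] times_divide_eq_right)
  also have "\<dots> = (\<Sum>(b, a)\<in>pairs. \<Sum>j\<in>?J. ?c a b j * wmod m a b j z)"
  proof (subst sum.swap, rule sum.cong[OF refl], clarsimp)
    fix b a assume "(b, a) \<in> pairs"
    then have ab: "a < 36" "b < 36" by (auto simp: pairs_def)
    show "(\<Sum>k\<in>S. \<epsilon> k * ((\<Sum>t<?l. wmod m a b (k - (int a + 1) * int ?l - int t) z)
       - (\<Sum>t<?l. wmod m a b (k - (int b + 1) * int ?l - int t) z)) / (36 * real ?l)) =
      (\<Sum>j\<in>?J. ?c a b j * wmod m a b j z)"
      using win_sum[OF ab(1), of "\<lambda>j. wmod m a b j z"] win_sum[OF ab(2), of "\<lambda>j. wmod m a b j z"]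
      by (simp add: sum_divide_distrib[symmetric] right_diff_distrib sum_subtractf coef_def left_diff_distrib)
  qed
  also have "\<dots> = (\<Sum>(b, a)\<in>pairs. (\<Sum>j\<in>?J. wcoef \<epsilon> S ?l A a b j * gauss m (36 * a + b) j z) +
      (\<Sum>i<6. if used i a b then \<Sum>\<gamma>\<in>A. ?s i \<gamma> * hid m i \<gamma> z else 0))"
    by (rule sum.cong[OF refl]) (auto simp: pairs_def intro!: pair)
  also have "\<dots> = (\<Sum>(b, a)\<in>pairs. \<Sum>j\<in>?J. wcoef \<epsilon> S ?l A a b j * gauss m (36 * a + b) j z) +
      (\<Sum>i<6. \<Sum>\<gamma>\<in>A. ?s i \<gamma> * hid m i \<gamma> z)"
    using sum_pairs_used[of "\<lambda>i. \<Sum>\<gamma>\<in>A. ?s i \<gamma> * hid m i \<gamma> z"]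
    by (simp add: case_prod_beta sum.distrib)
  also have "(\<Sum>i<6. \<Sum>\<gamma>\<in>A. ?s i \<gamma> * hid m i \<gamma> z) = (\<Sum>\<gamma>\<in>A. \<Sum>i<6. ?s i \<gamma> * hid m i \<gamma> z)"
    by (rule sum.swap)
  finally show ?thesis .
qed

text \<open>Pythagoras: blocks of separated sites are disjoint, so their normalised indicators are
  orthonormal and removing the projections lowers the square sum by the squares of the inner
  products \<open>kersum\<close>. The hidden variables contribute exactly this amount again, so the
  total variance is the same for every \<open>A\<close>.\<close>

lemma sum_wcoef_square:
  assumes A: "finite A" and sep: "\<And>\<gamma> \<gamma>'. \<gamma> \<in> A \<Longrightarrow> \<gamma>' \<in> A \<Longrightarrow> \<gamma> < \<gamma>' \<Longrightarrow> int (len m) \<le> \<gamma>' - \<gamma>"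
  shows "(\<Sum>(b, a)\<in>pairs. \<Sum>j\<in>{-R..R}. (wcoef \<epsilon> S (len m) A a b j)\<^sup>2) =
    energy \<epsilon> S (len m) - energy \<epsilon> S (len (Suc m)) - (\<Sum>\<gamma>\<in>A. \<Sum>i<6. (kersum \<epsilon> S (len m) i \<gamma>)\<^sup>2)"
proof -
  let ?l = "len m" and ?J = "{-R..R}" and ?c = "coef \<epsilon> S (len m)" and ?s = "kersum \<epsilon> S (len m)"
  have pair: "(\<Sum>j\<in>?J. (wcoef \<epsilon> S ?l A a b j)\<^sup>2) = (\<Sum>j\<in>?J. (?c a b j)\<^sup>2) -
      (\<Sum>i<6. if used i a b then \<Sum>\<gamma>\<in>A. (?s i \<gamma>)\<^sup>2 else 0)" for a b
  proof (cases rule: used_cases[of a b])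
    case 1
    then show ?thesis by (simp add: wcoef_def)
  next
    case (2 i)
    define D where "D j = (\<Sum>\<gamma>\<in>A. ?s i \<gamma> * win ?l (j - \<gamma>))" for j
    have cm: "wcoef \<epsilon> S ?l A a b j = ?c a b j - D j / sqrt ?l" for j
      unfolding wcoef_def sum_used_single[OF 2(1)] D_def ..
    have cross: "(\<Sum>j\<in>?J. ?c a b j * D j) = sqrt ?l * (\<Sum>\<gamma>\<in>A. (?s i \<gamma>)\<^sup>2)"
    proof -
      have "(\<Sum>j\<in>?J. ?c a b j * D j) = (\<Sum>\<gamma>\<in>A. ?s i \<gamma> * (\<Sum>j\<in>?J. win ?l (j - \<gamma>) * ?c a b j))"
        unfolding D_def sum_distrib_left by (subst sum.swap) (simp add: algebra_simps)
      also have "\<dots> = sqrt ?l * (\<Sum>\<gamma>\<in>A. (?s i \<gamma>)\<^sup>2)"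
        unfolding kersum_conv[OF 2(1)] by (simp add: sum_distrib_left power2_eq_square algebra_simps)
      finally show ?thesis .
    qed
    have D2: "(D j)\<^sup>2 = (\<Sum>\<gamma>\<in>A. (?s i \<gamma>)\<^sup>2 * win ?l (j - \<gamma>))" for j
    proof -
      have "(D j)\<^sup>2 = (\<Sum>\<gamma>\<in>A. \<Sum>\<gamma>'\<in>A. ?s i \<gamma> * ?s i \<gamma>' * (win ?l (j - \<gamma>) * win ?l (j - \<gamma>')))"
        by (simp add: D_def power2_eq_square sum_product algebra_simps)
      also have "\<dots> = (\<Sum>\<gamma>\<in>A. \<Sum>\<gamma>'\<in>A. if \<gamma>' = \<gamma> then (?s i \<gamma>)\<^sup>2 * win ?l (j - \<gamma>) else 0)"
      proof (intro sum.cong refl)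
        fix \<gamma> \<gamma>' assume g: "\<gamma> \<in> A" "\<gamma>' \<in> A"
        consider "\<gamma>' = \<gamma>" | "int ?l \<le> \<gamma>' - \<gamma>" | "int ?l \<le> \<gamma> - \<gamma>'"
          using sep[OF g] sep[OF g(2,1)] by linarith
        then show "?s i \<gamma> * ?s i \<gamma>' * (win ?l (j - \<gamma>) * win ?l (j - \<gamma>')) =
            (if \<gamma>' = \<gamma> then (?s i \<gamma>)\<^sup>2 * win ?l (j - \<gamma>) else 0)"
          by cases (auto simp: win_def power2_eq_square)
      qed
      also have "\<dots> = (\<Sum>\<gamma>\<in>A. (?s i \<gamma>)\<^sup>2 * win ?l (j - \<gamma>))" using A by (simp add: sum.delta)
      finally show ?thesis .
    qed
    have wl: "(?s i \<gamma>)\<^sup>2 * (\<Sum>j\<in>?J. win ?l (j - \<gamma>)) = (?s i \<gamma>)\<^sup>2 * ?l" for \<gamma>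
    proof (cases "?s i \<gamma> = 0")
      case False
      have "(\<Sum>t<?l. (1::real)) = (\<Sum>j\<in>?J. win ?l (j - \<gamma>) * 1)"
        by (rule sum_forward_window) (use kersum_eq_0_outside[OF 2(1) False] in auto)
      then show ?thesis by simp
    qed simp
    have "(\<Sum>j\<in>?J. (D j)\<^sup>2) = (\<Sum>\<gamma>\<in>A. (?s i \<gamma>)\<^sup>2 * (\<Sum>j\<in>?J. win ?l (j - \<gamma>)))"
      unfolding D2 by (subst sum.swap) (simp add: sum_distrib_left)
    then have sq: "(\<Sum>j\<in>?J. (D j)\<^sup>2) = ?l * (\<Sum>\<gamma>\<in>A. (?s i \<gamma>)\<^sup>2)"
      unfolding wl by (simp add: sum_distrib_left mult.commute)
    have "(\<Sum>j\<in>?J. (wcoef \<epsilon> S ?l A a b j)\<^sup>2) =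
        (\<Sum>j\<in>?J. (?c a b j)\<^sup>2) - 2 * (\<Sum>j\<in>?J. ?c a b j * D j) / sqrt ?l + (\<Sum>j\<in>?J. (D j)\<^sup>2) / ?l"
      unfolding cm power2_diff
      by (simp add: sum.distrib sum_subtractf sum_divide_distrib sum_distrib_left power_divide algebra_simps)
    also have "\<dots> = (\<Sum>j\<in>?J. (?c a b j)\<^sup>2) - (\<Sum>\<gamma>\<in>A. (?s i \<gamma>)\<^sup>2)"
      unfolding cross sq by simp
    finally show ?thesis unfolding sum_used_single[OF 2(1)] .
  qed
  have "(\<Sum>(b, a)\<in>pairs. \<Sum>j\<in>?J. (wcoef \<epsilon> S ?l A a b j)\<^sup>2) =
      (\<Sum>(b, a)\<in>pairs. \<Sum>j\<in>?J. (?c a b j)\<^sup>2) -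
      (\<Sum>(b, a)\<in>pairs. \<Sum>i<6. if used i a b then \<Sum>\<gamma>\<in>A. (?s i \<gamma>)\<^sup>2 else 0)"
    unfolding pair by (simp add: case_prod_beta sum_subtractf)
  also have "(\<Sum>(b, a)\<in>pairs. \<Sum>j\<in>?J. (?c a b j)\<^sup>2) = energy \<epsilon> S ?l - energy \<epsilon> S (36 * ?l)"
  proof (rule sum_coef_square)
    fix k x assume "k \<in> S" "k - 38 * int ?l \<le> x" "x \<le> k"
    then show "x \<in> ?J" using S(2)[of k] R by auto
  qed auto
  also have "(\<Sum>(b, a)\<in>pairs. \<Sum>i<6. if used i a b then \<Sum>\<gamma>\<in>A. (?s i \<gamma>)\<^sup>2 else 0) =
      (\<Sum>\<gamma>\<in>A. \<Sum>i<6. (?s i \<gamma>)\<^sup>2)"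
    unfolding sum_pairs_used by (rule sum.swap)
  finally show ?thesis by (simp add: len_Suc)
qed

end

section \<open>The six kernels as nested pairs of tents\<close>

definition tent :: "nat \<Rightarrow> int \<Rightarrow> real" where
  "tent l y = tilt (overlap l (int l - 1 - y) / (36 * real l * sqrt (real l)))"

lemma tent_arg_bounds:
  assumes "0 < l"
  shows "0 \<le> overlap l d / (36 * real l * sqrt (real l))" "overlap l d / (36 * real l * sqrt (real l)) \<le> 1 / 2"
proof -
  have o: "0 \<le> overlap l d" "overlap l d \<le> real l" by (auto simp: overlap_def)
  then show "0 \<le> overlap l d / (36 * real l * sqrt (real l))" by simp
  have "real l * 1 \<le> real l * (18 * sqrt (real l))"
    using assms real_sqrt_ge_one[of "real l"] by (intro mult_left_mono) linarith+
  then have "overlap l d \<le> 18 * real l * sqrt (real l)" using o by linarith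
  then show "overlap l d / (36 * real l * sqrt (real l)) \<le> 1 / 2" using assms by (simp add: field_simps)
qed

lemma tent_ge: "0 < l \<Longrightarrow> overlap l (int l - 1 - y) / (144 * real l * sqrt (real l)) \<le> tent l y"
  using tilt_ge[OF tent_arg_bounds[of l "int l - 1 - y"]] by (simp add: tent_def)

lemma tent_nonneg: "0 < l \<Longrightarrow> 0 \<le> tent l y"
  by (rule order_trans[OF _ tent_ge]) (auto simp: overlap_nonneg)

lemma overlap_eq_0: "y < 0 \<or> 2 * int l \<le> y \<Longrightarrow> overlap l (int l - 1 - y) = 0"
proof -
  assume "y < 0 \<or> 2 * int l \<le> y"
  then have "int l \<le> \<bar>int l - 1 - y\<bar>" by auto
  then have "real_of_int (int l) \<le> real_of_int \<bar>int l - 1 - y\<bar>" by (simp only: of_int_le_iff)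
  then show ?thesis unfolding overlap_def by simp
qed

lemma tent_eq_0: "y < 0 \<or> 2 * int l \<le> y \<Longrightarrow> tent l y = 0"
  by (simp add: tent_def overlap_eq_0)

lemma mult_int_gap: "a + 2 \<le> b \<Longrightarrow> a * int l + 2 * int l \<le> b * int l"
  using mult_right_mono[of "a + 2" b "int l"] by (simp add: distrib_right)

text \<open>\<open>tilt\<close> is not linear, but the two tents of a kernel have disjoint supports,
  and \<open>tilt\<close> is odd and vanishes at 0; so it acts on each tent separately.\<close>

lemma tilt_ker:
  assumes i: "i < 6"
  shows "tilt (ker l i x) = tent l (x - (2 * int i + 1) * int l) - tent l (x - (35 - 2 * int i) * int l)"
proof -
  have g: "(2 * int i + 1) * int l + 2 * int l \<le> (35 - 2 * int i) * int l"
    by (rule mult_int_gap) (use i in auto)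
  show ?thesis
  proof (cases "x - (2 * int i + 1) * int l < 2 * int l")
    case True
    then have n: "x - (35 - 2 * int i) * int l < 0" using g by linarith
    show ?thesis using tent_eq_0[OF disjI1[OF n]] overlap_eq_0[OF disjI1[OF n], of l]
      by (simp add: ker_def tent_def)
  next
    case False
    then have n: "2 * int l \<le> x - (2 * int i + 1) * int l" by linarith
    show ?thesis using tent_eq_0[OF disjI2[OF n]] overlap_eq_0[OF disjI2[OF n]]
      by (simp add: ker_def tent_def tilt_minus[symmetric])
  qed
qed

lemma ker_support:
  assumes "ker l i x \<noteq> 0"
  obtains "(2 * int i + 1) * int l \<le> x" "x < (2 * int i + 1) * int l + 2 * int l"
  | "(35 - 2 * int i) * int l \<le> x" "x < (35 - 2 * int i) * int l + 2 * int l"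
proof -
  have "overlap l (int l - 1 - (x - (2 * int i + 1) * int l)) \<noteq> 0 \<or>
      overlap l (int l - 1 - (x - (35 - 2 * int i) * int l)) \<noteq> 0"
    using assms by (auto simp: ker_def)
  then show ?thesis
    using that overlap_eq_0[of "x - (2 * int i + 1) * int l" l] overlap_eq_0[of "x - (35 - 2 * int i) * int l" l]
    by linarith
qed

text \<open>A tent is two lengths wide, and distinct offsets of equal parity differ by at least
  two.\<close>

lemma tents_disjoint:
  assumes "a * int l \<le> x" "x < a * int l + 2 * int l" "b * int l \<le> x" "x < b * int l + 2 * int l" "even (a - b)"
  shows "a = b"
proof (rule ccontr)
  assume "a \<noteq> b"
  then have "a + 2 \<le> b \<or> b + 2 \<le> a" using assms(5) by presburger
  then show False using mult_int_gap[of a b l] mult_int_gap[of b a l] assms by linarith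
qed

lemma ker_disjoint:
  assumes "i < 6" "i' < 6" "i \<noteq> i'"
  shows "ker l i x = 0 \<or> ker l i' x = 0"
proof (rule ccontr)
  assume "\<not> ?thesis"
  then have n: "ker l i x \<noteq> 0" "ker l i' x \<noteq> 0" by auto
  show False
    by (rule ker_support[OF n(1)]; rule ker_support[OF n(2)])
      (use assms tents_disjoint in \<open>fastforce dest: tents_disjoint\<close>)+
qed

lemma ker_support_bounds:
  assumes "ker l i x \<noteq> 0" "i < 6"
  shows "int l \<le> x" "x < 37 * int l"
proof -
  have m: "1 * int l \<le> a * int l \<and> a * int l \<le> 35 * int l" if "1 \<le> a" "a \<le> 35" for a
    using that by (intro conjI mult_right_mono) auto
  show "int l \<le> x" "x < 37 * int l"
    by (rule ker_support[OF assms(1)]; use m[of "2 * int i + 1"] m[of "35 - 2 * int i"] assms(2) in linarith)+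
qed

text \<open>For six points, and up to the product of their signs, the product of tilts that an
  active site at \<open>\<gamma>\<close> adds to the joint characteristic function. For a larger set
  the same formula adds up the values of all six-point subsets, by
  \<open>sum_corr_subsets\<close>.\<close>

definition corr :: "nat \<Rightarrow> int set \<Rightarrow> int \<Rightarrow> real" where
  "corr l S \<gamma> = (\<Prod>i<6. \<Sum>k\<in>S. tilt (ker l i (k - \<gamma>)))"

text \<open>Fewer points than kernels: some kernel vanishes on all of \<open>S\<close>. This is the
  source of the independence of any five signs.\<close>

lemma prod_tilt_kersum_small:
  assumes "finite S" "card S < 6"
  shows "(\<Prod>i<6. tilt (kersum \<epsilon> S l i \<gamma>)) = 0"
proof -
  have d: "ker l i (k - \<gamma>) = 0 \<or> ker l i' (k - \<gamma>) = 0" if "i < 6" "i' < 6" "i \<noteq> i'" for i i' k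
    by (rule ker_disjoint[OF that])
  obtain i where "i < 6" "\<And>k. k \<in> S \<Longrightarrow> ker l i (k - \<gamma>) = 0"
  proof (rule disjoint_kernels_cases[of S 6 "\<lambda>i k. ker l i (k - \<gamma>)"])
    show "card S \<le> 6" using assms(2) by simp
  qed (use assms d in auto)
  then have "kersum \<epsilon> S l i \<gamma> = 0" by (simp add: kersum_def)
  then show ?thesis using \<open>i < 6\<close> by (intro prod_zero) (auto intro!: bexI[of _ i])
qed

text \<open>If no factor vanishes, the six points are matched with the six kernels, every
  \<open>kersum\<close> is a single signed term, and oddness of \<open>tilt\<close> releases the
  signs. Kernel 0 has offsets 1 and 35, kernel 5 has 11 and 25; as tents are two lengths wide, their
  points are at least \<open>8 * l\<close> apart.\<close>

lemma prod_tilt_kersum_six: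
  assumes S: "finite S" "card S = 6" and \<epsilon>: "\<And>k. k \<in> S \<Longrightarrow> \<epsilon> k = 1 \<or> \<epsilon> k = -1"
  shows "(\<Prod>i<6. tilt (kersum \<epsilon> S l i \<gamma>)) = (\<Prod>k\<in>S. \<epsilon> k) * corr l S \<gamma>"
    and "corr l S \<gamma> \<noteq> 0 \<Longrightarrow> \<forall>k\<in>S. \<gamma> + int l \<le> k \<and> k < \<gamma> + 37 * int l"
    and "corr l S \<gamma> \<noteq> 0 \<Longrightarrow> \<exists>k\<in>S. \<exists>k'\<in>S. 8 * int l \<le> k' - k"
proof -
  have d: "ker l i (k - \<gamma>) = 0 \<or> ker l i' (k - \<gamma>) = 0" if "i < 6" "i' < 6" "i \<noteq> i'" for i i' k
    by (rule ker_disjoint[OF that])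
  from S(2) have c6: "card S \<le> 6" by simp
  have "(\<Prod>i<6. tilt (kersum \<epsilon> S l i \<gamma>)) = (\<Prod>k\<in>S. \<epsilon> k) * corr l S \<gamma> \<and>
    (corr l S \<gamma> \<noteq> 0 \<longrightarrow> (\<forall>k\<in>S. \<gamma> + int l \<le> k \<and> k < \<gamma> + 37 * int l) \<and> (\<exists>k\<in>S. \<exists>k'\<in>S. 8 * int l \<le> k' - k))"
  proof (rule disjoint_kernels_cases[of S 6 "\<lambda>i k. ker l i (k - \<gamma>)", OF S(1) c6])
    show "ker l i (k - \<gamma>) = 0 \<or> ker l i' (k - \<gamma>) = 0" if "i < 6" "i' < 6" "i \<noteq> i'" for i i' k
      by (rule d[OF that])
  next
    fix i assume i: "i < 6" "\<And>k. k \<in> S \<Longrightarrow> ker l i (k - \<gamma>) = 0"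
    have "corr l S \<gamma> = 0" unfolding corr_def using i by (intro prod_zero) (auto intro!: bexI[of _ i])
    moreover have "kersum \<epsilon> S l i \<gamma> = 0" using i by (simp add: kersum_def)
    then have "(\<Prod>i<6. tilt (kersum \<epsilon> S l i \<gamma>)) = 0"
      using i(1) by (intro prod_zero) (auto intro!: bexI[of _ i])
    ultimately show ?thesis by simp
  next
    fix \<kappa> assume bij: "bij_betw \<kappa> {..<6} S"
      and \<kappa>: "\<And>i k. i < 6 \<Longrightarrow> k \<in> S \<Longrightarrow> k \<noteq> \<kappa> i \<Longrightarrow> ker l i (k - \<gamma>) = 0"
    have in_S: "\<kappa> i \<in> S" if "i < 6" for i using bij that by (auto simp: bij_betw_def)
    have one: "(\<Sum>k\<in>S. f k) = f (\<kappa> i)" if "i < 6" "\<And>k. ker l i (k - \<gamma>) = 0 \<Longrightarrow> f k = 0"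
      for i and f :: "int \<Rightarrow> real"
    proof -
      have "(\<Sum>k\<in>S. f k) = (\<Sum>k\<in>{\<kappa> i}. f k)"
        using S(1) in_S[OF that(1)] \<kappa>[OF that(1)] that(2) by (intro sum.mono_neutral_right) auto
      then show ?thesis by simp
    qed
    have cr: "corr l S \<gamma> = (\<Prod>i<6. tilt (ker l i (\<kappa> i - \<gamma>)))"
      unfolding corr_def by (intro prod.cong refl one) auto
    have "(\<Prod>i<6. tilt (kersum \<epsilon> S l i \<gamma>)) = (\<Prod>i<6. \<epsilon> (\<kappa> i) * tilt (ker l i (\<kappa> i - \<gamma>)))"
    proof (rule prod.cong[OF refl])
      fix i :: nat assume "i \<in> {..<6}"
      then have i: "i < 6" by simp
      have "kersum \<epsilon> S l i \<gamma> = \<epsilon> (\<kappa> i) * ker l i (\<kappa> i - \<gamma>)"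
        unfolding kersum_def by (rule one[OF i]) auto
      then show "tilt (kersum \<epsilon> S l i \<gamma>) = \<epsilon> (\<kappa> i) * tilt (ker l i (\<kappa> i - \<gamma>))"
        using \<epsilon>[OF in_S[OF i]] by (auto simp: tilt_minus)
    qed
    also have "\<dots> = (\<Prod>k\<in>S. \<epsilon> k) * corr l S \<gamma>"
      unfolding cr prod.distrib using prod.reindex_bij_betw[OF bij, of \<epsilon>] by simp
    finally have eq: "(\<Prod>i<6. tilt (kersum \<epsilon> S l i \<gamma>)) = (\<Prod>k\<in>S. \<epsilon> k) * corr l S \<gamma>" .
    have "(\<forall>k\<in>S. \<gamma> + int l \<le> k \<and> k < \<gamma> + 37 * int l) \<and> (\<exists>k\<in>S. \<exists>k'\<in>S. 8 * int l \<le> k' - k)"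
      if "corr l S \<gamma> \<noteq> 0"
    proof
      have n: "ker l i (\<kappa> i - \<gamma>) \<noteq> 0" if "i < 6" for i
        using \<open>corr l S \<gamma> \<noteq> 0\<close> that unfolding cr by (metis finite_lessThan lessThan_iff prod_zero tilt_0)
      show "\<forall>k\<in>S. \<gamma> + int l \<le> k \<and> k < \<gamma> + 37 * int l"
      proof
        fix k assume "k \<in> S"
        then obtain i where i: "i < 6" "k = \<kappa> i" using bij by (auto simp: bij_betw_def)
        show "\<gamma> + int l \<le> k \<and> k < \<gamma> + 37 * int l"
          using ker_support_bounds[OF n[OF i(1)] i(1)] i(2) by simp
      qed
      have z: "(0::nat) < 6" and f: "(5::nat) < 6" by auto
      have "8 * int l \<le> \<kappa> 5 - \<kappa> 0 \<or> 8 * int l \<le> \<kappa> 0 - \<kappa> 5"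
        by (rule ker_support[OF n[OF z]]; rule ker_support[OF n[OF f]]) auto
      then show "\<exists>k\<in>S. \<exists>k'\<in>S. 8 * int l \<le> k' - k" using in_S[OF z] in_S[OF f] by blast
    qed
    with eq show ?thesis by blast
  qed
  then show "(\<Prod>i<6. tilt (kersum \<epsilon> S l i \<gamma>)) = (\<Prod>k\<in>S. \<epsilon> k) * corr l S \<gamma>"
    "corr l S \<gamma> \<noteq> 0 \<Longrightarrow> \<forall>k\<in>S. \<gamma> + int l \<le> k \<and> k < \<gamma> + 37 * int l"
    "corr l S \<gamma> \<noteq> 0 \<Longrightarrow> \<exists>k\<in>S. \<exists>k'\<in>S. 8 * int l \<le> k' - k" by auto
qed

text \<open>Six points seen at length \<open>l\<close> spread over at least \<open>8 * l\<close> but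
  less than \<open>36 * l\<close>, while the next length would require a spread of
  \<open>8 * 36 * l\<close>. The scale is thus determined, and the site up to less than the distance
  between active sites.\<close>

lemma corr_unique:
  assumes S: "finite S" "card S = 6" and nz: "corr (len m) S \<gamma> \<noteq> 0" "corr (len m') S \<gamma>' \<noteq> 0"
  shows "m = m'" "\<bar>\<gamma> - \<gamma>'\<bar> < 36 * int (len m)"
proof -
  have rng: "\<gamma> + int (len m) \<le> k \<and> k < \<gamma> + 37 * int (len m)"
    if "corr (len m) S \<gamma> \<noteq> 0" "k \<in> S" for m \<gamma> k
    using prod_tilt_kersum_six(2)[OF S _ that(1), of "\<lambda>_. 1"] that(2) by simp
  have le: "\<not> m < m'" if nz: "corr (len m) S \<gamma> \<noteq> 0" "corr (len m') S \<gamma>' \<noteq> 0" for m m' \<gamma> \<gamma>'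
  proof
    assume "m < m'"
    then have "len (Suc m) \<le> len m'" unfolding len_def by (intro power_increasing) auto
    then have "36 * int (len m) \<le> int (len m')" by (simp add: len_Suc)
    obtain k k' where k: "k \<in> S" "k' \<in> S" "8 * int (len m') \<le> k' - k"
      using prod_tilt_kersum_six(3)[OF S _ nz(2), of "\<lambda>_. 1"] by auto
    have "k' - k < 36 * int (len m)"
      using rng[OF nz(1) k(1)] rng[OF nz(1) k(2)] by linarith
    then show False using k(3) \<open>36 * int (len m) \<le> int (len m')\<close> by linarith
  qed
  show eq: "m = m'" using le[OF nz] le[OF nz(2,1)] by simp
  obtain k where "k \<in> S" using S by fastforce
  then show "\<bar>\<gamma> - \<gamma>'\<bar> < 36 * int (len m)"
    using rng[OF nz(1), of k] rng[OF nz(2), of k] unfolding eq by linarith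
qed

lemma sum_corr_subsets:
  assumes "finite W"
  shows "(\<Sum>S | S \<subseteq> W \<and> card S = 6. corr l S \<gamma>) = corr l W \<gamma>"
  unfolding corr_def
proof (rule sum_subsets_prod_disjoint[OF assms])
  fix i i' :: nat and k assume "i < 6" "i' < 6" "i \<noteq> i'"
  then show "tilt (ker l i (k - \<gamma>)) = 0 \<or> tilt (ker l i' (k - \<gamma>)) = 0"
    using ker_disjoint[of i i' l "k - \<gamma>"] by auto
qed

section \<open>Tent sums over the points from 1 to n\<close>

context
  fixes l :: nat and n :: int
  assumes l: "0 < l"
begin

definition tents :: "int \<Rightarrow> real" where
  "tents p = (\<Sum>k\<in>{1..n}. tent l (k - p))"

definition full_tent :: real where
  "full_tent = (\<Sum>y\<in>{0..<2 * int l}. tent l y)"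

lemma tents_nonneg: "0 \<le> tents p"
  unfolding tents_def by (intro sum_nonneg tent_nonneg l)

lemma tents_eq_0: "n < p \<or> p + 2 * int l \<le> 1 \<Longrightarrow> tents p = 0"
  unfolding tents_def by (intro sum.neutral) (auto intro!: tent_eq_0)

lemma sum_tent_shift:
  assumes "finite K" "{p..<p + 2 * int l} \<subseteq> K"
  shows "(\<Sum>k\<in>K. tent l (k - p)) = full_tent"
proof -
  have "(\<Sum>k\<in>K. tent l (k - p)) = (\<Sum>k\<in>{p..<p + 2 * int l}. tent l (k - p))"
    using assms by (intro sum.mono_neutral_right) (auto intro!: tent_eq_0)
  also have "{p..<p + 2 * int l} = (\<lambda>y. y + p) ` {0..<2 * int l}"
    by (auto simp: image_iff intro!: bexI[of _ "_ - p"])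
  also have "(\<Sum>k\<in>(\<lambda>y. y + p) ` {0..<2 * int l}. tent l (k - p)) = full_tent"
    by (subst sum.reindex) (auto simp: full_tent_def inj_on_def)
  finally show ?thesis .
qed

lemma tents_le: "tents p \<le> full_tent"
proof -
  have "tents p \<le> (\<Sum>k\<in>{1..n} \<union> {p..<p + 2 * int l}. tent l (k - p))"
    unfolding tents_def by (intro sum_mono2) (auto intro: tent_nonneg l)
  then show ?thesis by (simp add: sum_tent_shift)
qed

lemma tents_full: "1 \<le> p \<Longrightarrow> p + 2 * int l \<le> n + 1 \<Longrightarrow> tents p = full_tent"
  unfolding tents_def by (rule sum_tent_shift) auto

lemma corr_interval:
  "corr l {1..n} \<gamma> = (\<Prod>i<6. tents (\<gamma> + (2 * int i + 1) * int l) - tents (\<gamma> + (35 - 2 * int i) * int l))"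
  unfolding corr_def tents_def sum_subtractf[symmetric]
  by (intro prod.cong refl sum.cong) (auto simp: tilt_ker algebra_simps)

text \<open>The supports of the six kernels consist of nested pairs of tents of opposite signs, so the
  six window sums have the same sign or one of them vanishes.\<close>

lemma corr_interval_nonneg: "0 \<le> corr l {1..n} \<gamma>"
proof -
  define a where "a i = \<gamma> + (2 * int i + 1) * int l" for i
  define b where "b i = \<gamma> + (35 - 2 * int i) * int l" for i
  have c: "corr l {1..n} \<gamma> = (\<Prod>i<6. tents (a i) - tents (b i))"
    by (simp add: corr_interval a_def b_def)
  have g1: "a 0 + 2 * int l \<le> a i" if "0 < i" for i
    using mult_int_gap[of 1 "2 * int i + 1" l] that by (simp add: a_def)
  have g2: "a i + 2 * int l \<le> b i" if "i < 6" for i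
    using mult_int_gap[of "2 * int i + 1" "35 - 2 * int i" l] that by (simp add: a_def b_def)
  have g3: "b i + 2 * int l \<le> b 0" if "0 < i" for i
    using mult_int_gap[of "35 - 2 * int i" 35 l] that by (simp add: b_def)
  \<comment> \<open>\<open>?hit p\<close> says that the tent at \<open>p\<close> meets the range.
    The outermost pair decides. If neither is hit, factor 0 vanishes; if both are, the pair inside
    it lies fully in the range and factor 1 vanishes. If only the left one is hit, all factors are
    nonnegative; if only the right one, all are nonpositive, and their number is even.\<close>
  let ?hit = "\<lambda>p. p \<le> n \<and> 1 < p + 2 * int l"
  consider "\<not> ?hit (a 0)" "\<not> ?hit (b 0)" | "?hit (a 0)" "?hit (b 0)"
    | "?hit (a 0)" "\<not> ?hit (b 0)" | "\<not> ?hit (a 0)" "?hit (b 0)" by blast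
  then show ?thesis
  proof cases
    case 1
    then have "tents (a 0) - tents (b 0) = 0" by (auto simp: tents_eq_0 not_le not_less)
    then have "corr l {1..n} \<gamma> = 0" unfolding c by (intro prod_zero) (auto intro!: bexI[of _ 0])
    then show ?thesis by simp
  next
    case 2
    have "tents (a 1) = full_tent" "tents (b 1) = full_tent"
      using 2 g1[of 1] g2[of 1] g3[of 1] l by (auto intro!: tents_full)
    then have "corr l {1..n} \<gamma> = 0" unfolding c by (intro prod_zero) (auto intro!: bexI[of _ 1])
    then show ?thesis by simp
  next
    case 3
    have nb: "n < b 0" using 3 g2[of 0] l by auto
    have "tents (b i) \<le> tents (a i)" if i: "i < 6" for i
    proof (cases "b i \<le> n")
      case True
      then have "0 < i" using nb by (cases i) auto
      then have "tents (a i) = full_tent" using True 3 g1[of i] g2[OF i] l by (intro tents_full) auto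
      then show ?thesis using tents_le by simp
    qed (use tents_eq_0[of "b i"] tents_nonneg in auto)
    then show ?thesis unfolding c by (intro prod_nonneg) auto
  next
    case 4
    have na: "a 0 + 2 * int l \<le> 1" using 4 g2[of 0] l by auto
    have "tents (a i) \<le> tents (b i)" if i: "i < 6" for i
    proof (cases "1 < a i + 2 * int l")
      case True
      then have "0 < i" using na by (cases i) auto
      then have "tents (b i) = full_tent" using True 4 g3[of i] g2[OF i] l by (intro tents_full) auto
      then show ?thesis using tents_le by simp
    qed (use tents_eq_0[of "a i"] tents_nonneg in auto)
    then have "0 \<le> (\<Prod>i<6. tents (b i) - tents (a i))" by (intro prod_nonneg) auto
    also have "\<dots> = (\<Prod>i<6. (-1) * (tents (a i) - tents (b i)))" by (intro prod.cong) auto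
    also have "\<dots> = corr l {1..n} \<gamma>" unfolding c prod.distrib by simp
    finally show ?thesis .
  qed
qed

text \<open>A tent is the convolution of two windows, so its values sum to \<open>l * l\<close>;
  \<open>tent_ge\<close> transfers this to the tilted values.\<close>

lemma full_tent_ge: "sqrt (real l) / 144 \<le> full_tent"
proof -
  have "(\<Sum>y\<in>{0..<2 * int l}. overlap l (int l - 1 - y)) =
      (\<Sum>y\<in>{0..<2 * int l}. \<Sum>j\<in>{0..<int l}. win l (int l - 1 - j) * win l (y - j))"
    by (intro sum.cong refl sum_win_win[symmetric]) auto
  also have "\<dots> = (\<Sum>j\<in>{0..<int l}. \<Sum>y\<in>{0..<2 * int l}. win l (y - j) * 1)"
    by (subst sum.swap) (intro sum.cong refl, auto simp: win_def)
  also have "\<dots> = (\<Sum>j\<in>{0..<int l}. \<Sum>t<l. 1)"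
    by (intro sum.cong refl sum_forward_window[symmetric]) auto
  also have "\<dots> = real l * real l" by simp
  finally have s: "(\<Sum>y\<in>{0..<2 * int l}. overlap l (int l - 1 - y)) = real l * real l" .
  have "sqrt (real l) / 144 = (real l * real l) / (144 * real l * sqrt (real l))"
    using l by (simp add: field_simps)
  also have "\<dots> = (\<Sum>y\<in>{0..<2 * int l}. overlap l (int l - 1 - y) / (144 * real l * sqrt (real l)))"
    unfolding s[symmetric] by (rule sum_divide_distrib)
  also have "\<dots> \<le> full_tent" unfolding full_tent_def by (intro sum_mono tent_ge l)
  finally show ?thesis .
qed

text \<open>Here \<open>n\<close> lies in the central gap, between the end 13 of the last left tent
  and the start 25 of the first right tent. All left tents are counted in full and all right tents
  not at all.\<close>

lemma corr_interval_ge: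
  assumes "0 \<le> \<gamma>" "\<gamma> + 13 * int l \<le> n" "n < \<gamma> + 25 * int l"
  shows "real l ^ 3 / 144 ^ 6 \<le> corr l {1..n} \<gamma>"
proof -
  have "real l ^ 3 / 144 ^ 6 = (sqrt (real l) / 144) ^ 6"
    using real_sqrt_pow2[of "real l"] power_mult[of "sqrt (real l)" 2 3] by (simp add: power_divide)
  also have "\<dots> \<le> full_tent ^ 6" by (intro power_mono full_tent_ge) auto
  also have "\<dots> = (\<Prod>i<(6::nat). full_tent)" by simp
  also have "\<dots> = corr l {1..n} \<gamma>" unfolding corr_interval
  proof (rule prod.cong[OF refl])
    fix i :: nat assume "i \<in> {..<6}"
    then have i: "int i \<le> 5" by simp
    have m: "1 * int l \<le> (2 * int i + 1) * int l" "(2 * int i + 1) * int l \<le> 11 * int l"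
      "25 * int l \<le> (35 - 2 * int i) * int l"
      using i by (intro mult_right_mono; simp)+
    have "tents (\<gamma> + (2 * int i + 1) * int l) = full_tent" using m assms l by (intro tents_full) linarith+
    moreover have "tents (\<gamma> + (35 - 2 * int i) * int l) = 0" using m assms by (intro tents_eq_0) linarith
    ultimately show "full_tent = tents (\<gamma> + (2 * int i + 1) * int l) - tents (\<gamma> + (35 - 2 * int i) * int l)" by simp
  qed
  finally show ?thesis .
qed

end

section \<open>Independence and characteristic functions\<close>

abbreviation noise_space :: "(int \<times> label \<Rightarrow> real) measure" where
  "noise_space \<equiv> PiM UNIV (\<lambda>_. borel)"

text \<open>Stated as invariance under changes outside \<open>K\<close>, so that independence of
  functionals of the noise reduces to disjointness of coordinate sets.\<close>

definition depends_on :: "'i set \<Rightarrow> (('i \<Rightarrow> real) \<Rightarrow> 'b) \<Rightarrow> bool" where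
  "depends_on K F \<longleftrightarrow> (\<forall>z z'. (\<forall>x\<in>K. z x = z' x) \<longrightarrow> F z = F z')"

lemma depends_onI: "(\<And>z z'. (\<And>x. x \<in> K \<Longrightarrow> z x = z' x) \<Longrightarrow> F z = F z') \<Longrightarrow> depends_on K F"
  unfolding depends_on_def by blast

lemma depends_onD: "depends_on K F \<Longrightarrow> (\<And>x. x \<in> K \<Longrightarrow> z x = z' x) \<Longrightarrow> F z = F z'"
  unfolding depends_on_def by blast

lemma component_measurable: "(\<lambda>z. z x) \<in> borel_measurable noise_space"
  by (rule measurable_component_singleton) simp

lemma gauss_measurable [measurable]: "gauss m q j \<in> borel_measurable noise_space"
  unfolding gauss_def by (rule component_measurable)

lemma mark_measurable [measurable]: "Measurable.pred noise_space (mark m j)"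
  unfolding mark_def by (intro borel_measurable_pred_less component_measurable borel_measurable_const)

lemma active_measurable [measurable]: "Measurable.pred noise_space (active m j)"
  unfolding active_def
  by (intro pred_intros_logic pred_intros_finite mark_measurable) simp

lemma hid_measurable [measurable]: "hid m i j \<in> borel_measurable noise_space"
proof -
  have sgn: "(\<lambda>z. sgn (gauss m q j z)) \<in> borel_measurable noise_space" for q
    by (rule measurable_compose[OF gauss_measurable borel_measurable_sgn])
  show ?thesis unfolding hid_def
    by (cases "i < 5"; simp only: if_True if_False)
      (intro gauss_measurable borel_measurable_times borel_measurable_uminus borel_measurable_prod
        borel_measurable_abs sgn)+
qed

lemma wmod_measurable [measurable]: "wmod m a b j \<in> borel_measurable noise_space"
proof -
  have "(\<lambda>z. of_bool (active m j z) :: real) \<in> borel_measurable noise_space" for j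
    unfolding of_bool_def by measurable
  then show ?thesis unfolding wmod_def
    by (intro borel_measurable_add borel_measurable_sum gauss_measurable)
      (auto intro!: borel_measurable_sum borel_measurable_times borel_measurable_diff borel_measurable_divide)
qed

lemma level_measurable [measurable]: "level m k \<in> borel_measurable noise_space"
  unfolding level_def case_prod_beta
  by (intro borel_measurable_divide borel_measurable_sum borel_measurable_diff wmod_measurable) simp

text \<open>Kept abstract because it is used on two spaces: the product space of the raw noise, and
  the space of coded sequences on which the i.i.d. sequence lives.\<close>

locale noise = prob_space M for M :: "'a measure" +
  fixes Z :: "int \<times> label \<Rightarrow> 'a \<Rightarrow> real"
  assumes indep: "indep_vars (\<lambda>_. borel) Z UNIV"
    and coin_unif: "distr M borel (Z (j, Inl m)) = uniform_measure lborel {0..1}"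
    and gauss_normal: "distr M borel (Z (j, Inr p)) = std_normal_distribution"
begin

definition config :: "'a \<Rightarrow> int \<times> label \<Rightarrow> real" where
  "config \<omega> = (\<lambda>x. Z x \<omega>)"

lemma Z_measurable [measurable]: "Z x \<in> borel_measurable M"
  using indep unfolding indep_vars_def by blast

lemma config_measurable [measurable]: "config \<in> measurable M noise_space"
  unfolding config_def by (rule measurable_PiM_single') auto

lemma indep_vars_depends_on:
  assumes F: "\<And>l. l \<in> L \<Longrightarrow> F l \<in> measurable noise_space N"
    and dep: "\<And>l. l \<in> L \<Longrightarrow> depends_on (K l) (F l)"
    and disj: "disjoint_family_on K L"
  shows "indep_vars (\<lambda>_. N) (\<lambda>l \<omega>. F l (config \<omega>)) L"
proof -
  \<comment> \<open>Filling the coordinates outside \<open>K l\<close> with 0 gives a function of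
    the restricted family alone; by \<open>depends_on\<close> it has the same value as
    \<open>F l\<close>.\<close>
  let ?Y = "\<lambda>l y. F l (\<lambda>x. if x \<in> K l then y x else 0)"
  have 1: "indep_vars (\<lambda>l. PiM (K l) (\<lambda>_. borel)) (\<lambda>l \<omega>. restrict (\<lambda>x. Z x \<omega>) (K l)) L"
    by (rule indep_vars_restrict[OF indep _ disj]) auto
  have 2: "?Y l \<in> measurable (PiM (K l) (\<lambda>_. borel)) N" if "l \<in> L" for l
  proof (rule measurable_compose[OF _ F[OF that]])
    show "(\<lambda>y x. if x \<in> K l then y x else 0) \<in> measurable (PiM (K l) (\<lambda>_. borel)) noise_space"
    proof (rule measurable_PiM_single')
      fix x
      show "(\<lambda>y. if x \<in> K l then y x else 0) \<in> borel_measurable (PiM (K l) (\<lambda>_. borel))"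
        by (cases "x \<in> K l") auto
    qed auto
  qed
  from indep_vars_compose[OF 1 2]
  have "indep_vars (\<lambda>_. N) (\<lambda>l. ?Y l \<circ> (\<lambda>\<omega>. restrict (\<lambda>x. Z x \<omega>) (K l))) L" .
  also have "?this \<longleftrightarrow> indep_vars (\<lambda>_. N) (\<lambda>l \<omega>. F l (config \<omega>)) L"
  proof (rule indep_vars_cong[OF refl _ refl])
    fix l assume l: "l \<in> L"
    show "?Y l \<circ> (\<lambda>\<omega>. restrict (\<lambda>x. Z x \<omega>) (K l)) = (\<lambda>\<omega>. F l (config \<omega>))"
    proof
      fix \<omega>
      show "(?Y l \<circ> (\<lambda>\<omega>. restrict (\<lambda>x. Z x \<omega>) (K l))) \<omega> = F l (config \<omega>)"
        unfolding comp_def by (rule depends_onD[OF dep[OF l]]) (simp add: config_def)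
    qed
  qed
  finally show ?thesis .
qed

lemma integral_prod_depends_on:
  fixes F :: "'l \<Rightarrow> (int \<times> label \<Rightarrow> real) \<Rightarrow> 'b::{real_normed_field, banach, second_countable_topology}"
  assumes L: "finite L" and F: "\<And>l. l \<in> L \<Longrightarrow> F l \<in> borel_measurable noise_space"
    and bdd: "\<And>l z. l \<in> L \<Longrightarrow> norm (F l z) \<le> C"
    and dep: "\<And>l. l \<in> L \<Longrightarrow> depends_on (K l) (F l)"
    and disj: "disjoint_family_on K L"
  shows "(LINT \<omega>|M. (\<Prod>l\<in>L. F l (config \<omega>))) = (\<Prod>l\<in>L. LINT \<omega>|M. F l (config \<omega>))"
proof (rule indep_vars_lebesgue_integral[OF L])
  show "indep_vars (\<lambda>_. borel) (\<lambda>l \<omega>. F l (config \<omega>)) L"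
    by (rule indep_vars_depends_on[OF F dep disj])
  show "integrable M (\<lambda>\<omega>. F l (config \<omega>))" if "l \<in> L" for l
    using F[OF that] bdd[OF that] by (intro integrable_const_bound[of _ C]) auto
qed

end

context noise
begin

lemma integral_gauss:
  fixes f :: "real \<Rightarrow> 'b::{banach, second_countable_topology}"
  assumes "f \<in> borel_measurable borel"
  shows "(LINT \<omega>|M. f (gauss m q j (config \<omega>))) = (LINT x|std_normal_distribution. f x)"
proof -
  have "(LINT x|distr M borel (Z (j, Inr (m, q))). f x) = (LINT \<omega>|M. f (Z (j, Inr (m, q)) \<omega>))"
    by (rule integral_distr[OF Z_measurable assms])
  then show ?thesis unfolding gauss_normal by (simp only: gauss_def config_def)
qed

lemma AE_gauss_nonzero: "AE \<omega> in M. gauss m q j (config \<omega>) \<noteq> 0"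
proof -
  have "AE x in std_normal_distribution. x \<noteq> 0"
    by (subst AE_density) (auto intro: AE_mp[OF AE_lborel_singleton[of 0]])
  then have "AE x in distr M borel (Z (j, Inr (m, q))). x \<noteq> 0" unfolding gauss_normal .
  then show ?thesis by (subst (asm) AE_distr_iff) (auto simp: gauss_def config_def)
qed

lemma integral_prod_gauss:
  fixes f :: "nat \<Rightarrow> real \<Rightarrow> complex"
  assumes f: "\<And>i. i < n \<Longrightarrow> f i \<in> borel_measurable borel" and bdd: "\<And>i x. i < n \<Longrightarrow> norm (f i x) \<le> 1"
  shows "(CLINT \<omega>|M. (\<Prod>i<n. f i (gauss m (c + i) j (config \<omega>)))) =
    (\<Prod>i<n. CLINT x|std_normal_distribution. f i x)"
proof -
  have "(CLINT \<omega>|M. (\<Prod>i<n. f i (gauss m (c + i) j (config \<omega>)))) =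
      (\<Prod>i<n. CLINT \<omega>|M. f i (gauss m (c + i) j (config \<omega>)))"
    by (rule integral_prod_depends_on[where K = "\<lambda>i. {(j, Inr (m, c + i))}" and C = 1
          and F = "\<lambda>i z. f i (gauss m (c + i) j z)"])
      (use f bdd in \<open>auto simp: disjoint_family_on_def gauss_def intro!: depends_onI measurable_compose[OF _ f]\<close>)
  also have "\<dots> = (\<Prod>i<n. CLINT x|std_normal_distribution. f i x)"
    by (intro prod.cong refl integral_gauss f) auto
  finally show ?thesis .
qed

text \<open>The exponential of the sixth variable splits into a cosine and a sine, and only the sine
  carries the product of signs. There each of the five signs turns a Gaussian integral into
  \<open>\<i>\<close> times \<open>half_sine\<close>; the five powers of \<open>\<i>\<close> and the
  factor \<open>- \<i>\<close> multiply to 1. So the only deviation from independence is the product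
  of all six tilts.\<close>

lemma integral_iexp_hid:
  "(CLINT \<omega>|M. iexp (\<Sum>i<6. s i * hid m i j (config \<omega>))) =
    of_real ((\<Prod>i<6. exp (- (s i)\<^sup>2 / 2)) * (1 + (\<Prod>i<6. tilt (s i))))"
proof -
  let ?g = "\<lambda>i \<omega>. gauss m (1296 + i) j (config \<omega>)"
  define f1 where "f1 i x = (if i < 5 then iexp (s i * x) else of_real (cos (s i * x)))" for i :: nat and x
  define f2 where "f2 i x = (if i < 5 then of_real (sgn x) * iexp (s i * x) else of_real (sgn x * sin (s i * x)))"
    for i :: nat and x
  have meas [measurable]: "f1 i \<in> borel_measurable borel" "f2 i \<in> borel_measurable borel" for i
    by (auto simp: f1_def[abs_def] f2_def[abs_def])
  have bdd: "norm (f1 i x) \<le> 1" "norm (f2 i x) \<le> 1" for i x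
    by (auto simp: f1_def f2_def norm_mult abs_mult sgn_if)
  have split: "(\<Prod>i<6. h i) = (\<Prod>i<5. h i) * h 5" for h :: "nat \<Rightarrow> complex"
    by (simp add: lessThan_nat_numeral mult.commute)
  \<comment> \<open>Needs nonzero Gaussians, as \<open>sgn 0 = 0\<close> would destroy the sixth
    variable; this holds almost surely.\<close>
  have pt: "iexp (\<Sum>i<6. s i * hid m i j (config \<omega>)) =
      (\<Prod>i<6. f1 i (?g i \<omega>)) - \<i> * (\<Prod>i<6. f2 i (?g i \<omega>))"
    if nz: "\<And>i. i < 5 \<Longrightarrow> ?g i \<omega> \<noteq> 0" for \<omega>
  proof -
    define \<sigma> where "\<sigma> = (\<Prod>i<5. sgn (?g i \<omega>))"
    have \<sigma>: "\<sigma> = 1 \<or> \<sigma> = -1"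
    proof -
      have "\<bar>\<sigma>\<bar> = (\<Prod>i<(5::nat). 1)" unfolding \<sigma>_def abs_prod
        by (intro prod.cong) (use nz in \<open>auto simp: sgn_if\<close>)
      then show ?thesis by (auto simp: abs_if split: if_splits)
    qed
    have "(\<Sum>i<6. s i * hid m i j (config \<omega>)) = (\<Sum>i<5. s i * ?g i \<omega>) + s 5 * (- \<sigma> * \<bar>?g 5 \<omega>\<bar>)"
      by (simp add: hid_def \<sigma>_def lessThan_nat_numeral)
    then have "iexp (\<Sum>i<6. s i * hid m i j (config \<omega>)) =
        iexp (\<Sum>i<5. s i * ?g i \<omega>) * iexp (s 5 * (- \<sigma> * \<bar>?g 5 \<omega>\<bar>))"
      by (simp only: of_real_add distrib_left exp_add)
    also have "iexp (\<Sum>i<5. s i * ?g i \<omega>) = (\<Prod>i<5. iexp (s i * ?g i \<omega>))"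
      by (simp only: of_real_sum sum_distrib_left exp_sum[OF finite_lessThan])
    also have "iexp (s 5 * (- \<sigma> * \<bar>?g 5 \<omega>\<bar>)) =
        of_real (cos (s 5 * ?g 5 \<omega>)) - \<i> * of_real \<sigma> * of_real (sgn (?g 5 \<omega>) * sin (s 5 * ?g 5 \<omega>))"
      unfolding iexp_conv_cos_sin using \<sigma> by (auto simp: abs_if sgn_if)
    also have "(\<Prod>i<5. iexp (s i * ?g i \<omega>)) * (of_real (cos (s 5 * ?g 5 \<omega>)) -
        \<i> * of_real \<sigma> * of_real (sgn (?g 5 \<omega>) * sin (s 5 * ?g 5 \<omega>))) =
      (\<Prod>i<6. f1 i (?g i \<omega>)) - \<i> * (\<Prod>i<6. f2 i (?g i \<omega>))"
      unfolding split by (simp add: f1_def f2_def prod.distrib \<sigma>_def algebra_simps)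
    finally show ?thesis .
  qed
  have "AE \<omega> in M. \<forall>i<5. ?g i \<omega> \<noteq> 0"
    using AE_gauss_nonzero by (simp add: AE_all_countable)
  then have "(CLINT \<omega>|M. iexp (\<Sum>i<6. s i * hid m i j (config \<omega>))) =
      (CLINT \<omega>|M. (\<Prod>i<6. f1 i (?g i \<omega>)) - \<i> * (\<Prod>i<6. f2 i (?g i \<omega>)))"
  proof (intro integral_cong_AE)
    assume ae: "AE \<omega> in M. \<forall>i<5. ?g i \<omega> \<noteq> 0"
    show "AE \<omega> in M. iexp (\<Sum>i<6. s i * hid m i j (config \<omega>)) =
        (\<Prod>i<6. f1 i (?g i \<omega>)) - \<i> * (\<Prod>i<6. f2 i (?g i \<omega>))"
      using ae by (rule eventually_mono) (rule pt, blast)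
  qed measurable
  also have "\<dots> = (CLINT \<omega>|M. (\<Prod>i<6. f1 i (?g i \<omega>))) - \<i> * (CLINT \<omega>|M. (\<Prod>i<6. f2 i (?g i \<omega>)))"
  proof -
    have "norm (\<Prod>i<6. f i (?g i \<omega>)) \<le> 1" if "\<And>i x. norm (f i x) \<le> 1" for f :: "nat \<Rightarrow> real \<Rightarrow> complex" and \<omega>
      using that by (simp add: prod_norm[symmetric] prod_le_1)
    then have "integrable M (\<lambda>\<omega>. \<Prod>i<6. f1 i (?g i \<omega>))" "integrable M (\<lambda>\<omega>. \<Prod>i<6. f2 i (?g i \<omega>))"
      using bdd by (auto intro!: integrable_const_bound[of _ 1])
    then show ?thesis by simp
  qed
  also have "(CLINT \<omega>|M. (\<Prod>i<6. f1 i (?g i \<omega>))) = of_real (\<Prod>i<6. exp (- (s i)\<^sup>2 / 2))"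
  proof -
    have "(CLINT x|std_normal_distribution. f1 i x) = of_real (exp (- (s i)\<^sup>2 / 2))" for i
      by (cases "i < 5") (simp_all add: f1_def integral_std_normal_iexp[simplified] integral_std_normal_cos)
    then show ?thesis using integral_prod_gauss[of 6 f1 m 1296 j] bdd by simp
  qed
  also have "(CLINT \<omega>|M. (\<Prod>i<6. f2 i (?g i \<omega>))) = \<i> * of_real (\<Prod>i<6. half_sine (s i))"
  proof -
    have f2: "(CLINT x|std_normal_distribution. f2 i x) = (if i < 5 then \<i> else 1) * of_real (half_sine (s i))" for i
      using integral_std_normal_sgn_iexp[of "s i"]
      by (auto simp: f2_def half_sine_def simp del: of_real_mult)
    have i5: "\<i> ^ 5 = \<i>" by (simp add: numeral_eq_Suc)
    from f2 have "(CLINT \<omega>|M. (\<Prod>i<6. f2 i (?g i \<omega>))) =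
        (\<Prod>i<6. (if i < 5 then \<i> else 1) * of_real (half_sine (s i)))"
      using integral_prod_gauss[of 6 f2 m 1296 j] bdd by simp
    also have "\<dots> = \<i> * of_real (\<Prod>i<6. half_sine (s i))"
      unfolding split using i5 by (simp add: prod.distrib lessThan_nat_numeral)
    finally show ?thesis .
  qed
  finally have "(CLINT \<omega>|M. iexp (\<Sum>i<6. s i * hid m i j (config \<omega>))) =
      of_real ((\<Prod>i<6. exp (- (s i)\<^sup>2 / 2)) + (\<Prod>i<6. half_sine (s i)))" by simp
  also have "(\<Prod>i<6. half_sine (s i)) = (\<Prod>i<6. exp (- (s i)\<^sup>2 / 2) * tilt (s i))"
    by (intro prod.cong refl) (simp add: tilt_def exp_minus field_simps)
  finally show ?thesis by (simp add: prod.distrib algebra_simps)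
qed

end

lemma integral_uniform_less:
  assumes "0 \<le> q" "q \<le> 1"
  shows "(LINT x|uniform_measure lborel {0..1}. of_bool (x < q)) = (q::real)"
proof -
  interpret prob_space "uniform_measure lborel {0..1::real}"
    by (rule prob_space_uniform_measure) auto
  have "(LINT x|uniform_measure lborel {0..1}. of_bool (x < q)) =
      (LINT x|uniform_measure lborel {0..1}. indicator {..<q} x :: real)"
    by (intro Bochner_Integration.integral_cong) (auto simp: indicator_def)
  also have "\<dots> = measure (uniform_measure lborel {0..1}) {..<q}" by simp
  also have "\<dots> = q"
  proof -
    have "{0..1} \<inter> {..<q} = {0..<q}" using assms by auto
    then have "emeasure (uniform_measure lborel {0..1}) {..<q} = ennreal q"
      using assms divide_ennreal[of q 1] by (simp add: emeasure_uniform_measure)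
    then show ?thesis using assms by (simp add: measure_def)
  qed
  finally show ?thesis .
qed

definition activity :: "nat \<Rightarrow> real" where
  "activity m = 1 / (100 * real (len m)) * (1 - 1 / (100 * real (len m))) ^ (50 * len m)"

text \<open>By Bernoulli's inequality, requiring \<open>50 * len m\<close> unmarked sites costs at
  most half of the marking probability \<open>1 / (100 * len m)\<close>.\<close>

lemma activity_ge: "1 / (200 * real (len m)) \<le> activity m"
proof -
  have l: "1 \<le> real (len m)" using len_pos[of m] by linarith
  have "1 + real (50 * len m) * (- 1 / (100 * real (len m))) \<le> (1 + (- 1 / (100 * real (len m)))) ^ (50 * len m)"
    by (rule Bernoulli_inequality) (use l in \<open>simp add: field_simps\<close>)
  then have "1 / 2 \<le> (1 - 1 / (100 * real (len m))) ^ (50 * len m)" using l by simp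
  then have "1 / (100 * real (len m)) * (1 / 2) \<le> activity m"
    unfolding activity_def by (intro mult_left_mono) auto
  then show ?thesis by simp
qed

text \<open>Coordinates of the independent groups for a frozen active set: \<open>None\<close>
  stands for all marks of the scale, \<open>Some (Inl p)\<close> for one Gaussian at one site,
  \<open>Some (Inr \<gamma>)\<close> for the six raw Gaussians behind the hidden variables at
  \<open>\<gamma>\<close>. Window pairs are stored as \<open>(b, a)\<close>, so
  \<open>snd (fst p)\<close> is the smaller index.\<close>

definition group_slots ::
  "nat \<Rightarrow> (((nat \<times> nat) \<times> int) + int) option \<Rightarrow> (int \<times> label) set" where
  "group_slots m l = (case l of None \<Rightarrow> {(j, Inl (Suc m)) | j. True}
     | Some (Inl p) \<Rightarrow> {(snd p, Inr (m, 36 * snd (fst p) + fst (fst p)))}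
     | Some (Inr \<gamma>) \<Rightarrow> {(\<gamma>, Inr (m, 1296 + i)) | i. i < 6})"

lemma disjoint_group_slots: "disjoint_family_on (group_slots m) (insert None (Some ` (Inl ` (pairs \<times> \<Gamma>) \<union> Inr ` A)))"
proof -
  have 1: "p = p'" if "p \<in> pairs" "p' \<in> pairs" "36 * snd p + fst p = 36 * snd p' + fst p'" for p p'
  proof -
    have "fst p < 36" "fst p' < 36" using that by (auto simp: pairs_def)
    then have "fst p = (36 * snd p + fst p) mod 36" "fst p' = (36 * snd p' + fst p') mod 36"
      "snd p = (36 * snd p + fst p) div 36" "snd p' = (36 * snd p' + fst p') div 36" by simp_all
    then show ?thesis using that(3) by (intro prod_eqI) metis+
  qed
  have 2: "36 * snd p + fst p < 1296" if "p \<in> pairs" for p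
    using that by (auto simp: pairs_def)
  show ?thesis unfolding disjoint_family_on_def
  proof (intro ballI impI)
    fix l l' assume l: "l \<in> insert None (Some ` (Inl ` (pairs \<times> \<Gamma>) \<union> Inr ` A))"
      "l' \<in> insert None (Some ` (Inl ` (pairs \<times> \<Gamma>) \<union> Inr ` A))" "l \<noteq> l'"
    have cs: "l = None \<or> (\<exists>p j. p \<in> pairs \<and> l = Some (Inl (p, j))) \<or> (\<exists>\<gamma>. l = Some (Inr \<gamma>))"
      if "l \<in> insert None (Some ` (Inl ` (pairs \<times> \<Gamma>) \<union> Inr ` A))" for l
      using that by auto
    have False if x: "(j, x) \<in> group_slots m l" "(j, x) \<in> group_slots m l'" for j x
      using cs[OF l(1)] cs[OF l(2)]
    proof (elim disjE exE conjE)
      fix p i p' i' assume p: "p \<in> pairs" "l = Some (Inl (p, i))" "p' \<in> pairs" "l' = Some (Inl (p', i'))"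
      then have "i = i'" "36 * snd p + fst p = 36 * snd p' + fst p'" using x by (auto simp: group_slots_def)
      then show False using 1[OF p(1,3)] p l(3) by simp
    next
      fix p i \<gamma> assume p: "p \<in> pairs" "l = Some (Inl (p, i))" "l' = Some (Inr \<gamma>)"
      then show False using x 2[OF p(1)] by (auto simp: group_slots_def)
    next
      fix p i \<gamma> assume p: "p \<in> pairs" "l' = Some (Inl (p, i))" "l = Some (Inr \<gamma>)"
      then show False using x 2[OF p(1)] by (auto simp: group_slots_def)
    next
      fix \<gamma> \<gamma>' assume p: "l = Some (Inr \<gamma>)" "l' = Some (Inr \<gamma>')"
      then show False using x l(3) by (auto simp: group_slots_def)
    qed (use x l(3) in \<open>simp_all add: group_slots_def\<close>)
    then show "group_slots m l \<inter> group_slots m l' = {}" by auto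
  qed
qed

context noise
begin

lemma integral_coin:
  assumes "0 \<le> q" "q \<le> 1"
  shows "(LINT \<omega>|M. of_bool (config \<omega> (j, Inl m) < q)) = (q::real)"
proof -
  have "(LINT x|distr M borel (Z (j, Inl m)). of_bool (x < q)) = (LINT \<omega>|M. of_bool (Z (j, Inl m) \<omega> < q) :: real)"
    by (rule integral_distr[OF Z_measurable]) (unfold of_bool_def, measurable)
  then have "(LINT \<omega>|M. of_bool (Z (j, Inl m) \<omega> < q)) = q"
    unfolding coin_unif integral_uniform_less[OF assms] by (rule sym)
  then show ?thesis unfolding config_def .
qed

lemma integral_active: "(LINT \<omega>|M. of_bool (active m j (config \<omega>))) = activity m"
proof -
  let ?q = "1 / (100 * real (len m))"
  define F where "F d z = (if d = 0 then of_bool (mark m j z) else 1 - of_bool (mark m (j - int d) z) :: real)"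
    for d :: nat and z
  have l: "1 \<le> real (len m)" using len_pos[of m] by linarith
  have q: "0 \<le> ?q" "?q \<le> 1" using l by (auto simp: field_simps)
  have of_bool_meas: "(\<lambda>z. of_bool (mark m j z) :: real) \<in> borel_measurable noise_space" for j
    unfolding of_bool_def by measurable
  have Fm: "F d \<in> borel_measurable noise_space" for d
    unfolding F_def[abs_def] using of_bool_meas by (cases "d = 0") auto
  have mk: "(LINT \<omega>|M. of_bool (mark m j (config \<omega>))) = ?q" for j
    unfolding mark_def by (rule integral_coin[OF q])
  have act: "of_bool (active m j z) = (\<Prod>d\<in>{0..50 * len m}. F d z)" for z
  proof -
    have "{0..50 * len m} = insert 0 {1..50 * len m}" by auto
    then have "(\<Prod>d\<in>{0..50 * len m}. F d z) = of_bool (mark m j z) * (\<Prod>d\<in>{1..50 * len m}. F d z)"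
      by (simp add: F_def)
    also have "(\<Prod>d\<in>{1..50 * len m}. F d z) = of_bool (\<forall>d\<in>{1..50 * len m}. \<not> mark m (j - int d) z)"
    proof (cases "\<forall>d\<in>{1..50 * len m}. \<not> mark m (j - int d) z")
      case True then have "(\<Prod>d\<in>{1..50 * len m}. F d z) = 1"
        unfolding F_def by (intro prod.neutral) simp
      then show ?thesis using True by simp
    next
      case False
      then obtain d where "d \<in> {1..50 * len m}" "F d z = 0" by (auto simp: F_def)
      then have "(\<Prod>d\<in>{1..50 * len m}. F d z) = 0" by (intro prod_zero) auto
      then show ?thesis unfolding of_bool_def if_not_P[OF False] .
    qed
    finally show ?thesis unfolding active_def of_bool_conj ..
  qed
  have "(LINT \<omega>|M. of_bool (active m j (config \<omega>))) = (\<Prod>d\<in>{0..50 * len m}. LINT \<omega>|M. F d (config \<omega>))"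
    unfolding act
    by (rule integral_prod_depends_on[where K = "\<lambda>d. {(j - int d, Inl (Suc m))}" and C = 1, OF _ Fm])
      (simp_all add: F_def, auto simp: F_def disjoint_family_on_def mark_def depends_on_def)
  also have "\<dots> = (\<Prod>d\<in>{0..50 * len m}. if d = 0 then ?q else 1 - ?q)"
  proof (rule prod.cong[OF refl])
    fix d
    have "integrable M (\<lambda>\<omega>. of_bool (mark m (j - int d) (config \<omega>)) :: real)"
      by (rule integrable_const_bound[of _ 1]) (auto intro!: measurable_compose[OF config_measurable of_bool_meas])
    then show "(LINT \<omega>|M. F d (config \<omega>)) = (if d = 0 then ?q else 1 - ?q)"
      unfolding F_def by (simp add: mk prob_space)
  qed
  also have "\<dots> = ?q * (\<Prod>d\<in>{1..50 * len m}. 1 - ?q)"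
  proof -
    have "{0..50 * len m} = insert 0 {1..50 * len m}" by auto
    moreover have "(\<Prod>d\<in>{1..50 * len m}. if d = 0 then ?q else 1 - ?q) = (\<Prod>d\<in>{1..50 * len m}. 1 - ?q)"
      by (rule prod.cong) auto
    ultimately show ?thesis by (simp only: prod.insert[OF finite_atLeastAtMost] if_True) simp
  qed
  finally show ?thesis by (simp add: activity_def)
qed

text \<open>The integral is split by the set \<open>A\<close> of active sites. For each
  \<open>A\<close> the exponent is a sum over independent groups, and by
  \<open>sum_wcoef_square\<close> their Gaussian factors multiply to a constant free of
  \<open>A\<close>. Only the tilt products of the active sites remain inside the
  expectation.\<close>

lemma integral_iexp_sum_level:
  fixes \<epsilon> :: "int \<Rightarrow> real"
  assumes S: "finite S" "\<And>k. k \<in> S \<Longrightarrow> \<bar>k\<bar> \<le> B" and R: "B + 40 * int (len m) \<le> R"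
  shows "(CLINT \<omega>|M. iexp (\<Sum>k\<in>S. \<epsilon> k * level m k (config \<omega>))) =
    of_real (exp (- (energy \<epsilon> S (len m) - energy \<epsilon> S (len (Suc m))) / 2) *
      (LINT \<omega>|M. (\<Prod>\<gamma>\<in>{-R..R}. 1 + of_bool (active m \<gamma> (config \<omega>)) * (\<Prod>i<6. tilt (kersum \<epsilon> S (len m) i \<gamma>)))))"
proof -
  let ?\<Gamma> = "{-R..R}" and ?l = "len m"
  let ?s = "kersum \<epsilon> S ?l"
  define P where "P \<gamma> = (\<Prod>i<6. tilt (?s i \<gamma>))" for \<gamma>
  define act where "act z = {\<gamma> \<in> ?\<Gamma>. active m \<gamma> z}" for z
  define w where "w A z = (of_bool (act z = A) :: real)" for A z
  \<comment> \<open>The exponent with the active set frozen at \<open>A\<close>: it no longer reads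
    the marks, which makes it independent of the weight \<open>w A\<close>.\<close>
  define \<Phi> where "\<Phi> A z = (\<Sum>(b, a)\<in>pairs. \<Sum>j\<in>?\<Gamma>. wcoef \<epsilon> S ?l A a b j * gauss m (36 * a + b) j z) +
    (\<Sum>\<gamma>\<in>A. \<Sum>i<6. ?s i \<gamma> * hid m i \<gamma> z)" for A z
  have w_eq: "w A z = (\<Prod>\<gamma>\<in>?\<Gamma>. of_bool (active m \<gamma> z \<longleftrightarrow> \<gamma> \<in> A))" if "A \<subseteq> ?\<Gamma>" for A z
  proof (cases "act z = A")
    case True
    then have "(\<Prod>\<gamma>\<in>?\<Gamma>. of_bool (active m \<gamma> z \<longleftrightarrow> \<gamma> \<in> A)) = (1::real)"
      unfolding act_def by (intro prod.neutral) auto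
    then show ?thesis using True by (simp add: w_def)
  next
    case False
    have "\<exists>\<gamma>\<in>?\<Gamma>. active m \<gamma> z \<noteq> (\<gamma> \<in> A)"
    proof (rule ccontr)
      assume "\<not> ?thesis"
      then have "act z = A" using that unfolding act_def by blast
      then show False using False by simp
    qed
    then have "(\<Prod>\<gamma>\<in>?\<Gamma>. of_bool (active m \<gamma> z \<longleftrightarrow> \<gamma> \<in> A)) = (0::real)" by (intro prod_zero) auto
    then show ?thesis using False by (simp add: w_def)
  qed
  have w_meas: "w A \<in> borel_measurable noise_space" if "A \<subseteq> ?\<Gamma>" for A
  proof -
    have "(\<lambda>z. of_bool (active m \<gamma> z \<longleftrightarrow> \<gamma> \<in> A) :: real) \<in> borel_measurable noise_space" for \<gamma>
      unfolding of_bool_def by measurable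
    moreover have "w A = (\<lambda>z. \<Prod>\<gamma>\<in>?\<Gamma>. of_bool (active m \<gamma> z \<longleftrightarrow> \<gamma> \<in> A))"
      by (rule ext) (rule w_eq[OF that])
    ultimately show ?thesis by (simp only:) (intro borel_measurable_prod)
  qed
  have part: "G (act z) = (\<Sum>A\<in>Pow ?\<Gamma>. of_real (w A z) * G A)" for G :: "int set \<Rightarrow> 'c::real_normed_field" and z
  proof -
    have "(\<Sum>A\<in>Pow ?\<Gamma>. of_real (w A z) * G A) = (\<Sum>A\<in>Pow ?\<Gamma>. if A = act z then G A else 0)"
      by (intro sum.cong) (auto simp: w_def)
    also have "\<dots> = G (act z)" by (subst sum.delta) (auto simp: act_def)
    finally show ?thesis by simp
  qed
  have lev: "(\<Sum>k\<in>S. \<epsilon> k * level m k z) = \<Phi> (act z) z" for z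
    unfolding \<Phi>_def act_def by (rule sum_level_expand[OF S R])
  define W where "W A = (LINT \<omega>|M. w A (config \<omega>))" for A
  have trm: "(CLINT \<omega>|M. of_real (w A (config \<omega>)) * iexp (\<Phi> A (config \<omega>))) =
      of_real (W A * (exp (- (energy \<epsilon> S ?l - energy \<epsilon> S (len (Suc m))) / 2) * (\<Prod>\<gamma>\<in>A. 1 + P \<gamma>)))"
    if A: "A \<subseteq> ?\<Gamma>" for A
  proof -
    have fA: "finite A" using A finite_subset by blast
    define F where "F l z = (case l of None \<Rightarrow> of_real (w A z)
      | Some (Inl p) \<Rightarrow> iexp (wcoef \<epsilon> S ?l A (snd (fst p)) (fst (fst p)) (snd p) * gauss m (36 * snd (fst p) + fst (fst p)) (snd p) z)
      | Some (Inr \<gamma>) \<Rightarrow> iexp (\<Sum>i<6. ?s i \<gamma> * hid m i \<gamma> z))" for l z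
    let ?L = "insert None (Some ` (Inl ` (pairs \<times> ?\<Gamma>) \<union> Inr ` A))"
    have prodL: "(\<Prod>l\<in>?L. f l) = f None * (\<Prod>p\<in>pairs \<times> ?\<Gamma>. f (Some (Inl p))) * (\<Prod>\<gamma>\<in>A. f (Some (Inr \<gamma>)))"
      for f :: "_ \<Rightarrow> complex"
    proof -
      have "(\<Prod>l\<in>?L. f l) = f None * (\<Prod>l\<in>Some ` (Inl ` (pairs \<times> ?\<Gamma>) \<union> Inr ` A). f l)"
        using fA by (subst prod.insert) auto
      also have "(\<Prod>l\<in>Some ` (Inl ` (pairs \<times> ?\<Gamma>) \<union> Inr ` A). f l) =
          (\<Prod>x\<in>Inl ` (pairs \<times> ?\<Gamma>) \<union> Inr ` A. f (Some x))"
        by (subst prod.reindex) auto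
      also have "\<dots> = (\<Prod>x\<in>Inl ` (pairs \<times> ?\<Gamma>). f (Some x)) * (\<Prod>x\<in>Inr ` A. f (Some x))"
        using fA by (intro prod.union_disjoint) auto
      also have "\<dots> = (\<Prod>p\<in>pairs \<times> ?\<Gamma>. f (Some (Inl p))) * (\<Prod>\<gamma>\<in>A. f (Some (Inr \<gamma>)))"
        by (simp add: prod.reindex)
      finally show ?thesis by (simp add: mult.assoc)
    qed
    have \<Phi>_pairs: "\<Phi> A z = (\<Sum>p\<in>pairs \<times> ?\<Gamma>. wcoef \<epsilon> S ?l A (snd (fst p)) (fst (fst p)) (snd p) * gauss m (36 * snd (fst p) + fst (fst p)) (snd p) z)
        + (\<Sum>\<gamma>\<in>A. \<Sum>i<6. ?s i \<gamma> * hid m i \<gamma> z)" for z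
      unfolding \<Phi>_def case_prod_beta sum.cartesian_product by (simp add: case_prod_beta)
    have "of_real (w A z) * iexp (\<Phi> A z) = (\<Prod>l\<in>?L. F l z)" for z
      unfolding prodL \<Phi>_pairs
      by (simp only: F_def option.case sum.case of_real_add of_real_sum distrib_left sum_distrib_left exp_add
          exp_sum[OF fA] exp_sum[OF finite_cartesian_product[OF finite_pairs finite_atLeastAtMost_int]] mult.assoc)
    then have "(CLINT \<omega>|M. of_real (w A (config \<omega>)) * iexp (\<Phi> A (config \<omega>))) =
        (CLINT \<omega>|M. (\<Prod>l\<in>?L. F l (config \<omega>)))" by simp
    also have "\<dots> = (\<Prod>l\<in>?L. CLINT \<omega>|M. F l (config \<omega>))"
    proof (rule integral_prod_depends_on[where K = "group_slots m" and C = 1])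
      show "finite ?L" using fA by auto
      show "disjoint_family_on (group_slots m) ?L" by (rule disjoint_group_slots)
      fix l assume l: "l \<in> ?L"
      then consider "l = None" | p where "l = Some (Inl p)" | \<gamma> where "l = Some (Inr \<gamma>)" by auto
      note cs = this
      show "F l \<in> borel_measurable noise_space" using w_meas[OF A]
        by (cases rule: cs) (auto simp: F_def[abs_def])
      show "norm (F l z) \<le> 1" for z
        by (cases rule: cs) (auto simp: F_def w_def norm_exp_i_times[of "_ * _", simplified] simp del: of_real_mult of_real_sum)
      show "depends_on (group_slots m l) (F l)"
      proof (rule depends_onI)
        fix z z' :: "int \<times> label \<Rightarrow> real" assume eq: "\<And>x. x \<in> group_slots m l \<Longrightarrow> z x = z' x"
        show "F l z = F l z'"
        proof (cases rule: cs)
          case 1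
          then have "mark m j z = mark m j z'" for j
            using eq by (simp add: mark_def group_slots_def)
          then show ?thesis using 1 by (simp add: F_def w_def act_def active_def)
        next
          case (2 p)
          then show ?thesis using eq by (simp add: F_def gauss_def group_slots_def)
        next
          case (3 \<gamma>)
          then have "gauss m (1296 + i) \<gamma> z = gauss m (1296 + i) \<gamma> z'" if "i < 6" for i
            using eq that by (simp add: gauss_def group_slots_def)
          note g = this
          have "gauss m 1301 \<gamma> z = gauss m 1301 \<gamma> z'" using g[of 5] by simp
          then have "hid m i \<gamma> z = hid m i \<gamma> z'" if "i < 6" for i using that g by (simp add: hid_def)
          then show ?thesis using 3 by (simp add: F_def)
        qed
      qed
    qed
    also have "\<dots> = of_real (W A) *
        (\<Prod>p\<in>pairs \<times> ?\<Gamma>. of_real (exp (- (wcoef \<epsilon> S ?l A (snd (fst p)) (fst (fst p)) (snd p))\<^sup>2 / 2))) *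
        (\<Prod>\<gamma>\<in>A. of_real ((\<Prod>i<6. exp (- (?s i \<gamma>)\<^sup>2 / 2)) * (1 + P \<gamma>)))"
    proof -
      have "(CLINT \<omega>|M. F None (config \<omega>)) = of_real (W A)" by (simp add: F_def W_def)
      moreover have "(CLINT \<omega>|M. F (Some (Inl p)) (config \<omega>)) =
          of_real (exp (- (wcoef \<epsilon> S ?l A (snd (fst p)) (fst (fst p)) (snd p))\<^sup>2 / 2))" for p
        unfolding F_def option.case sum.case
        by (subst integral_gauss[where f = "\<lambda>x. iexp (_ * x)"]) (simp, rule integral_std_normal_iexp)
      moreover have "(CLINT \<omega>|M. F (Some (Inr \<gamma>)) (config \<omega>)) =
          of_real ((\<Prod>i<6. exp (- (?s i \<gamma>)\<^sup>2 / 2)) * (1 + P \<gamma>))" for \<gamma>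
        unfolding F_def option.case sum.case P_def by (rule integral_iexp_hid)
      ultimately show ?thesis unfolding prodL by simp
    qed
    also have "\<dots> = of_real (W A * (exp (- (\<Sum>(b, a)\<in>pairs. \<Sum>j\<in>?\<Gamma>. (wcoef \<epsilon> S ?l A a b j)\<^sup>2) / 2) *
        (exp (- (\<Sum>\<gamma>\<in>A. \<Sum>i<6. (?s i \<gamma>)\<^sup>2) / 2) * (\<Prod>\<gamma>\<in>A. 1 + P \<gamma>))))"
    proof -
      have "(\<Prod>p\<in>pairs \<times> ?\<Gamma>. exp (- (wcoef \<epsilon> S ?l A (snd (fst p)) (fst (fst p)) (snd p))\<^sup>2 / 2)) =
          exp (- (\<Sum>(b, a)\<in>pairs. \<Sum>j\<in>?\<Gamma>. (wcoef \<epsilon> S ?l A a b j)\<^sup>2) / 2)"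
        unfolding case_prod_beta sum.cartesian_product
        by (subst exp_sum[symmetric]) (auto simp: case_prod_beta sum_negf sum_divide_distrib)
      moreover have "(\<Prod>\<gamma>\<in>A. (\<Prod>i<6. exp (- (?s i \<gamma>)\<^sup>2 / 2)) * (1 + P \<gamma>)) =
          exp (- (\<Sum>\<gamma>\<in>A. \<Sum>i<6. (?s i \<gamma>)\<^sup>2) / 2) * (\<Prod>\<gamma>\<in>A. 1 + P \<gamma>)"
        unfolding prod.distrib using fA
        by (simp add: exp_sum[symmetric] sum_negf sum_divide_distrib)
      ultimately have "W A * (\<Prod>p\<in>pairs \<times> ?\<Gamma>. exp (- (wcoef \<epsilon> S ?l A (snd (fst p)) (fst (fst p)) (snd p))\<^sup>2 / 2)) *
          (\<Prod>\<gamma>\<in>A. (\<Prod>i<6. exp (- (?s i \<gamma>)\<^sup>2 / 2)) * (1 + P \<gamma>)) =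
        W A * (exp (- (\<Sum>(b, a)\<in>pairs. \<Sum>j\<in>?\<Gamma>. (wcoef \<epsilon> S ?l A a b j)\<^sup>2) / 2) *
          (exp (- (\<Sum>\<gamma>\<in>A. \<Sum>i<6. (?s i \<gamma>)\<^sup>2) / 2) * (\<Prod>\<gamma>\<in>A. 1 + P \<gamma>)))"
        by (simp only: mult.assoc)
      from arg_cong[OF this, of complex_of_real] show ?thesis by (simp only: of_real_mult of_real_prod)
    qed
    also have "\<dots> = of_real (W A * (exp (- (energy \<epsilon> S ?l - energy \<epsilon> S (len (Suc m))) / 2) * (\<Prod>\<gamma>\<in>A. 1 + P \<gamma>)))"
    proof (cases "\<forall>\<gamma>\<in>A. \<forall>\<gamma>'\<in>A. \<gamma> < \<gamma>' \<longrightarrow> int ?l \<le> \<gamma>' - \<gamma>")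
      case True
      then have "(\<Sum>(b, a)\<in>pairs. \<Sum>j\<in>?\<Gamma>. (wcoef \<epsilon> S ?l A a b j)\<^sup>2) =
          energy \<epsilon> S ?l - energy \<epsilon> S (len (Suc m)) - (\<Sum>\<gamma>\<in>A. \<Sum>i<6. (?s i \<gamma>)\<^sup>2)"
        by (intro sum_wcoef_square[OF S R fA]) auto
      then have "exp (- (\<Sum>(b, a)\<in>pairs. \<Sum>j\<in>?\<Gamma>. (wcoef \<epsilon> S ?l A a b j)\<^sup>2) / 2) *
          exp (- (\<Sum>\<gamma>\<in>A. \<Sum>i<6. (?s i \<gamma>)\<^sup>2) / 2) = exp (- (energy \<epsilon> S ?l - energy \<epsilon> S (len (Suc m))) / 2)"
        by (simp add: exp_add[symmetric] field_simps)
      then show ?thesis by (simp only: mult.assoc[symmetric])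
    next
      case False
      \<comment> \<open>Sites this close are never active together, so the weight of such an
        \<open>A\<close> is zero.\<close>
      have "act z \<noteq> A" for z
        using False active_separated[of m _ z] unfolding act_def by force
      then have "W A = 0" by (simp add: W_def w_def)
      then show ?thesis by simp
    qed
    finally show ?thesis .
  qed
  have w_int: "integrable M (\<lambda>\<omega>. w A (config \<omega>))" if "A \<subseteq> ?\<Gamma>" for A
    using measurable_compose[OF config_measurable w_meas[OF that]]
    by (intro integrable_const_bound[of _ 1]) (auto simp: w_def)
  have t_int: "integrable M (\<lambda>\<omega>. of_real (w A (config \<omega>)) * iexp (\<Phi> A (config \<omega>)))" if "A \<subseteq> ?\<Gamma>" for A
  proof (rule integrable_const_bound[of _ 1])
    have "\<Phi> A \<in> borel_measurable noise_space"
      unfolding \<Phi>_def[abs_def] case_prod_beta by measurable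
    then show "(\<lambda>\<omega>. of_real (w A (config \<omega>)) * iexp (\<Phi> A (config \<omega>))) \<in> borel_measurable M"
      using measurable_compose[OF config_measurable w_meas[OF that]]
        measurable_compose[OF config_measurable, of "\<Phi> A" borel] by simp
    show "AE \<omega> in M. norm (of_real (w A (config \<omega>)) * iexp (\<Phi> A (config \<omega>))) \<le> 1"
      by (simp add: norm_mult w_def)
  qed
  have "(CLINT \<omega>|M. iexp (\<Sum>k\<in>S. \<epsilon> k * level m k (config \<omega>))) =
      (CLINT \<omega>|M. (\<Sum>A\<in>Pow ?\<Gamma>. of_real (w A (config \<omega>)) * iexp (\<Phi> A (config \<omega>))))"
    unfolding lev
  proof (rule Bochner_Integration.integral_cong[OF refl])
    fix \<omega>
    show "iexp (\<Phi> (act (config \<omega>)) (config \<omega>)) =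
        (\<Sum>A\<in>Pow ?\<Gamma>. of_real (w A (config \<omega>)) * iexp (\<Phi> A (config \<omega>)))"
      by (rule part[of "\<lambda>A. iexp (\<Phi> A (config \<omega>))" "config \<omega>"])
  qed
  also have "\<dots> = (\<Sum>A\<in>Pow ?\<Gamma>. CLINT \<omega>|M. of_real (w A (config \<omega>)) * iexp (\<Phi> A (config \<omega>)))"
    using t_int by (intro Bochner_Integration.integral_sum) auto
  also have "\<dots> = of_real (exp (- (energy \<epsilon> S ?l - energy \<epsilon> S (len (Suc m))) / 2) *
      (\<Sum>A\<in>Pow ?\<Gamma>. W A * (\<Prod>\<gamma>\<in>A. 1 + P \<gamma>)))"
    using trm by (simp add: sum_distrib_left algebra_simps)
  also have "(\<Sum>A\<in>Pow ?\<Gamma>. W A * (\<Prod>\<gamma>\<in>A. 1 + P \<gamma>)) =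
      (LINT \<omega>|M. (\<Sum>A\<in>Pow ?\<Gamma>. w A (config \<omega>) * (\<Prod>\<gamma>\<in>A. 1 + P \<gamma>)))"
    using w_int by (subst Bochner_Integration.integral_sum) (auto simp: W_def)
  also have "\<dots> = (LINT \<omega>|M. (\<Prod>\<gamma>\<in>?\<Gamma>. 1 + of_bool (active m \<gamma> (config \<omega>)) * P \<gamma>))"
  proof (rule Bochner_Integration.integral_cong[OF refl])
    fix \<omega>
    have "(\<Sum>A\<in>Pow ?\<Gamma>. w A (config \<omega>) * (\<Prod>\<gamma>\<in>A. 1 + P \<gamma>)) = (\<Prod>\<gamma>\<in>act (config \<omega>). 1 + P \<gamma>)"
      using part[of "\<lambda>A. \<Prod>\<gamma>\<in>A. 1 + P \<gamma>" "config \<omega>"] by simp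
    also have "\<dots> = (\<Prod>\<gamma>\<in>?\<Gamma>. if active m \<gamma> (config \<omega>) then 1 + P \<gamma> else 1)"
      unfolding act_def by (rule prod.inter_filter) simp
    also have "\<dots> = (\<Prod>\<gamma>\<in>?\<Gamma>. 1 + of_bool (active m \<gamma> (config \<omega>)) * P \<gamma>)"
      by (intro prod.cong) auto
    finally show "(\<Sum>A\<in>Pow ?\<Gamma>. w A (config \<omega>) * (\<Prod>\<gamma>\<in>A. 1 + P \<gamma>)) =
        (\<Prod>\<gamma>\<in>?\<Gamma>. 1 + of_bool (active m \<gamma> (config \<omega>)) * P \<gamma>)" .
  qed
  finally show ?thesis unfolding P_def .
qed

end

text \<open>The windows reach back 37 lengths, a block one more, and the search for earlier marks
  another 50; 100 is a round bound. Since the labels carry \<open>m\<close>, levels of different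
  scales share no coordinate.\<close>

definition level_slots :: "nat \<Rightarrow> int \<Rightarrow> (int \<times> label) set" where
  "level_slots m k = {(j, x) | j x. k - 100 * int (len m) \<le> j \<and> j \<le> k \<and> (x = Inl (Suc m) \<or> (\<exists>q. x = Inr (m, q)))}"

lemma wmod_cong:
  assumes g: "\<And>q j'. j - 60 * int (len m) \<le> j' \<Longrightarrow> j' \<le> j + int (len m) \<Longrightarrow> gauss m q j' z = gauss m q j' z'"
    and mk: "\<And>j'. j - 60 * int (len m) \<le> j' \<Longrightarrow> j' \<le> j + int (len m) \<Longrightarrow> mark m j' z = mark m j' z'"
  shows "wmod m a b j z = wmod m a b j z'"
proof -
  let ?l = "int (len m)"
  have l: "1 \<le> ?l" using len_pos[of m] by linarith
  have act: "active m (j - int d) z = active m (j - int d) z'" if "d < len m" for d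
  proof -
    have "mark m (j - int d - int e) z = mark m (j - int d - int e) z'" if "e \<le> 50 * len m" for e
      using that \<open>d < len m\<close> by (intro mk) linarith+
    from this[of 0] this show ?thesis unfolding active_def by simp
  qed
  have hd: "hid m i (j - int d) z = hid m i (j - int d) z'" if "d < len m" for d i
  proof -
    have "gauss m q (j - int d) z = gauss m q (j - int d) z'" for q
      using that l by (intro g) linarith+
    then show ?thesis unfolding hid_def by simp
  qed
  have gs: "gauss m q (j - int d + int t) z = gauss m q (j - int d + int t) z'" if "d < len m" "t < len m" for d t q
    using that l by (intro g) linarith+
  have g0: "gauss m q j z = gauss m q j z'" for q using l by (intro g) linarith+
  show ?thesis unfolding wmod_def
    by (intro arg_cong2[where f = "(+)"] sum.cong refl if_cong g0 arg_cong2[where f = "(*)"]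
        arg_cong2[where f = "(-)"] arg_cong2[where f = "(/)"]) (simp_all add: act hd gs)
qed

lemma level_depends_on: "depends_on (level_slots m k) (level m k)"
proof (rule depends_onI)
  fix z z' :: "int \<times> label \<Rightarrow> real"
  assume eq: "\<And>x. x \<in> level_slots m k \<Longrightarrow> z x = z' x"
  let ?l = "int (len m)"
  have l: "1 \<le> ?l" using len_pos[of m] by linarith
  have g: "gauss m q j z = gauss m q j z'" if "k - 100 * ?l \<le> j" "j \<le> k" for q j
    unfolding gauss_def by (rule eq) (use that in \<open>auto simp: level_slots_def\<close>)
  have mk: "mark m j z = mark m j z'" if "k - 100 * ?l \<le> j" "j \<le> k" for j
    unfolding mark_def by (subst eq) (use that in \<open>auto simp: level_slots_def\<close>)
  have w: "wmod m a b (k - (int c + 1) * ?l - int t) z = wmod m a b (k - (int c + 1) * ?l - int t) z'"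
    if "c < 36" "t < len m" for a b c t
    using shift_bounds[OF that(1), of k "len m"] that(2) by (intro wmod_cong g mk) linarith+
  show "level m k z = level m k z'" unfolding level_def
  proof (rule arg_cong2[where f = "(/)", OF sum.cong[OF refl] refl], clarify)
    fix b a assume "(b, a) \<in> pairs"
    then have ab: "a < 36" "b < 36" by (auto simp: pairs_def)
    show "(\<Sum>t<len m. wmod m a b (k - (int a + 1) * ?l - int t) z - wmod m a b (k - (int b + 1) * ?l - int t) z) =
        (\<Sum>t<len m. wmod m a b (k - (int a + 1) * ?l - int t) z' - wmod m a b (k - (int b + 1) * ?l - int t) z')"
      by (intro sum.cong refl arg_cong2[where f = "(-)"] w ab) auto
  qed
qed

lemma depends_on_mono: "depends_on K F \<Longrightarrow> K \<subseteq> K' \<Longrightarrow> depends_on K' F"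
  unfolding depends_on_def by blast

section \<open>The signs and their product moments\<close>

text \<open>\<open>suminf\<close> has an arbitrary value where the series diverges; by
  \<open>AE_summable_level\<close> this happens with probability 0.\<close>

definition drift :: "int \<Rightarrow> (int \<times> label \<Rightarrow> real) \<Rightarrow> real" where
  "drift k z = (\<Sum>m. level m k z)"

definition signal :: "int \<Rightarrow> (int \<times> label \<Rightarrow> real) \<Rightarrow> real" where
  "signal k z = (if z (k, Inl 0) < (1 + sin (drift k z)) / 2 then 1 else -1)"

lemma drift_measurable [measurable]: "drift k \<in> borel_measurable noise_space"
  unfolding drift_def by (intro borel_measurable_suminf level_measurable)

lemma signal_measurable [measurable]: "signal k \<in> borel_measurable noise_space"
proof -
  have "Measurable.pred noise_space (\<lambda>z. z (k, Inl 0) < (1 + sin (drift k z)) / 2)"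
    by (intro borel_measurable_pred_less component_measurable borel_measurable_divide borel_measurable_add
        measurable_compose[OF drift_measurable borel_measurable_sin] borel_measurable_const)
  then show ?thesis unfolding signal_def pred_def by (intro measurable_If borel_measurable_const)
qed

definition past_slots :: "int \<Rightarrow> (int \<times> label) set" where
  "past_slots k = {(j, x) | j x. j \<le> k}"

text \<open>Besides causality this records that no drift reads a coin \<open>Inl 0\<close>, which is
  what allows a coin to be resampled while all drifts stay fixed.\<close>

lemma drift_depends_on: "depends_on (past_slots k - {(j, Inl 0) | j. True}) (drift k)"
proof -
  have "depends_on (past_slots k - {(j, Inl 0) | j. True}) (level m k)" for m
    by (rule depends_on_mono[OF level_depends_on]) (auto simp: level_slots_def past_slots_def)
  note dep = depends_onD[OF this]
  show ?thesis
  proof (rule depends_onI)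
    fix z z' :: "int \<times> label \<Rightarrow> real"
    assume eq: "\<And>x. x \<in> past_slots k - {(j, Inl 0) | j. True} \<Longrightarrow> z x = z' x"
    have "level m k z = level m k z'" for m by (rule dep) (rule eq)
    then show "drift k z = drift k z'" unfolding drift_def by (simp only:)
  qed
qed

text \<open>All mixed products vanish. Used for the sites of one scale, and again for the
  scales.\<close>

lemma prod_one_plus_single:
  fixes x :: "'i \<Rightarrow> 'b::comm_ring_1"
  assumes "finite I" and "\<And>i j. i \<in> I \<Longrightarrow> j \<in> I \<Longrightarrow> x i \<noteq> 0 \<Longrightarrow> x j \<noteq> 0 \<Longrightarrow> i = j"
  shows "(\<Prod>i\<in>I. 1 + x i) = 1 + (\<Sum>i\<in>I. x i)"
  using assms
proof (induction I rule: finite_induct)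
  case (insert a I)
  have IH: "(\<Prod>i\<in>I. 1 + x i) = 1 + (\<Sum>i\<in>I. x i)" using insert.prems by (intro insert.IH) auto
  show ?case
  proof (cases "x a = 0")
    case True then show ?thesis using insert.hyps IH by simp
  next
    case False
    then have "x i = 0" if "i \<in> I" for i using insert.prems[of a i] insert.hyps that by auto
    then have "(\<Sum>i\<in>I. x i) = 0" by simp
    then show ?thesis using insert.hyps IH by simp
  qed
qed simp

section \<open>From one scale to the whole drift\<close>

context noise
begin

lemma char_level_single:
  "(CLINT \<omega>|M. iexp (t * level m k (config \<omega>))) =
    of_real (exp (- (t\<^sup>2 * (35 / (36 * real (len m)))) / 2))"
proof -
  have "(CLINT \<omega>|M. iexp (\<Sum>k'\<in>{k}. t * level m k' (config \<omega>))) =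
    of_real (exp (- (energy (\<lambda>_. t) {k} (len m) - energy (\<lambda>_. t) {k} (len (Suc m))) / 2) *
      (LINT \<omega>|M. (\<Prod>\<gamma>\<in>{-(\<bar>k\<bar> + 40 * int (len m))..(\<bar>k\<bar> + 40 * int (len m))}.
        1 + of_bool (active m \<gamma> (config \<omega>)) * (\<Prod>i<6. tilt (kersum (\<lambda>_. t) {k} (len m) i \<gamma>)))))"
    by (rule integral_iexp_sum_level[where B = "\<bar>k\<bar>"]) auto
  moreover have "(\<Prod>i<6. tilt (kersum (\<lambda>_. t) {k} (len m) i \<gamma>)) = 0" for \<gamma>
    by (rule prod_tilt_kersum_small) auto
  moreover have "energy (\<lambda>_. t) {k} (len m) - energy (\<lambda>_. t) {k} (len (Suc m)) = t\<^sup>2 * (35 / (36 * real (len m)))"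
    using len_pos[of m] by (simp add: energy_singleton len_Suc field_simps)
  ultimately show ?thesis by (simp add: prob_space)
qed

text \<open>A single point sees no dependence, so the characteristic function is exactly Gaussian
  with variance below \<open>1 / 36 ^ m\<close>. The mean absolute value is then at most the
  standard deviation, which makes the levels summable.\<close>

lemma integral_abs_level:
  "integrable M (\<lambda>\<omega>. level m k (config \<omega>))" "(LINT \<omega>|M. \<bar>level m k (config \<omega>)\<bar>) \<le> (1 / 6) ^ m"
proof -
  define v where "v = 35 / (36 * real (len m))"
  have l: "0 < real (len m)" using len_pos[of m] by linarith
  have v: "0 < v" using l by (simp add: v_def)
  define \<nu> where "\<nu> = distr M borel (\<lambda>\<omega>. level m k (config \<omega>) / sqrt v)"
  have meas: "(\<lambda>\<omega>. level m k (config \<omega>) / sqrt v) \<in> borel_measurable M" by measurable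
  have rd: "real_distribution \<nu>" unfolding \<nu>_def by (rule real_distribution_distr[OF meas])
  have "char \<nu> = char std_normal_distribution"
  proof
    fix t
    have "char \<nu> t = (CLINT \<omega>|M. iexp (t * (level m k (config \<omega>) / sqrt v)))"
      unfolding char_def \<nu>_def by (rule integral_distr[OF meas]) measurable
    also have "\<dots> = (CLINT \<omega>|M. iexp ((t / sqrt v) * level m k (config \<omega>)))" by simp
    also have "\<dots> = of_real (exp (- ((t / sqrt v)\<^sup>2 * v) / 2))"
      unfolding char_level_single v_def ..
    also have "(t / sqrt v)\<^sup>2 * v = t\<^sup>2" using v by (simp add: power_divide)
    finally show "char \<nu> t = char std_normal_distribution t" by (simp add: char_std_normal_distribution)
  qed
  then have eq: "\<nu> = std_normal_distribution"
    by (intro Levy_uniqueness rd real_dist_normal_dist)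
  have i1: "integrable \<nu> (\<lambda>x. x)"
    unfolding eq using integrable_std_normal_distribution_moment[of 1] by simp
  then have i2: "integrable M (\<lambda>\<omega>. level m k (config \<omega>) / sqrt v)"
    unfolding \<nu>_def using integrable_distr[OF meas, of "\<lambda>x. x"] by simp
  then have "integrable M (\<lambda>\<omega>. sqrt v * (level m k (config \<omega>) / sqrt v))" by (rule integrable_mult_right)
  then show "integrable M (\<lambda>\<omega>. level m k (config \<omega>))" using v by simp
  have "(LINT \<omega>|M. \<bar>level m k (config \<omega>)\<bar>) = (LINT \<omega>|M. sqrt v * \<bar>level m k (config \<omega>) / sqrt v\<bar>)"
    using v by (simp add: abs_divide)
  also have "\<dots> = sqrt v * (LINT x|\<nu>. \<bar>x\<bar>)"
    unfolding \<nu>_def by (subst integral_distr[OF meas]) auto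
  also have "(LINT x|\<nu>. \<bar>x\<bar>) = sqrt (2 / pi)"
    unfolding eq using std_normal_distribution_odd_moments_abs[of 0] by simp
  also have "sqrt v * sqrt (2 / pi) \<le> (1 / 6) ^ m * 1"
  proof (rule mult_mono)
    have "sqrt v \<le> sqrt (1 / real (len m))" using l by (simp add: v_def field_simps)
    also have "1 / real (len m) = ((1 / 6) ^ m)\<^sup>2"
      by (simp add: len_def power_divide power_mult[symmetric]) (simp add: power_mult mult.commute[of m])
    finally show "sqrt v \<le> (1 / 6) ^ m" by simp
    show "sqrt (2 / pi) \<le> 1" using pi_gt3 by simp
  qed auto
  finally show "(LINT \<omega>|M. \<bar>level m k (config \<omega>)\<bar>) \<le> (1 / 6) ^ m" by simp
qed

lemma AE_summable_level: "AE \<omega> in M. \<forall>k. summable (\<lambda>m. level m k (config \<omega>))"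
proof -
  have "AE \<omega> in M. summable (\<lambda>m. level m k (config \<omega>))" for k
  proof -
    have "(\<integral>\<^sup>+\<omega>. (\<Sum>m. ennreal \<bar>level m k (config \<omega>)\<bar>) \<partial>M) =
        (\<Sum>m. \<integral>\<^sup>+\<omega>. ennreal \<bar>level m k (config \<omega>)\<bar> \<partial>M)"
      by (rule nn_integral_suminf) measurable
    also have "\<dots> \<le> (\<Sum>m. ennreal ((1 / 6) ^ m))"
    proof (rule suminf_le)
      fix m
      have "(\<integral>\<^sup>+\<omega>. ennreal \<bar>level m k (config \<omega>)\<bar> \<partial>M) = ennreal (LINT \<omega>|M. \<bar>level m k (config \<omega>)\<bar>)"
        by (intro nn_integral_eq_integral integrable_abs integral_abs_level) auto
      also have "\<dots> \<le> ennreal ((1 / 6) ^ m)" by (intro ennreal_leI integral_abs_level)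
      finally show "(\<integral>\<^sup>+\<omega>. ennreal \<bar>level m k (config \<omega>)\<bar> \<partial>M) \<le> ennreal ((1 / 6) ^ m)" .
    qed auto
    also have "\<dots> = ennreal (\<Sum>m. (1 / 6) ^ m)" by (rule suminf_ennreal2) auto
    also have "\<dots> < \<infinity>" by simp
    finally have "AE \<omega> in M. (\<Sum>m. ennreal \<bar>level m k (config \<omega>)\<bar>) \<noteq> \<infinity>"
      by (intro nn_integral_PInf_AE) auto
    then show ?thesis
    proof (rule eventually_mono)
      fix \<omega> assume "(\<Sum>m. ennreal \<bar>level m k (config \<omega>)\<bar>) \<noteq> \<infinity>"
      then have "summable (\<lambda>m. \<bar>level m k (config \<omega>)\<bar>)" by (intro summable_suminf_not_top) auto
      then show "summable (\<lambda>m. level m k (config \<omega>))" by (rule summable_rabs_cancel)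
    qed
  qed
  then show ?thesis by (simp add: AE_all_countable)
qed

definition pdrift :: "nat \<Rightarrow> int \<Rightarrow> (int \<times> label \<Rightarrow> real) \<Rightarrow> real" where
  "pdrift N k z = (\<Sum>m<N. level m k z)"

lemma pdrift_measurable [measurable]: "pdrift N k \<in> borel_measurable noise_space"
  unfolding pdrift_def by measurable

lemma AE_pdrift_tendsto: "AE \<omega> in M. \<forall>k. (\<lambda>N. pdrift N k (config \<omega>)) \<longlonglongrightarrow> drift k (config \<omega>)"
  using AE_summable_level unfolding pdrift_def drift_def
  by (rule eventually_mono) (auto intro: summable_LIMSEQ)

text \<open>The scale is part of the labels, so different scales read disjoint coordinates and are
  independent.\<close>

lemma char_pdrift_prod:
  "(CLINT \<omega>|M. iexp (\<Sum>k\<in>S. \<epsilon> k * pdrift N k (config \<omega>))) =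
    (\<Prod>m<N. CLINT \<omega>|M. iexp (\<Sum>k\<in>S. \<epsilon> k * level m k (config \<omega>)))"
proof -
  have "iexp (\<Sum>k\<in>S. \<epsilon> k * pdrift N k z) = (\<Prod>m<N. iexp (\<Sum>k\<in>S. \<epsilon> k * level m k z))" for z
  proof -
    have "(\<Sum>k\<in>S. \<epsilon> k * pdrift N k z) = (\<Sum>m<N. \<Sum>k\<in>S. \<epsilon> k * level m k z)"
      unfolding pdrift_def sum_distrib_left by (rule sum.swap)
    then show ?thesis by (simp only: of_real_sum sum_distrib_left[of _ _ "{..<N}"] exp_sum[OF finite_lessThan])
  qed
  moreover have "(CLINT \<omega>|M. (\<Prod>m<N. iexp (\<Sum>k\<in>S. \<epsilon> k * level m k (config \<omega>)))) =
      (\<Prod>m<N. CLINT \<omega>|M. iexp (\<Sum>k\<in>S. \<epsilon> k * level m k (config \<omega>)))"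
  proof (rule integral_prod_depends_on[where K = "\<lambda>m. \<Union>k. level_slots m k" and C = 1])
    fix m
    show "(\<lambda>z. iexp (\<Sum>k\<in>S. \<epsilon> k * level m k z)) \<in> borel_measurable noise_space" by measurable
    show "depends_on (\<Union>k. level_slots m k) (\<lambda>z. iexp (\<Sum>k\<in>S. \<epsilon> k * level m k z))"
    proof -
      have "depends_on (\<Union>k. level_slots m k) (level m k)" for k
        by (rule depends_on_mono[OF level_depends_on]) auto
      note dep = depends_onD[OF this]
      show ?thesis
      proof (rule depends_onI)
        fix z z' :: "int \<times> label \<Rightarrow> real"
        assume eq: "\<And>x. x \<in> (\<Union>k. level_slots m k) \<Longrightarrow> z x = z' x"
        have "level m k z = level m k z'" for k by (rule dep) (rule eq)
        then show "iexp (\<Sum>k\<in>S. \<epsilon> k * level m k z) = iexp (\<Sum>k\<in>S. \<epsilon> k * level m k z')" by (simp only:)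
      qed
    qed
  qed (auto simp: disjoint_family_on_def level_slots_def simp del: of_real_sum)
  ultimately show ?thesis by simp
qed

text \<open>With fewer than six points no active site contributes, and the Gaussian factors of the
  scales telescope.\<close>

lemma char_pdrift_small:
  assumes S: "finite S" "card S < 6"
  shows "(CLINT \<omega>|M. iexp (\<Sum>k\<in>S. \<epsilon> k * pdrift N k (config \<omega>))) =
    of_real (exp (- (energy \<epsilon> S 1 - energy \<epsilon> S (len N)) / 2))"
proof -
  define B where "B = Max (abs ` S)"
  have B: "\<bar>k\<bar> \<le> B" if "k \<in> S" for k unfolding B_def using S(1) that by (intro Max_ge) auto
  have "(CLINT \<omega>|M. iexp (\<Sum>k\<in>S. \<epsilon> k * level m k (config \<omega>))) =
      of_real (exp (- (energy \<epsilon> S (len m) - energy \<epsilon> S (len (Suc m))) / 2))" for m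
    using integral_iexp_sum_level[OF S(1) B order_refl, of \<epsilon> m] prod_tilt_kersum_small[OF S]
    by (simp add: prob_space)
  then have "(CLINT \<omega>|M. iexp (\<Sum>k\<in>S. \<epsilon> k * pdrift N k (config \<omega>))) =
      of_real (\<Prod>m<N. exp (- (energy \<epsilon> S (len m) - energy \<epsilon> S (len (Suc m))) / 2))"
    unfolding char_pdrift_prod by simp
  also have "(\<Prod>m<N. exp (- (energy \<epsilon> S (len m) - energy \<epsilon> S (len (Suc m))) / 2)) =
      exp (- (energy \<epsilon> S 1 - energy \<epsilon> S (len N)) / 2)"
    by (induction N) (auto simp: len_def exp_add[symmetric] field_simps)
  finally show ?thesis .
qed

text \<open>The expected correction that scale \<open>m\<close> makes to the characteristic function
  of the six points in \<open>S\<close>.\<close>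

definition rate :: "nat \<Rightarrow> int \<Rightarrow> int set \<Rightarrow> real" where
  "rate m B S = activity m * (\<Sum>\<gamma>\<in>{-(B + 40 * int (len m))..B + 40 * int (len m)}. corr (len m) S \<gamma>)"

text \<open>The sites relevant to six points lie within \<open>36 * len m\<close> of each other,
  active sites more than \<open>50 * len m\<close> apart; so at most one factor of a scale differs
  from 1, and only one scale has a correction at all. Both products thus become 1 plus a sum, and
  the expectation needs only the probability of a single site being active.\<close>

lemma char_pdrift_six:
  assumes S: "finite S" "card S = 6" and B: "\<And>k. k \<in> S \<Longrightarrow> \<bar>k\<bar> \<le> B"
    and \<epsilon>: "\<And>k. k \<in> S \<Longrightarrow> \<epsilon> k = 1 \<or> \<epsilon> k = -1"
  shows "(CLINT \<omega>|M. iexp (\<Sum>k\<in>S. \<epsilon> k * pdrift N k (config \<omega>))) =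
    of_real (exp (- (energy \<epsilon> S 1 - energy \<epsilon> S (len N)) / 2) * (1 + (\<Prod>k\<in>S. \<epsilon> k) * (\<Sum>m<N. rate m B S)))"
proof -
  let ?\<pi> = "\<Prod>k\<in>S. \<epsilon> k"
  have lev: "(CLINT \<omega>|M. iexp (\<Sum>k\<in>S. \<epsilon> k * level m k (config \<omega>))) =
      of_real (exp (- (energy \<epsilon> S (len m) - energy \<epsilon> S (len (Suc m))) / 2) * (1 + ?\<pi> * rate m B S))" for m
  proof -
    let ?\<Gamma> = "{-(B + 40 * int (len m))..B + 40 * int (len m)}"
    have "(LINT \<omega>|M. (\<Prod>\<gamma>\<in>?\<Gamma>. 1 + of_bool (active m \<gamma> (config \<omega>)) * (?\<pi> * corr (len m) S \<gamma>))) =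
        (LINT \<omega>|M. 1 + (\<Sum>\<gamma>\<in>?\<Gamma>. of_bool (active m \<gamma> (config \<omega>)) * (?\<pi> * corr (len m) S \<gamma>)))"
    proof (rule Bochner_Integration.integral_cong[OF refl], rule prod_one_plus_single)
      fix \<omega> \<gamma> \<gamma>'
      assume nz: "of_bool (active m \<gamma> (config \<omega>)) * (?\<pi> * corr (len m) S \<gamma>) \<noteq> 0"
        "of_bool (active m \<gamma>' (config \<omega>)) * (?\<pi> * corr (len m) S \<gamma>') \<noteq> 0"
      then have a: "active m \<gamma> (config \<omega>)" "active m \<gamma>' (config \<omega>)" and c: "corr (len m) S \<gamma> \<noteq> 0" "corr (len m) S \<gamma>' \<noteq> 0"
        by (auto split: if_splits)
      show "\<gamma> = \<gamma>'"
        using corr_unique(2)[OF S c] active_separated[OF a] active_separated[OF a(2,1)] len_pos[of m] by linarith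
    qed simp
    also have "\<dots> = 1 + (\<Sum>\<gamma>\<in>?\<Gamma>. activity m * (?\<pi> * corr (len m) S \<gamma>))"
    proof -
      have "(\<lambda>z. of_bool (active m \<gamma> z) :: real) \<in> borel_measurable noise_space" for \<gamma>
        unfolding of_bool_def by measurable
      then have i: "integrable M (\<lambda>\<omega>. of_bool (active m \<gamma> (config \<omega>)) :: real)" for \<gamma>
        by (intro integrable_const_bound[of _ 1]) (auto intro: measurable_compose[OF config_measurable])
      define u where "u \<gamma> \<omega> = (of_bool (active m \<gamma> (config \<omega>)) :: real)" for \<gamma> \<omega>
      have u: "integrable M (u \<gamma>)" "integral\<^sup>L M (u \<gamma>) = activity m" for \<gamma>
        unfolding u_def[abs_def] by (rule i, rule integral_active)
      define c where "c \<gamma> = ?\<pi> * corr (len m) S \<gamma>" for \<gamma>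
      have i2: "integrable M (\<lambda>\<omega>. u \<gamma> \<omega> * c \<gamma>)" for \<gamma> using u(1) by (rule integrable_mult_left)
      have "(LINT \<omega>|M. 1 + (\<Sum>\<gamma>\<in>?\<Gamma>. u \<gamma> \<omega> * c \<gamma>)) = (LINT \<omega>|M. 1) + (LINT \<omega>|M. (\<Sum>\<gamma>\<in>?\<Gamma>. u \<gamma> \<omega> * c \<gamma>))"
        by (rule Bochner_Integration.integral_add) (auto intro: i2)
      also have "(LINT \<omega>|M. (\<Sum>\<gamma>\<in>?\<Gamma>. u \<gamma> \<omega> * c \<gamma>)) = (\<Sum>\<gamma>\<in>?\<Gamma>. LINT \<omega>|M. u \<gamma> \<omega> * c \<gamma>)"
        by (rule Bochner_Integration.integral_sum) (rule i2)
      also have "\<dots> = (\<Sum>\<gamma>\<in>?\<Gamma>. activity m * c \<gamma>)"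
        by (rule sum.cong[OF refl]) (simp add: u(2))
      finally show ?thesis unfolding u_def c_def by (simp add: prob_space)
    qed
    also have "\<dots> = 1 + ?\<pi> * rate m B S"
      by (simp add: rate_def sum_distrib_left algebra_simps)
    finally have A: "(LINT \<omega>|M. (\<Prod>\<gamma>\<in>?\<Gamma>. 1 + of_bool (active m \<gamma> (config \<omega>)) * (?\<pi> * corr (len m) S \<gamma>))) = 1 + ?\<pi> * rate m B S" .
    have P: "(\<Prod>i<6. tilt (kersum \<epsilon> S (len m) i \<gamma>)) = ?\<pi> * corr (len m) S \<gamma>" for \<gamma>
      by (rule prod_tilt_kersum_six(1)[OF S \<epsilon>])
    show ?thesis
      using integral_iexp_sum_level[OF S(1) B order_refl, of \<epsilon> m] unfolding P A .
  qed
  have ex: "\<exists>\<gamma>. corr (len m) S \<gamma> \<noteq> 0" if "rate m B S \<noteq> 0" for m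
  proof (rule ccontr)
    assume "\<not> ?thesis"
    then have "rate m B S = 0" by (simp add: rate_def)
    then show False using that by simp
  qed
  have "(\<Prod>m<N. 1 + ?\<pi> * rate m B S) = 1 + (\<Sum>m<N. ?\<pi> * rate m B S)"
  proof (rule prod_one_plus_single)
    fix m m' assume nz: "?\<pi> * rate m B S \<noteq> 0" "?\<pi> * rate m' B S \<noteq> 0"
    obtain \<gamma> where g: "corr (len m) S \<gamma> \<noteq> 0" using ex[of m] nz(1) by auto
    obtain \<gamma>' where g': "corr (len m') S \<gamma>' \<noteq> 0" using ex[of m'] nz(2) by auto
    show "m = m'" by (rule corr_unique(1)[OF S g g'])
  qed simp
  moreover have "(\<Prod>m<N. exp (- (energy \<epsilon> S (len m) - energy \<epsilon> S (len (Suc m))) / 2)) =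
      exp (- (energy \<epsilon> S 1 - energy \<epsilon> S (len N)) / 2)"
    by (induction N) (auto simp: len_def exp_add[symmetric] field_simps)
  ultimately show ?thesis
    unfolding char_pdrift_prod lev of_real_prod[symmetric] prod.distrib by (simp add: sum_distrib_left)
qed

end

section \<open>Product moments of the sines\<close>

definition sign_of :: "'a set \<Rightarrow> 'a \<Rightarrow> real" where
  "sign_of T k = (if k \<in> T then 1 else -1)"

lemma prod_sin_conv_iexp:
  fixes y :: "'a \<Rightarrow> real"
  assumes S: "finite S"
  shows "of_real (\<Prod>k\<in>S. sin (y k)) =
    (1 / (2 * \<i>)) ^ card S * (\<Sum>T\<in>Pow S. of_real (\<Prod>k\<in>S. sign_of T k) * iexp (\<Sum>k\<in>S. sign_of T k * y k))"
proof -
  have s: "of_real (sin (y k)) = (1 / (2 * \<i>)) * (iexp (y k) + - iexp (- y k))" for k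
    unfolding iexp_conv_cos_sin by simp
  have "of_real (\<Prod>k\<in>S. sin (y k)) = (1 / (2 * \<i>)) ^ card S * (\<Prod>k\<in>S. iexp (y k) + - iexp (- y k))"
    by (simp only: of_real_prod s prod.distrib prod_constant)
  also have "(\<Prod>k\<in>S. iexp (y k) + - iexp (- y k)) =
      (\<Sum>T\<in>Pow S. (\<Prod>k\<in>T. iexp (y k)) * (\<Prod>k\<in>S - T. - iexp (- y k)))"
    by (rule prod_add[OF S])
  also have "\<dots> = (\<Sum>T\<in>Pow S. of_real (\<Prod>k\<in>S. sign_of T k) * iexp (\<Sum>k\<in>S. sign_of T k * y k))"
  proof (rule sum.cong[OF refl])
    fix T assume "T \<in> Pow S"
    then have TS: "S \<inter> T = T" "S \<inter> - T = S - T" by auto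
    have "of_real (\<Prod>k\<in>S. sign_of T k) * iexp (\<Sum>k\<in>S. sign_of T k * y k) =
        (\<Prod>k\<in>S. of_real (sign_of T k) * iexp (sign_of T k * y k))"
      by (simp only: of_real_prod of_real_sum sum_distrib_left exp_sum[OF S] prod.distrib)
    also have "\<dots> = (\<Prod>k\<in>S. if k \<in> T then iexp (y k) else - iexp (- y k))"
      by (intro prod.cong refl) (auto simp: sign_of_def)
    also have "\<dots> = (\<Prod>k\<in>T. iexp (y k)) * (\<Prod>k\<in>S - T. - iexp (- y k))"
      unfolding prod.If_cases[OF S] Collect_mem_eq TS ..
    finally show "(\<Prod>k\<in>T. iexp (y k)) * (\<Prod>k\<in>S - T. - iexp (- y k)) =
        of_real (\<Prod>k\<in>S. sign_of T k) * iexp (\<Sum>k\<in>S. sign_of T k * y k)" by simp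
  qed
  finally show ?thesis .
qed

lemma sum_prod_sign_of:
  assumes S: "finite S" "S \<noteq> {}"
  shows "(\<Sum>T\<in>Pow S. \<Prod>k\<in>S. sign_of T k) = 0"
proof -
  have "(\<Prod>k\<in>S. (1::real) + -1) = (\<Sum>T\<in>Pow S. (\<Prod>k\<in>T. 1) * (\<Prod>k\<in>S - T. -1))"
    by (rule prod_add[OF S(1)])
  also have "\<dots> = (\<Sum>T\<in>Pow S. \<Prod>k\<in>S. sign_of T k)"
  proof (rule sum.cong[OF refl])
    fix T assume "T \<in> Pow S"
    then have TS: "S \<inter> T = T" "S \<inter> - T = S - T" by auto
    show "(\<Prod>k\<in>T. 1) * (\<Prod>k\<in>S - T. -1) = (\<Prod>k\<in>S. sign_of T k)"
      unfolding sign_of_def prod.If_cases[OF S(1)] Collect_mem_eq TS ..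
  qed
  finally show ?thesis using S by (simp add: card_gt_0_iff power_0_left)
qed

lemma prod_sign_of_square: "(\<Prod>k\<in>S. sign_of T k) * (\<Prod>k\<in>S. sign_of T k) = 1"
  unfolding prod.distrib[symmetric] by (rule prod.neutral) (simp add: sign_of_def)

lemma energy_tendsto_0:
  assumes "finite S"
  shows "(\<lambda>N. energy \<epsilon> S (len N)) \<longlonglongrightarrow> 0"
proof (rule Lim_null_comparison)
  show "eventually (\<lambda>N. norm (energy \<epsilon> S (len N)) \<le> (\<Sum>k\<in>S. \<bar>\<epsilon> k\<bar>)\<^sup>2 * (1 / 36) ^ N) sequentially"
    using energy_bound[OF assms len_pos, of \<epsilon>] by (intro always_eventually) (auto simp: len_def power_divide)
  show "(\<lambda>N. (\<Sum>k\<in>S. \<bar>\<epsilon> k\<bar>)\<^sup>2 * (1 / 36) ^ N) \<longlonglongrightarrow> 0"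
    by (rule tendsto_mult_right_zero) (rule LIMSEQ_realpow_zero, auto)
qed

lemma energy_signs: "finite S \<Longrightarrow> energy (sign_of T) S 1 = card S"
proof -
  assume "finite S"
  moreover have "(sign_of T k)\<^sup>2 = 1" for k by (simp add: sign_of_def)
  ultimately show ?thesis by (simp only: energy_1) simp
qed

context noise
begin

lemma char_drift_lim:
  assumes S: "finite S"
  shows "(\<lambda>N. CLINT \<omega>|M. iexp (\<Sum>k\<in>S. \<epsilon> k * pdrift N k (config \<omega>))) \<longlonglongrightarrow>
    (CLINT \<omega>|M. iexp (\<Sum>k\<in>S. \<epsilon> k * drift k (config \<omega>)))"
proof (rule integral_dominated_convergence[where w = "\<lambda>_. 1"])
  show "AE \<omega> in M. (\<lambda>N. iexp (\<Sum>k\<in>S. \<epsilon> k * pdrift N k (config \<omega>))) \<longlonglongrightarrow> iexp (\<Sum>k\<in>S. \<epsilon> k * drift k (config \<omega>))"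
    using AE_pdrift_tendsto
  proof (rule eventually_mono)
    fix \<omega> assume "\<forall>k. (\<lambda>N. pdrift N k (config \<omega>)) \<longlonglongrightarrow> drift k (config \<omega>)"
    then have "(\<lambda>N. pdrift N k (config \<omega>)) \<longlonglongrightarrow> drift k (config \<omega>)" for k by blast
    then show "(\<lambda>N. iexp (\<Sum>k\<in>S. \<epsilon> k * pdrift N k (config \<omega>))) \<longlonglongrightarrow> iexp (\<Sum>k\<in>S. \<epsilon> k * drift k (config \<omega>))"
      by (intro tendsto_exp tendsto_mult tendsto_of_real tendsto_sum tendsto_const)
  qed
qed (simp_all del: of_real_sum)

lemma char_drift_small:
  assumes S: "finite S" "card S < 6"
  shows "(CLINT \<omega>|M. iexp (\<Sum>k\<in>S. \<epsilon> k * drift k (config \<omega>))) = of_real (exp (- energy \<epsilon> S 1 / 2))"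
proof (rule LIMSEQ_unique[OF char_drift_lim[OF S(1)]])
  have "(\<lambda>N. exp (- (energy \<epsilon> S 1 - energy \<epsilon> S (len N)) / 2)) \<longlonglongrightarrow> exp (- (energy \<epsilon> S 1 - 0) / 2)"
    by (intro tendsto_intros energy_tendsto_0 S) auto
  then show "(\<lambda>N. CLINT \<omega>|M. iexp (\<Sum>k\<in>S. \<epsilon> k * pdrift N k (config \<omega>))) \<longlonglongrightarrow> of_real (exp (- energy \<epsilon> S 1 / 2))"
    unfolding char_pdrift_small[OF S] by (intro tendsto_of_real) simp
qed

lemma char_drift_six:
  assumes S: "finite S" "card S = 6" and B: "\<And>k. k \<in> S \<Longrightarrow> \<bar>k\<bar> \<le> B"
    and \<epsilon>: "\<And>k. k \<in> S \<Longrightarrow> \<epsilon> k = 1 \<or> \<epsilon> k = -1"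
    and z: "\<And>m. m \<ge> N \<Longrightarrow> rate m B S = 0"
  shows "(CLINT \<omega>|M. iexp (\<Sum>k\<in>S. \<epsilon> k * drift k (config \<omega>))) =
    of_real (exp (- energy \<epsilon> S 1 / 2) * (1 + (\<Prod>k\<in>S. \<epsilon> k) * (\<Sum>m<N. rate m B S)))"
proof (rule LIMSEQ_unique[OF char_drift_lim[OF S(1)]])
  have e: "(CLINT \<omega>|M. iexp (\<Sum>k\<in>S. \<epsilon> k * pdrift N k (config \<omega>))) =
    of_real (exp (- (energy \<epsilon> S 1 - energy \<epsilon> S (len N)) / 2) * (1 + (\<Prod>k\<in>S. \<epsilon> k) * (\<Sum>m<N. rate m B S)))" for N
    by (rule char_pdrift_six[OF S]) (erule B, erule \<epsilon>)
  have l: "(\<lambda>N. \<Sum>m<N. rate m B S) \<longlonglongrightarrow> (\<Sum>m<N. rate m B S)"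
    using sums_finite[of "{..<N}" "\<lambda>m. rate m B S"] z unfolding sums_def by auto
  have "(\<lambda>N. exp (- (energy \<epsilon> S 1 - energy \<epsilon> S (len N)) / 2) * (1 + (\<Prod>k\<in>S. \<epsilon> k) * (\<Sum>m<N. rate m B S)))
      \<longlonglongrightarrow> exp (- (energy \<epsilon> S 1 - 0) / 2) * (1 + (\<Prod>k\<in>S. \<epsilon> k) * (\<Sum>m<N. rate m B S))"
    by (intro tendsto_intros energy_tendsto_0 S l) auto
  then show "(\<lambda>N. CLINT \<omega>|M. iexp (\<Sum>k\<in>S. \<epsilon> k * pdrift N k (config \<omega>))) \<longlonglongrightarrow>
      of_real (exp (- energy \<epsilon> S 1 / 2) * (1 + (\<Prod>k\<in>S. \<epsilon> k) * (\<Sum>m<N. rate m B S)))"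
    unfolding e by (intro tendsto_of_real) simp
qed

text \<open>Each choice of signs is weighted with the product of the signs. The Gaussian term keeps
  this weight, and \<open>sum_prod_sign_of\<close> later cancels it for nonempty \<open>S\<close>;
  in the correction the product appears squared, so all \<open>2 ^ card S\<close> choices add
  up.\<close>

lemma integral_prod_sin_drift:
  assumes S: "finite S"
    and c: "\<And>T. (CLINT \<omega>|M. iexp (\<Sum>k\<in>S. sign_of T k * drift k (config \<omega>))) =
      of_real (e * (1 + (\<Prod>k\<in>S. sign_of T k) * \<rho>))"
  shows "of_real (LINT \<omega>|M. (\<Prod>k\<in>S. sin (drift k (config \<omega>)))) =
    (1 / (2 * \<i>)) ^ card S * of_real (e * ((\<Sum>T\<in>Pow S. \<Prod>k\<in>S. sign_of T k) + 2 ^ card S * \<rho>))"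
proof -
  have "complex_of_real (LINT \<omega>|M. (\<Prod>k\<in>S. sin (drift k (config \<omega>)))) =
      (CLINT \<omega>|M. of_real (\<Prod>k\<in>S. sin (drift k (config \<omega>))))" by (rule integral_complex_of_real[symmetric])
  also have "\<dots> = (1 / (2 * \<i>)) ^ card S *
      (CLINT \<omega>|M. (\<Sum>T\<in>Pow S. of_real (\<Prod>k\<in>S. sign_of T k) * iexp (\<Sum>k\<in>S. sign_of T k * drift k (config \<omega>))))"
    unfolding prod_sin_conv_iexp[OF S] by (rule integral_mult_right_zero)
  also have "(CLINT \<omega>|M. (\<Sum>T\<in>Pow S. of_real (\<Prod>k\<in>S. sign_of T k) * iexp (\<Sum>k\<in>S. sign_of T k * drift k (config \<omega>)))) =
      (\<Sum>T\<in>Pow S. CLINT \<omega>|M. of_real (\<Prod>k\<in>S. sign_of T k) * iexp (\<Sum>k\<in>S. sign_of T k * drift k (config \<omega>)))"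
  proof (rule Bochner_Integration.integral_sum)
    fix T
    have "integrable M (\<lambda>\<omega>. iexp (\<Sum>k\<in>S. sign_of T k * drift k (config \<omega>)))"
      by (rule integrable_const_bound[of _ 1]) (simp_all del: of_real_sum)
    then show "integrable M (\<lambda>\<omega>. of_real (\<Prod>k\<in>S. sign_of T k) * iexp (\<Sum>k\<in>S. sign_of T k * drift k (config \<omega>)))"
      by (rule integrable_mult_right)
  qed
  also have "\<dots> = (\<Sum>T\<in>Pow S. of_real ((\<Prod>k\<in>S. sign_of T k) * (e * (1 + (\<Prod>k\<in>S. sign_of T k) * \<rho>))))"
    by (rule sum.cong[OF refl]) (simp only: integral_mult_right_zero c of_real_mult)
  also have "\<dots> = of_real (\<Sum>T\<in>Pow S. e * (\<Prod>k\<in>S. sign_of T k) + e * \<rho>)"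
  proof -
    have "(\<Prod>k\<in>S. sign_of T k) * (e * (1 + (\<Prod>k\<in>S. sign_of T k) * \<rho>)) = e * (\<Prod>k\<in>S. sign_of T k) + e * \<rho>" for T
    proof -
      have "p * (e * (1 + p * \<rho>)) = e * p + e * \<rho> * (p * p)" for p by (simp add: algebra_simps)
      then show ?thesis by (simp only: prod_sign_of_square mult_1_right)
    qed
    then show ?thesis by (simp only: of_real_sum)
  qed
  also have "(\<Sum>T\<in>Pow S. e * (\<Prod>k\<in>S. sign_of T k) + e * \<rho>) =
      e * ((\<Sum>T\<in>Pow S. \<Prod>k\<in>S. sign_of T k) + 2 ^ card S * \<rho>)"
    using S by (simp add: sum.distrib sum_distrib_left[symmetric] card_Pow distrib_left)
  finally show ?thesis .
qed

lemma integral_prod_sin_drift_small: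
  assumes S: "finite S" "card S < 6" "S \<noteq> {}"
  shows "(LINT \<omega>|M. (\<Prod>k\<in>S. sin (drift k (config \<omega>)))) = 0"
proof -
  have "complex_of_real (LINT \<omega>|M. (\<Prod>k\<in>S. sin (drift k (config \<omega>)))) =
      (1 / (2 * \<i>)) ^ card S * of_real (exp (- real (card S) / 2) * ((\<Sum>T\<in>Pow S. \<Prod>k\<in>S. sign_of T k) + 2 ^ card S * 0))"
    by (rule integral_prod_sin_drift[OF S(1)]) (simp only: char_drift_small[OF S(1,2)] energy_signs[OF S(1)], simp)
  then show ?thesis using sum_prod_sign_of[OF S(1,3)] by simp
qed

text \<open>The minus sign is that of \<open>(1 / (2 * \<i>)) ^ 6 = - 1 / 64\<close>; the
  exponential is the Gaussian factor of six independent standard variables.\<close>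

lemma integral_prod_sin_drift_six:
  assumes S: "finite S" "card S = 6" and B: "\<And>k. k \<in> S \<Longrightarrow> \<bar>k\<bar> \<le> B"
    and z: "\<And>m. m \<ge> N \<Longrightarrow> rate m B S = 0"
  shows "(LINT \<omega>|M. (\<Prod>k\<in>S. sin (drift k (config \<omega>)))) = - exp (-3) * (\<Sum>m<N. rate m B S)"
proof -
  have ne: "S \<noteq> {}" using S by auto
  have "complex_of_real (LINT \<omega>|M. (\<Prod>k\<in>S. sin (drift k (config \<omega>)))) =
      (1 / (2 * \<i>)) ^ card S * of_real (exp (- real (card S) / 2) *
        ((\<Sum>T\<in>Pow S. \<Prod>k\<in>S. sign_of T k) + 2 ^ card S * (\<Sum>m<N. rate m B S)))"
  proof (rule integral_prod_sin_drift[OF S(1)])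
    fix T
    have s: "sign_of T k = 1 \<or> sign_of T k = -1" for k :: int by (simp add: sign_of_def)
    show "(CLINT \<omega>|M. iexp (\<Sum>k\<in>S. sign_of T k * drift k (config \<omega>))) =
        of_real (exp (- real (card S) / 2) * (1 + (\<Prod>k\<in>S. sign_of T k) * (\<Sum>m<N. rate m B S)))"
      unfolding energy_signs[OF S(1), symmetric, of T]
      by (rule char_drift_six[OF S]) (erule B, rule s, erule z)
  qed
  also have "(1 / (2 * \<i>)) ^ card S = complex_of_real (-1 / 64)"
    by (simp add: S(2) power_divide power_mult_distrib)
  finally show ?thesis unfolding sum_prod_sign_of[OF S(1) ne] of_real_mult[symmetric] of_real_eq_iff
    by (simp add: S(2))
qed

section \<open>Integrating out the coins\<close>

lemma indep_var_restricted_config: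
  defines "only K y \<equiv> (\<lambda>i. if i \<in> K then y i else (0::real))"
  shows "indep_var noise_space (\<lambda>\<omega>. only K (config \<omega>)) noise_space (\<lambda>\<omega>. only (- K) (config \<omega>))"
proof -
  have only: "only K \<in> measurable (PiM K (\<lambda>_. borel)) noise_space" for K :: "(int \<times> label) set"
    unfolding only_def
  proof (rule measurable_PiM_single')
    fix i
    show "(\<lambda>y. if i \<in> K then y i else 0) \<in> borel_measurable (PiM K (\<lambda>_. borel))"
      by (cases "i \<in> K") auto
  qed auto
  have "indep_var (PiM K (\<lambda>_. borel)) (\<lambda>\<omega>. restrict (\<lambda>i. Z i \<omega>) K)
      (PiM (- K) (\<lambda>_. borel)) (\<lambda>\<omega>. restrict (\<lambda>i. Z i \<omega>) (- K))"
    by (rule indep_var_restrict[OF indep]) auto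
  from indep_var_compose[OF this only only]
  have "indep_var noise_space (only K \<circ> (\<lambda>\<omega>. restrict (\<lambda>i. Z i \<omega>) K))
      noise_space (only (- K) \<circ> (\<lambda>\<omega>. restrict (\<lambda>i. Z i \<omega>) (- K)))" .
  moreover have "only K \<circ> (\<lambda>\<omega>. restrict (\<lambda>i. Z i \<omega>) K) = (\<lambda>\<omega>. only K (config \<omega>))" for K
    by (auto simp: fun_eq_iff only_def config_def)
  ultimately show ?thesis by simp
qed

text \<open>Fubini for one coordinate: the configuration is rebuilt from the coin and from the
  independent remainder in which that coin is set to 0.\<close>

lemma integral_coin_resample:
  fixes F :: "(int \<times> label \<Rightarrow> real) \<Rightarrow> real"
  assumes [measurable]: "F \<in> borel_measurable noise_space" and bdd: "\<And>z. \<bar>F z\<bar> \<le> C"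
  shows "(LINT \<omega>|M. F (config \<omega>)) =
    (LINT \<omega>|M. (LINT v|uniform_measure lborel {0..1}. F ((config \<omega>)((k, Inl j) := v))))"
proof -
  let ?x = "(k, Inl j) :: int \<times> label" and ?U = "uniform_measure lborel {0..1::real}"
  define only where "only K y = (\<lambda>i. if i \<in> K then y i else 0)" for K and y :: "int \<times> label \<Rightarrow> real"
  define a0 where "a0 \<omega> = only {?x} (config \<omega>)" for \<omega>
  define c0 where "c0 \<omega> = only (- {?x}) (config \<omega>)" for \<omega>
  have ind: "indep_var noise_space a0 noise_space c0"
    using indep_var_restricted_config[of "{?x}"] unfolding a0_def[abs_def] c0_def[abs_def] only_def .
  have c0m: "c0 \<in> measurable M noise_space" and a0m: "a0 \<in> measurable M noise_space"
    using indep_var_rv2[OF ind] indep_var_rv1[OF ind] .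
  let ?A = "distr M noise_space a0" and ?D = "distr M noise_space c0"
  interpret A: prob_space ?A by (rule prob_space_distr[OF a0m])
  interpret D: prob_space ?D by (rule prob_space_distr[OF c0m])
  interpret U: prob_space ?U by (rule prob_space_uniform_measure) auto
  interpret P: pair_prob_space ?A ?D ..
  have joint: "?A \<Otimes>\<^sub>M ?D = distr M (noise_space \<Otimes>\<^sub>M noise_space) (\<lambda>\<omega>. (a0 \<omega>, c0 \<omega>))"
    using ind unfolding indep_var_distribution_eq by blast
  have updm: "(\<lambda>w. (g w)(?x := f w)) \<in> measurable N noise_space"
    if f: "f \<in> borel_measurable N" and g: "g \<in> measurable N noise_space"
    for f and g :: "'c \<Rightarrow> int \<times> label \<Rightarrow> real" and N
  proof (rule measurable_PiM_single')
    fix i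
    show "(\<lambda>w. ((g w)(?x := f w)) i) \<in> borel_measurable N"
      using f measurable_compose[OF g component_measurable[of i]] by (cases "i = ?x") auto
  qed auto
  define G where "G w = F ((snd w)(?x := fst w ?x))" for w :: "(int \<times> label \<Rightarrow> real) \<times> (int \<times> label \<Rightarrow> real)"
  have Gm: "G \<in> borel_measurable (noise_space \<Otimes>\<^sub>M noise_space)"
    unfolding G_def
    by (rule measurable_compose[OF updm assms(1)]) (rule measurable_compose[OF measurable_fst component_measurable], rule measurable_snd)
  have sets_eq: "sets (?A \<Otimes>\<^sub>M ?D) = sets (noise_space \<Otimes>\<^sub>M noise_space)"
    by (rule sets_pair_measure_cong) auto
  have Gint: "integrable (?A \<Otimes>\<^sub>M ?D) (\<lambda>(a, z). G (a, z))"
  proof (rule P.integrable_const_bound[of _ C])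
    show "(\<lambda>(a, z). G (a, z)) \<in> borel_measurable (?A \<Otimes>\<^sub>M ?D)"
      using Gm unfolding measurable_cong_sets[OF sets_eq refl] by simp
  qed (use bdd in \<open>auto simp: G_def\<close>)
  have "config \<omega> = (c0 \<omega>)(?x := a0 \<omega> ?x)" for \<omega> by (simp add: c0_def a0_def only_def config_def fun_eq_iff)
  then have "(LINT \<omega>|M. F (config \<omega>)) = (LINT \<omega>|M. G (a0 \<omega>, c0 \<omega>))" by (simp add: G_def)
  also have "\<dots> = (LINT w|(?A \<Otimes>\<^sub>M ?D). G w)"
    unfolding joint
    by (rule integral_distr[symmetric, OF _ Gm]) (intro measurable_Pair a0m c0m)
  also have "\<dots> = (LINT w|(?A \<Otimes>\<^sub>M ?D). (case w of (a, z) \<Rightarrow> G (a, z)))" by simp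
  also have "\<dots> = (LINT z|?D. (LINT a|?A. G (a, z)))"
    by (rule P.integral_snd[symmetric, OF Gint])
  also have "\<dots> = (LINT z|?D. (LINT v|?U. F (z(?x := v))))"
  proof (rule Bochner_Integration.integral_cong[OF refl])
    fix z
    have zm: "(\<lambda>_. z) \<in> measurable N noise_space" for N :: "'d measure"
      by (rule measurable_const) (simp add: space_PiM)
    have Fz: "(\<lambda>v. F (z(?x := v))) \<in> borel_measurable borel"
      by (rule measurable_compose[OF updm assms(1)]) (simp, rule zm)
    have "(LINT a|?A. G (a, z)) = (LINT \<omega>|M. G (a0 \<omega>, z))"
    proof (rule integral_distr[OF a0m])
      show "(\<lambda>a. G (a, z)) \<in> borel_measurable noise_space"
        by (rule measurable_compose[OF _ Gm]) (intro measurable_Pair zm measurable_ident_sets refl)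
    qed
    also have "\<dots> = (LINT \<omega>|M. F (z(?x := Z ?x \<omega>)))" by (simp add: G_def a0_def only_def config_def)
    also have "\<dots> = (LINT v|distr M borel (Z ?x). F (z(?x := v)))"
      by (rule integral_distr[symmetric, OF Z_measurable Fz])
    finally show "(LINT a|?A. G (a, z)) = (LINT v|?U. F (z(?x := v)))" unfolding coin_unif .
  qed
  also have "\<dots> = (LINT \<omega>|M. (LINT v|?U. F ((c0 \<omega>)(?x := v))))"
  proof (rule integral_distr[OF c0m])
    have "(\<lambda>(z, v). F (z(?x := v))) \<in> borel_measurable (noise_space \<Otimes>\<^sub>M ?U)"
    proof -
      have "(\<lambda>w. F ((fst w)(?x := snd w))) \<in> borel_measurable (noise_space \<Otimes>\<^sub>M ?U)"
        by (rule measurable_compose[OF updm assms(1)]) (rule measurable_compose[OF measurable_snd], simp, rule measurable_fst)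
      then show ?thesis by (simp add: case_prod_beta)
    qed
    then show "(\<lambda>z. LINT v|?U. F (z(?x := v))) \<in> borel_measurable noise_space"
      by (rule U.borel_measurable_lebesgue_integral)
  qed
  also have "\<dots> = (LINT \<omega>|M. (LINT v|?U. F ((config \<omega>)(?x := v))))"
  proof -
    have "(c0 \<omega>)(?x := v) = (config \<omega>)(?x := v)" for \<omega> v by (auto simp: c0_def only_def fun_eq_iff)
    then show ?thesis by simp
  qed
  finally show ?thesis .
qed

lemma signal_bounded: "\<bar>signal k z\<bar> = 1"
  by (simp add: signal_def)

lemma signal_update: "k \<noteq> k' \<Longrightarrow> signal k' (z((k, Inl 0) := v)) = signal k' z"
  and drift_update: "drift k' (z((k, Inl 0) := v)) = drift k' z"
proof -
  show d: "drift k' (z((k, Inl 0) := v)) = drift k' z"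
    by (rule depends_onD[OF drift_depends_on]) auto
  show "signal k' (z((k, Inl 0) := v)) = signal k' z" if "k \<noteq> k'"
    using that by (simp add: signal_def d)
qed

lemma one_plus_sin_half_range: "0 \<le> (1 + sin x) / 2" "(1 + sin x) / 2 \<le> (1::real)"
proof -
  have "0 \<le> (1 + s) / 2" "(1 + s) / 2 \<le> 1" if "-1 \<le> s" "s \<le> 1" for s :: real using that by auto
  from this[OF sin_ge_minus_one sin_le_one] show "0 \<le> (1 + sin x) / 2" "(1 + sin x) / 2 \<le> (1::real)" .
qed

lemma integral_signal_resample:
  "(LINT v|uniform_measure lborel {0..1}. signal k (z((k, Inl 0) := v))) = sin (drift k z)"
proof -
  interpret U: prob_space "uniform_measure lborel {0..1::real}"
    by (rule prob_space_uniform_measure) auto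
  define q where "q = (1 + sin (drift k z)) / 2"
  have q: "0 \<le> q" "q \<le> 1" unfolding q_def by (rule one_plus_sin_half_range)+
  have "signal k (z((k, Inl 0) := v)) = 2 * of_bool (v < q) - 1" for v
    by (simp add: signal_def drift_update q_def)
  moreover have "integrable (uniform_measure lborel {0..1}) (\<lambda>v. of_bool (v < q) :: real)"
    by (rule U.integrable_const_bound[of _ 1]) (auto simp: of_bool_def)
  ultimately have "(LINT v|uniform_measure lborel {0..1}. signal k (z((k, Inl 0) := v))) = 2 * q - 1"
    using integral_uniform_less[OF q] by (simp add: U.prob_space)
  also have "2 * q - 1 = sin (drift k z)" unfolding q_def by (simp add: field_simps)
  finally show ?thesis .
qed

text \<open>One coin is integrated out at a time, turning its sign into the sine of the drift. The
  extra factor \<open>H\<close> collects the sines already produced; the induction works because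
  they ignore the coins still to come.\<close>

lemma integral_prod_signal:
  assumes "finite S" and "H \<in> borel_measurable noise_space" and "\<And>z. \<bar>H z\<bar> \<le> 1"
    and "\<And>k z v. k \<in> S \<Longrightarrow> H (z((k, Inl 0) := v)) = H z"
  shows "(LINT \<omega>|M. (\<Prod>k\<in>S. signal k (config \<omega>)) * H (config \<omega>)) =
    (LINT \<omega>|M. (\<Prod>k\<in>S. sin (drift k (config \<omega>))) * H (config \<omega>))"
  using assms
proof (induction S arbitrary: H rule: finite_induct)
  case (insert k S)
  note Hm = insert.prems(1) and Hb = insert.prems(2) and Hu = insert.prems(3)
  define F where "F z = signal k z * ((\<Prod>k\<in>S. signal k z) * H z)" for z
  have Fm: "F \<in> borel_measurable noise_space"
    unfolding F_def by (intro borel_measurable_times borel_measurable_prod signal_measurable Hm)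
  have Fb: "\<bar>F z\<bar> \<le> 1" for z using Hb[of z] by (simp add: F_def abs_mult abs_prod signal_bounded)
  have "(LINT \<omega>|M. (\<Prod>k\<in>insert k S. signal k (config \<omega>)) * H (config \<omega>)) = (LINT \<omega>|M. F (config \<omega>))"
    using insert.hyps by (simp add: F_def mult.assoc)
  also have "\<dots> = (LINT \<omega>|M. (LINT v|uniform_measure lborel {0..1}. F ((config \<omega>)((k, Inl 0) := v))))"
    by (rule integral_coin_resample[OF Fm Fb])
  also have "\<dots> = (LINT \<omega>|M. (\<Prod>k\<in>S. signal k (config \<omega>)) * (sin (drift k (config \<omega>)) * H (config \<omega>)))"
  proof (rule Bochner_Integration.integral_cong[OF refl])
    fix \<omega>
    have "(\<Prod>k'\<in>S. signal k' ((config \<omega>)((k, Inl 0) := v))) = (\<Prod>k'\<in>S. signal k' (config \<omega>))" for v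
      by (rule prod.cong[OF refl]) (use insert.hyps in \<open>auto intro: signal_update\<close>)
    then have "F ((config \<omega>)((k, Inl 0) := v)) =
        signal k ((config \<omega>)((k, Inl 0) := v)) * ((\<Prod>k\<in>S. signal k (config \<omega>)) * H (config \<omega>))" for v
      unfolding F_def by (simp only: Hu[OF insertI1])
    then show "(LINT v|uniform_measure lborel {0..1}. F ((config \<omega>)((k, Inl 0) := v))) =
        (\<Prod>k\<in>S. signal k (config \<omega>)) * (sin (drift k (config \<omega>)) * H (config \<omega>))"
      by (simp only: integral_mult_left_zero integral_signal_resample) (simp add: ac_simps)
  qed
  also have "\<dots> = (LINT \<omega>|M. (\<Prod>k\<in>S. sin (drift k (config \<omega>))) * (sin (drift k (config \<omega>)) * H (config \<omega>)))"
  proof (rule insert.IH)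
    show "(\<lambda>z. sin (drift k z) * H z) \<in> borel_measurable noise_space"
      by (intro borel_measurable_times Hm measurable_compose[OF drift_measurable borel_measurable_sin])
    show "\<bar>sin (drift k z) * H z\<bar> \<le> 1" for z
      using mult_mono[OF abs_sin_le_one[of "drift k z"] Hb[of z]] by (simp add: abs_mult)
    show "sin (drift k (z((k', Inl 0) := v))) * H (z((k', Inl 0) := v)) = sin (drift k z) * H z" if "k' \<in> S" for k' z v
      by (simp only: Hu[OF insertI2[OF that]] drift_update)
  qed
  also have "\<dots> = (LINT \<omega>|M. (\<Prod>k\<in>insert k S. sin (drift k (config \<omega>))) * H (config \<omega>))"
    using insert.hyps by (simp add: ac_simps)
  finally show ?case .
qed simp

lemma expectation_prod_signal:
  "finite S \<Longrightarrow> (LINT \<omega>|M. (\<Prod>k\<in>S. signal k (config \<omega>))) = (LINT \<omega>|M. (\<Prod>k\<in>S. sin (drift k (config \<omega>))))"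
  using integral_prod_signal[of S "\<lambda>_. 1"] by simp

end

section \<open>Moments and limits of the partial sums\<close>

context noise
begin

lemma expectation_prod_signal_small:
  assumes "finite S" "card S < 6" "S \<noteq> {}"
  shows "(LINT \<omega>|M. (\<Prod>k\<in>S. signal k (config \<omega>))) = 0"
  unfolding expectation_prod_signal[OF assms(1)] by (rule integral_prod_sin_drift_small[OF assms])

lemma expectation_prod_signal_six:
  assumes S: "card S = 6" "S \<subseteq> {1..int n}"
  shows "(LINT \<omega>|M. (\<Prod>k\<in>S. signal k (config \<omega>))) = - exp (-3) * (\<Sum>m<n. rate m (int n) S)"
proof -
  have fin: "finite S" using S(2) finite_subset by blast
  \<comment> \<open>Six points that are seen at scale \<open>m\<close> are at least
    \<open>8 * len m\<close> apart somewhere, which exceeds \<open>n\<close> once \<open>m\<close>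
    reaches \<open>n\<close>; the series of rates is thus a finite sum.\<close>
  have z: "rate m (int n) S = 0" if "n \<le> m" for m
  proof -
    have "corr (len m) S \<gamma> = 0" for \<gamma>
    proof (rule ccontr)
      assume nz: "corr (len m) S \<gamma> \<noteq> 0"
      obtain k k' where k: "k \<in> S" "k' \<in> S" "8 * int (len m) \<le> k' - k"
        using prod_tilt_kersum_six(3)[OF fin S(1) _ nz, of "\<lambda>_. 1"] by auto
      have "m < len m" unfolding len_def by (rule less_exp[THEN less_le_trans]) (simp add: power_mono)
      moreover have "1 \<le> k" "k' \<le> int n" using subsetD[OF S(2)] k(1,2) by force+
      ultimately show False using k(3) that by linarith
    qed
    then show ?thesis by (simp add: rate_def)
  qed
  show ?thesis unfolding expectation_prod_signal[OF fin]
    by (rule integral_prod_sin_drift_six[OF fin S(1)]) (use S(2) z in auto)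
qed

lemma signal_product_integrable: "integrable M (\<lambda>\<omega>. \<Prod>k\<in>S. signal k (config \<omega>))"
proof (rule integrable_const_bound[of _ 1])
  show "(\<lambda>\<omega>. \<Prod>k\<in>S. signal k (config \<omega>)) \<in> borel_measurable M"
    by (intro borel_measurable_prod measurable_compose[OF config_measurable signal_measurable])
qed (simp add: abs_prod signal_bounded)

lemma expectation_esym:
  assumes "finite W"
  shows "integrable M (\<lambda>\<omega>. esym W (\<lambda>k. signal k (config \<omega>)) j)"
    "(LINT \<omega>|M. esym W (\<lambda>k. signal k (config \<omega>)) j) =
      (\<Sum>S | S \<subseteq> W \<and> card S = j. LINT \<omega>|M. (\<Prod>k\<in>S. signal k (config \<omega>)))"
  unfolding esym_def
  by (rule Bochner_Integration.integrable_sum, rule signal_product_integrable)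
    (rule Bochner_Integration.integral_sum, rule signal_product_integrable)

lemma expectation_esym_small:
  assumes "finite W" "0 < j" "j < 6"
  shows "(LINT \<omega>|M. esym W (\<lambda>k. signal k (config \<omega>)) j) = 0"
  unfolding expectation_esym[OF assms(1)]
proof (rule sum.neutral, rule ballI)
  fix S assume "S \<in> {S. S \<subseteq> W \<and> card S = j}"
  then have "finite S" "card S < 6" "S \<noteq> {}" using assms finite_subset by auto
  then show "(LINT \<omega>|M. (\<Prod>k\<in>S. signal k (config \<omega>))) = 0" by (rule expectation_prod_signal_small)
qed

lemma expectation_esym_six:
  "(LINT \<omega>|M. esym {1..int n} (\<lambda>k. signal k (config \<omega>)) 6) =
    - exp (-3) * (\<Sum>m<n. activity m *
      (\<Sum>\<gamma>\<in>{-(int n + 40 * int (len m))..int n + 40 * int (len m)}. corr (len m) {1..int n} \<gamma>))"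
proof -
  let ?\<S> = "{S. S \<subseteq> {1..int n} \<and> card S = 6}"
  let ?\<Gamma> = "\<lambda>m. {-(int n + 40 * int (len m))..int n + 40 * int (len m)}"
  have "(LINT \<omega>|M. esym {1..int n} (\<lambda>k. signal k (config \<omega>)) 6) =
      (\<Sum>S\<in>?\<S>. - exp (-3) * (\<Sum>m<n. rate m (int n) S))"
    unfolding expectation_esym(2)[OF finite_atLeastAtMost_int]
  proof (rule sum.cong[OF refl])
    fix S assume "S \<in> ?\<S>"
    then show "(LINT \<omega>|M. (\<Prod>k\<in>S. signal k (config \<omega>))) = - exp (-3) * (\<Sum>m<n. rate m (int n) S)"
      by (intro expectation_prod_signal_six) blast+
  qed
  also have "\<dots> = - exp (-3) * (\<Sum>m<n. \<Sum>S\<in>?\<S>. rate m (int n) S)"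
    unfolding sum_distrib_left[symmetric] by (subst sum.swap) (rule refl)
  also have "(\<Sum>m<n. \<Sum>S\<in>?\<S>. rate m (int n) S) =
      (\<Sum>m<n. activity m * (\<Sum>\<gamma>\<in>?\<Gamma> m. corr (len m) {1..int n} \<gamma>))"
  proof (rule sum.cong[OF refl])
    fix m
    have "(\<Sum>S\<in>?\<S>. rate m (int n) S) = activity m * (\<Sum>\<gamma>\<in>?\<Gamma> m. \<Sum>S\<in>?\<S>. corr (len m) S \<gamma>)"
      unfolding rate_def sum_distrib_left[symmetric] by (subst sum.swap) (rule refl)
    then show "(\<Sum>S\<in>?\<S>. rate m (int n) S) = activity m * (\<Sum>\<gamma>\<in>?\<Gamma> m. corr (len m) {1..int n} \<gamma>)"
      unfolding sum_corr_subsets[OF finite_atLeastAtMost_int] .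
  qed
  finally show ?thesis .
qed

lemma activity_nonneg: "0 \<le> activity m"
  by (rule order_trans[OF _ activity_ge]) simp

text \<open>All scales push in the same direction, so the one comparable to \<open>n\<close>
  suffices: the largest \<open>m\<close> with \<open>25 * len m \<le> n\<close>, for which
  \<open>n < 900 * len m\<close>. For \<open>12 * len m\<close> sites the point \<open>n\<close>
  lies in the central gap; each is active with probability at least \<open>1 / (200 * len m)\<close>
  and then worth \<open>len m ^ 3 / 144 ^ 6\<close>.\<close>

lemma expectation_esym_six_le:
  assumes n: "25 \<le> n"
  shows "(LINT \<omega>|M. esym {1..int n} (\<lambda>k. signal k (config \<omega>)) 6) \<le>
    - exp (-3) * (12 / 200 / 144 ^ 6 / 900 ^ 3) * real n ^ 3"
proof -
  let ?\<Gamma> = "\<lambda>m. {-(int n + 40 * int (len m))..int n + 40 * int (len m)}"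
  let ?c = "\<lambda>m. corr (len m) {1..int n}"
  have mlt: "m < len m" for m unfolding len_def by (rule less_exp[THEN less_le_trans]) (simp add: power_mono)
  define m where "m = (GREATEST m. 25 * len m \<le> n)"
  have ex: "25 * len m \<le> n"
    unfolding m_def
  proof (rule GreatestI_nat[of _ 0 n])
    show "25 * len 0 \<le> n" using n by (simp add: len_def)
    show "m \<le> n" if "25 * len m \<le> n" for m using mlt[of m] that by linarith
  qed
  have "\<not> 25 * len (Suc m) \<le> n"
  proof
    assume "25 * len (Suc m) \<le> n"
    then have "Suc m \<le> m" unfolding m_def
      by (rule Greatest_le_nat[of _ _ n]) (metis mlt le_trans less_imp_le_nat mult_le_mono2 mult_1 one_le_numeral mult_le_mono1)
    then show False by simp
  qed
  then have up: "n < 900 * len m" by (simp add: len_Suc)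
  have mn: "m < n" using mlt[of m] ex by linarith
  let ?l = "len m"
  let ?I = "{int n - 25 * int ?l + 1..int n - 13 * int ?l}"
  have I: "?I \<subseteq> ?\<Gamma> m" using ex by auto
  have cI: "card ?I = 12 * ?l" by simp
  have "12 / 200 / 144 ^ 6 / 900 ^ 3 * real n ^ 3 \<le> 12 / 200 / 144 ^ 6 * real ?l ^ 3"
  proof -
    have "real n ^ 3 \<le> (900 * real ?l) ^ 3" using up by (intro power_mono) auto
    then show ?thesis by (simp add: power_mult_distrib)
  qed
  also have "\<dots> = 1 / (200 * real ?l) * (real (12 * ?l) * (real ?l ^ 3 / 144 ^ 6))"
    by (simp add: field_simps)
  also have "\<dots> \<le> activity m * (\<Sum>\<gamma>\<in>?\<Gamma> m. ?c m \<gamma>)"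
  proof (rule mult_mono[OF activity_ge])
    have "real (12 * ?l) * (real ?l ^ 3 / 144 ^ 6) = (\<Sum>\<gamma>\<in>?I. real ?l ^ 3 / 144 ^ 6)"
      by (simp only: sum_constant cI)
    also have "\<dots> \<le> (\<Sum>\<gamma>\<in>?I. ?c m \<gamma>)"
    proof (rule sum_mono)
      fix \<gamma> assume g: "\<gamma> \<in> ?I"
      show "real ?l ^ 3 / 144 ^ 6 \<le> ?c m \<gamma>"
        by (rule corr_interval_ge[OF len_pos]) (use g ex in auto)
    qed
    also have "\<dots> \<le> (\<Sum>\<gamma>\<in>?\<Gamma> m. ?c m \<gamma>)"
      by (rule sum_mono2) (use I corr_interval_nonneg[OF len_pos] in auto)
    finally show "real (12 * ?l) * (real ?l ^ 3 / 144 ^ 6) \<le> (\<Sum>\<gamma>\<in>?\<Gamma> m. ?c m \<gamma>)" .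
  qed (auto intro: activity_nonneg)
  also have "\<dots> \<le> (\<Sum>m<n. activity m * (\<Sum>\<gamma>\<in>?\<Gamma> m. ?c m \<gamma>))"
    by (rule member_le_sum[of m "{..<n}"])
      (use mn in \<open>auto intro!: mult_nonneg_nonneg activity_nonneg sum_nonneg corr_interval_nonneg len_pos\<close>)
  finally have "exp (-3) * (12 / 200 / 144 ^ 6 / 900 ^ 3 * real n ^ 3) \<le>
      exp (-3) * (\<Sum>m<n. activity m * (\<Sum>\<gamma>\<in>?\<Gamma> m. ?c m \<gamma>))"
    by (rule mult_left_mono) simp
  then show ?thesis unfolding expectation_esym_six by (simp only: mult_minus_left neg_le_iff_le mult.assoc)
qed

text \<open>The coefficient 720 of the sixth symmetric function in the sixth power, times the
  constant of \<open>expectation_esym_six_le\<close>.\<close>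

definition gap :: real where
  "gap = 720 * exp (-3) * (12 / 200 / 144 ^ 6 / 900 ^ 3)"

lemma gap_pos: "0 < gap"
  by (simp add: gap_def)

abbreviation X :: "int \<Rightarrow> 'a \<Rightarrow> real" where
  "X k \<omega> \<equiv> signal k (config \<omega>)"

lemma X_measurable [measurable]: "X k \<in> borel_measurable M"
  by (rule measurable_compose[OF config_measurable signal_measurable])

lemma partial_sum_X: "partial_sum X n \<omega> = (\<Sum>k\<in>{1..int n}. X k \<omega>)"
proof -
  have "{1..int n} = int ` {1..n}" by (simp add: image_int_atLeastAtMost)
  then show ?thesis by (simp add: partial_sum_def sum.reindex)
qed

lemma partial_sum_measurable [measurable]: "partial_sum X n \<in> borel_measurable M"
  unfolding partial_sum_def by measurable

lemma partial_sum_bounded: "\<bar>partial_sum X n \<omega>\<bar> \<le> real n"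
proof -
  have "\<bar>partial_sum X n \<omega>\<bar> \<le> (\<Sum>k\<in>{1..int n}. 1)"
    unfolding partial_sum_X by (rule order_trans[OF sum_abs]) (simp add: signal_bounded)
  then show ?thesis by simp
qed

lemma partial_sum_power_integrable: "integrable M (\<lambda>\<omega>. partial_sum X n \<omega> ^ j)"
  by (rule integrable_const_bound[of _ "real n ^ j"])
    (auto simp: power_abs intro!: power_mono partial_sum_bounded)

lemma expectation_partial_sum: "(LINT \<omega>|M. partial_sum X n \<omega>) = 0"
proof -
  have "partial_sum X n \<omega> = esym {1..int n} (\<lambda>k. X k \<omega>) 1" for \<omega>
    by (simp only: partial_sum_X esym_1[OF finite_atLeastAtMost_int])
  then show ?thesis using expectation_esym_small[of "{1..int n}" 1] by simp
qed

lemma expectation_partial_sum_square: "(LINT \<omega>|M. partial_sum X n \<omega> ^ 2) = real n"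
proof -
  have "partial_sum X n \<omega> ^ 2 = 2 * esym {1..int n} (\<lambda>k. X k \<omega>) 2 + real n" for \<omega>
    unfolding partial_sum_X using sixth_power_sum_signs(1)[of "{1..int n}" "\<lambda>k. X k \<omega>"]
    by (simp add: signal_def)
  then show ?thesis
    using expectation_esym(1)[of "{1..int n}" 2] expectation_esym_small[of "{1..int n}" 2]
    by (simp add: prob_space)
qed

lemma expectation_partial_sum_six:
  assumes n: "25 \<le> n"
  shows "(LINT \<omega>|M. partial_sum X n \<omega> ^ 6) \<le> (15 - gap) * real n ^ 3"
proof -
  let ?e = "\<lambda>j \<omega>. esym {1..int n} (\<lambda>k. X k \<omega>) j"
  let ?n = "real n"
  have "partial_sum X n \<omega> ^ 6 = 720 * ?e 6 \<omega>
      + (120 * (?n - 4) + 4 * (60 * ?n - 120)) * ?e 4 \<omega>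
      + ((60 * ?n - 120) * (?n - 2) + 2 * (15 * ?n\<^sup>2 - 30 * ?n + 16)) * ?e 2 \<omega>
      + (15 * ?n ^ 3 - 30 * ?n\<^sup>2 + 16 * ?n)" for \<omega>
    unfolding partial_sum_X using sixth_power_sum_signs(2)[of "{1..int n}" "\<lambda>k. X k \<omega>"]
    by (simp add: signal_def)
  moreover have "integrable M (?e j)" for j by (rule expectation_esym) simp
  moreover have "integral\<^sup>L M (?e 4) = 0" "integral\<^sup>L M (?e 2) = 0"
    by (rule expectation_esym_small; simp)+
  ultimately have "(LINT \<omega>|M. partial_sum X n \<omega> ^ 6) = 720 * integral\<^sup>L M (?e 6) + (15 * ?n ^ 3 - 30 * ?n\<^sup>2 + 16 * ?n)"
    by (simp add: prob_space)
  moreover have "720 * integral\<^sup>L M (?e 6) \<le> - (gap * ?n ^ 3)"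
  proof -
    have "720 * integral\<^sup>L M (?e 6) \<le> 720 * (- exp (-3) * (12 / 200 / 144 ^ 6 / 900 ^ 3) * ?n ^ 3)"
      by (rule mult_left_mono[OF expectation_esym_six_le[OF n]]) simp
    also have "\<dots> = - (gap * ?n ^ 3)" by (simp add: gap_def)
    finally show ?thesis .
  qed
  moreover have "16 * ?n \<le> 30 * ?n\<^sup>2" using n by (simp add: power2_eq_square)
  ultimately show ?thesis unfolding left_diff_distrib by linarith
qed

lemma indep_vars_five:
  assumes "card K = 5"
  shows "indep_vars (\<lambda>_. borel) X K"
proof (rule indep_vars_signs)
  have fin: "finite K" using assms card.infinite by force
  show "X k \<omega> \<in> {-1, 1}" for k \<omega> by (simp add: signal_def)
  show "expectation (\<lambda>\<omega>. \<Prod>k\<in>S. X k \<omega>) = 0" if "finite S" "S \<subseteq> K" "S \<noteq> {}" for S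
    using card_mono[OF fin that(2)] assms by (intro expectation_prod_signal_small that) simp
qed (rule X_measurable)

lemma expectation_X: "expectation (X k) = 0"
  using expectation_prod_signal_small[of "{k}"] by simp

lemma prob_X: "prob {\<omega> \<in> space M. X k \<omega> = 1} = 1 / 2" "prob {\<omega> \<in> space M. X k \<omega> = -1} = 1 / 2"
proof -
  have e: "prob {\<omega> \<in> space M. X k \<omega> = s} = (LINT \<omega>|M. (1 + s * X k \<omega>) / 2)" if "s = 1 \<or> s = -1" for s
  proof -
    have "{\<omega> \<in> space M. X k \<omega> = s} \<in> events" by measurable
    then have "prob {\<omega> \<in> space M. X k \<omega> = s} = (LINT \<omega>|M. indicator {\<omega> \<in> space M. X k \<omega> = s} \<omega>)" by simp
    also have "\<dots> = (LINT \<omega>|M. (1 + s * X k \<omega>) / 2)"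
      by (rule Bochner_Integration.integral_cong[OF refl]) (use that in \<open>auto simp: signal_def\<close>)
    finally show ?thesis .
  qed
  have "integrable M (X k)" using signal_product_integrable[of "{k}"] by simp
  then have "(LINT \<omega>|M. (1 + s * X k \<omega>) / 2) = 1 / 2" for s by (simp add: expectation_X prob_space)
  then show "prob {\<omega> \<in> space M. X k \<omega> = 1} = 1 / 2" "prob {\<omega> \<in> space M. X k \<omega> = -1} = 1 / 2"
    using e by auto
qed

lemma limsup_six:
  "limsup (\<lambda>n. ereal (expectation (\<lambda>\<omega>. (partial_sum X n \<omega> / sqrt (real n)) ^ 6))) < 15"
proof -
  have "limsup (\<lambda>n. ereal (expectation (\<lambda>\<omega>. (partial_sum X n \<omega> / sqrt (real n)) ^ 6))) \<le> ereal (15 - gap)"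
  proof (rule Limsup_bounded, rule eventually_sequentiallyI[of 25])
    fix n :: nat assume n: "25 \<le> n"
    have "sqrt (real n) ^ 6 = real n ^ 3"
      using power_mult[of "sqrt (real n)" 2 3] by simp
    then have "expectation (\<lambda>\<omega>. (partial_sum X n \<omega> / sqrt (real n)) ^ 6) = (LINT \<omega>|M. partial_sum X n \<omega> ^ 6) / real n ^ 3"
      by (simp add: power_divide)
    also have "\<dots> \<le> 15 - gap" using expectation_partial_sum_six[OF n] n by (simp add: field_simps)
    finally show "ereal (expectation (\<lambda>\<omega>. (partial_sum X n \<omega> / sqrt (real n)) ^ 6)) \<le> ereal (15 - gap)" by simp
  qed
  also have "\<dots> < 15" using gap_pos by simp
  finally show ?thesis .
qed

text \<open>Unit variances give tightness, so a subsequence of \<open>Q\<close> converges weakly;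
  the moments of its limit then exclude point masses and normal laws.\<close>

lemma subsequence_limit:
  fixes Q :: "nat set"
  assumes Q: "Q \<subseteq> {1..}" "infinite Q"
  shows "\<exists>T \<mu>. T \<subseteq> Q \<and> infinite T \<and> real_distribution \<mu> \<and> nondegenerate \<mu> \<and> \<not> normal_law \<mu> \<and>
    converges_in_distribution_along M (\<lambda>n \<omega>. partial_sum X n \<omega> / sqrt (real n)) T \<mu>"
proof -
  define \<nu> where "\<nu> n = distr M borel (\<lambda>\<omega>. partial_sum X n \<omega> / sqrt (real n))" for n
  have meas: "(\<lambda>\<omega>. partial_sum X n \<omega> / sqrt (real n)) \<in> borel_measurable M" for n by measurable
  have rd: "real_distribution (\<nu> n)" for n unfolding \<nu>_def by (rule real_distribution_distr[OF meas])
  have int: "integrable (\<nu> n) (\<lambda>x. x ^ j)" for n j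
    unfolding \<nu>_def by (subst integrable_distr_eq[OF meas]) (auto simp: power_divide partial_sum_power_integrable)
  have mom: "(LINT x|\<nu> n. x ^ j) = (LINT \<omega>|M. partial_sum X n \<omega> ^ j) / sqrt (real n) ^ j" for n j
    unfolding \<nu>_def by (subst integral_distr[OF meas]) (auto simp: power_divide)
  have mean: "(LINT x|\<nu> n. x) = 0" for n using mom[of n 1] expectation_partial_sum by simp
  have var: "(LINT x|\<nu> n. x\<^sup>2) = 1" if "1 \<le> n" for n
    using mom[of n 2] expectation_partial_sum_square[of n] that by simp
  have six: "(LINT x|\<nu> n. x ^ 6) \<le> 15 - gap" if n: "25 \<le> n" for n
  proof -
    have "sqrt (real n) ^ 6 = real n ^ 3" using power_mult[of "sqrt (real n)" 2 3] by simp
    then have "(LINT x|\<nu> n. x ^ 6) = (LINT \<omega>|M. partial_sum X n \<omega> ^ 6) / real n ^ 3" using mom[of n 6] by simp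
    also have "\<dots> \<le> 15 - gap" using expectation_partial_sum_six[OF n] n by (simp add: field_simps)
    finally show ?thesis .
  qed
  let ?q = "enumerate Q"
  have q: "strict_mono ?q" using Q(2) by (simp add: strict_mono_enumerate)
  \<comment> \<open>Excludes \<open>n = 0\<close>, where the normalised sum is 0 and does not have
    variance 1.\<close>
  have q1: "1 \<le> ?q i" for i using enumerate_in_set[OF Q(2), of i] Q(1) by auto
  have "tight (\<nu> \<circ> ?q)"
    by (rule tight_if_second_moment) (use rd int var q1 in \<open>auto simp: comp_def\<close>)
  from tight_imp_convergent_subsubsequence[OF this strict_mono_id]
  obtain r \<mu> where r: "strict_mono r" and \<mu>: "real_distribution \<mu>" and "weak_conv_m (\<nu> \<circ> ?q \<circ> id \<circ> r) \<mu>"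
    by auto
  then have conv: "weak_conv_m (\<lambda>i. \<nu> (?q (r i))) \<mu>" by (simp add: comp_def)
  define T where "T = range (?q \<circ> r)"
  have qr: "strict_mono (?q \<circ> r)" by (rule strict_mono_o[OF q r])
  have enumT: "enumerate T i = ?q (r i)" for i
    unfolding T_def using enumerate_range_strict_mono[OF qr] by simp
  have "T \<subseteq> Q" unfolding T_def using enumerate_in_set[OF Q(2)] by auto
  moreover have "infinite T" unfolding T_def by (rule range_inj_infinite[OF strict_mono_imp_inj_on[OF qr]])
  moreover have "eventually (\<lambda>i. (LINT x|\<nu> (?q (r i)). x ^ 6) \<le> 15 - gap) sequentially"
  proof (rule eventually_sequentiallyI[of 25])
    fix i :: nat assume "25 \<le> i"
    then have "25 \<le> ?q (r i)" using strict_mono_imp_increasing[OF qr, of i] by simp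
    then show "(LINT x|\<nu> (?q (r i)). x ^ 6) \<le> 15 - gap" by (rule six)
  qed
  note lim = weak_limit_moments[OF rd \<mu> conv int mean var[OF q1] this]
  have "(LINT x|\<mu>. x ^ 6) < 15" using lim(2) gap_pos by simp
  from nondegenerate_not_normal_if_moments[OF lim(4,3) this]
  have "nondegenerate \<mu>" "\<not> normal_law \<mu>" .
  moreover have "converges_in_distribution_along M (\<lambda>n \<omega>. partial_sum X n \<omega> / sqrt (real n)) T \<mu>"
    using conv unfolding converges_in_distribution_along_def enumT \<nu>_def .
  ultimately show ?thesis using \<mu> by blast
qed

end

section \<open>The double tail\<close>

definition shift :: "int \<Rightarrow> (int \<times> label \<Rightarrow> real) \<Rightarrow> (int \<times> label \<Rightarrow> real)" where
  "shift d z = (\<lambda>(j, x). z (j + d, x))"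

lemma shift_apply [simp]: "shift d z (j, x) = z (j + d, x)"
  by (simp add: shift_def)

lemma gauss_shift: "gauss m q j (shift d z) = gauss m q (j + d) z"
  by (simp add: gauss_def)

lemma active_shift: "active m j (shift d z) = active m (j + d) z"
  by (simp add: active_def mark_def algebra_simps)

lemma hid_shift: "hid m i j (shift d z) = hid m i (j + d) z"
  by (simp add: hid_def gauss_shift)

lemma wmod_shift: "wmod m a b j (shift d z) = wmod m a b (j + d) z"
proof -
  have "j - int e + d = j + d - int e" "j - int e + int t + d = j + d - int e + int t" for e t by simp_all
  then show ?thesis unfolding wmod_def by (simp only: gauss_shift active_shift hid_shift)
qed

lemma level_shift: "level m k (shift d z) = level m (k + d) z"
proof -
  have "k - (int c + 1) * int (len m) - int t + d = k + d - (int c + 1) * int (len m) - int t" for c t by simp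
  then show ?thesis unfolding level_def by (simp only: wmod_shift)
qed

lemma signal_shift: "signal k (shift d z) = signal (k + d) z"
  by (simp add: signal_def drift_def level_shift)

lemma signal_depends_on: "depends_on (past_slots k) (signal k)"
proof (rule depends_onI)
  fix z z' :: "int \<times> label \<Rightarrow> real"
  assume eq: "\<And>x. x \<in> past_slots k \<Longrightarrow> z x = z' x"
  have "drift k z = drift k z'" by (rule depends_onD[OF drift_depends_on]) (rule eq, blast)
  moreover have "z (k, Inl 0) = z' (k, Inl 0)" by (rule eq) (simp add: past_slots_def)
  ultimately show "signal k z = signal k z'" unfolding signal_def by (simp only:)
qed

section \<open>Truncation to finitely many scales\<close>

context noise
begin

definition psignal :: "nat \<Rightarrow> int \<Rightarrow> (int \<times> label \<Rightarrow> real) \<Rightarrow> real" where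
  "psignal N k z = (if z (k, Inl 0) < (1 + sin (pdrift N k z)) / 2 then 1 else -1)"

lemma psignal_measurable [measurable]: "psignal N k \<in> borel_measurable noise_space"
proof -
  have "Measurable.pred noise_space (\<lambda>z. z (k, Inl 0) < (1 + sin (pdrift N k z)) / 2)"
    by (intro borel_measurable_pred_less component_measurable borel_measurable_divide borel_measurable_add
        measurable_compose[OF pdrift_measurable borel_measurable_sin] borel_measurable_const)
  then show ?thesis unfolding psignal_def pred_def by (intro measurable_If borel_measurable_const)
qed

definition psignal_slots :: "nat \<Rightarrow> int \<Rightarrow> (int \<times> label) set" where
  "psignal_slots N k = insert (k, Inl 0) (\<Union>m<N. level_slots m k)"

lemma psignal_depends_on: "depends_on (psignal_slots N k) (psignal N k)"
proof (rule depends_onI)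
  fix z z' :: "int \<times> label \<Rightarrow> real"
  assume eq: "\<And>x. x \<in> psignal_slots N k \<Longrightarrow> z x = z' x"
  have "level m k z = level m k z'" if "m < N" for m
    by (rule depends_onD[OF level_depends_on]) (rule eq, use that in \<open>auto simp: psignal_slots_def\<close>)
  then have "pdrift N k z = pdrift N k z'" unfolding pdrift_def by (intro sum.cong) auto
  moreover have "z (k, Inl 0) = z' (k, Inl 0)" by (rule eq) (simp add: psignal_slots_def)
  ultimately show "psignal N k z = psignal N k z'" unfolding psignal_def by (simp only:)
qed

lemma pdrift_update: "pdrift N k' (z((k, Inl 0) := v)) = pdrift N k' z"
proof -
  have "level m k' (z((k, Inl 0) := v)) = level m k' z" for m
    by (rule depends_onD[OF level_depends_on]) (auto simp: level_slots_def)
  then show ?thesis unfolding pdrift_def by (simp only:)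
qed

text \<open>Both signs use the same coin, so they differ, and then by 2, exactly when the coin falls
  between their thresholds; the thresholds are half as far apart as the sines.\<close>

lemma expectation_signal_psignal:
  "(LINT \<omega>|M. \<bar>signal k (config \<omega>) - psignal N k (config \<omega>)\<bar>) =
    (LINT \<omega>|M. \<bar>sin (drift k (config \<omega>)) - sin (pdrift N k (config \<omega>))\<bar>)"
proof -
  let ?U = "uniform_measure lborel {0..1::real}"
  interpret U: prob_space ?U by (rule prob_space_uniform_measure) auto
  have "(LINT \<omega>|M. \<bar>signal k (config \<omega>) - psignal N k (config \<omega>)\<bar>) =
      (LINT \<omega>|M. (LINT v|?U. \<bar>signal k ((config \<omega>)((k, Inl 0) := v)) - psignal N k ((config \<omega>)((k, Inl 0) := v))\<bar>))"
  proof (rule integral_coin_resample[where C = 2])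
    show "(\<lambda>z. \<bar>signal k z - psignal N k z\<bar>) \<in> borel_measurable noise_space"
      by (intro borel_measurable_abs borel_measurable_diff signal_measurable psignal_measurable)
  qed (auto simp: signal_def psignal_def)
  also have "\<dots> = (LINT \<omega>|M. \<bar>sin (drift k (config \<omega>)) - sin (pdrift N k (config \<omega>))\<bar>)"
  proof (rule Bochner_Integration.integral_cong[OF refl])
    fix \<omega>
    define p where "p = (1 + sin (drift k (config \<omega>))) / 2"
    define q where "q = (1 + sin (pdrift N k (config \<omega>))) / 2"
    have pq: "0 \<le> max p q" "max p q \<le> 1" "0 \<le> min p q" "min p q \<le> 1"
      unfolding p_def q_def using one_plus_sin_half_range by (auto simp: max_def min_def)
    have i: "integrable ?U (\<lambda>v. of_bool (v < r) :: real)" for r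
      by (rule U.integrable_const_bound[of _ 1]) (auto simp: of_bool_def)
    have "\<bar>signal k ((config \<omega>)((k, Inl 0) := v)) - psignal N k ((config \<omega>)((k, Inl 0) := v))\<bar> =
        2 * (of_bool (v < max p q) - of_bool (v < min p q))" for v
      unfolding signal_def psignal_def drift_update pdrift_update p_def[symmetric] q_def[symmetric]
      by (auto simp: max_def min_def)
    then have "(LINT v|?U. \<bar>signal k ((config \<omega>)((k, Inl 0) := v)) - psignal N k ((config \<omega>)((k, Inl 0) := v))\<bar>) =
        2 * (max p q - min p q)"
      by (simp only: integral_mult_right_zero Bochner_Integration.integral_diff[OF i i]
          integral_uniform_less[OF pq(1,2)] integral_uniform_less[OF pq(3,4)])
    also have "\<dots> = \<bar>2 * p - 2 * q\<bar>" by (auto simp: max_def min_def)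
    also have "2 * p - 2 * q = sin (drift k (config \<omega>)) - sin (pdrift N k (config \<omega>))"
      unfolding p_def q_def by (simp add: field_simps)
    finally show "(LINT v|?U. \<bar>signal k ((config \<omega>)((k, Inl 0) := v)) - psignal N k ((config \<omega>)((k, Inl 0) := v))\<bar>) =
        \<bar>sin (drift k (config \<omega>)) - sin (pdrift N k (config \<omega>))\<bar>" .
  qed
  finally show ?thesis .
qed

lemma psignal_converges: "(\<lambda>N. LINT \<omega>|M. \<bar>signal k (config \<omega>) - psignal N k (config \<omega>)\<bar>) \<longlonglongrightarrow> 0"
proof -
  have "(\<lambda>N. LINT \<omega>|M. \<bar>sin (drift k (config \<omega>)) - sin (pdrift N k (config \<omega>))\<bar>) \<longlonglongrightarrow> (LINT \<omega>|M. 0)"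
  proof (rule integral_dominated_convergence[where w = "\<lambda>_. 2"])
    show "AE \<omega> in M. (\<lambda>N. \<bar>sin (drift k (config \<omega>)) - sin (pdrift N k (config \<omega>))\<bar>) \<longlonglongrightarrow> 0"
      using AE_pdrift_tendsto
    proof (rule eventually_mono)
      fix \<omega> assume "\<forall>k. (\<lambda>N. pdrift N k (config \<omega>)) \<longlonglongrightarrow> drift k (config \<omega>)"
      then have "(\<lambda>N. \<bar>sin (drift k (config \<omega>)) - sin (pdrift N k (config \<omega>))\<bar>) \<longlonglongrightarrow>
          \<bar>sin (drift k (config \<omega>)) - sin (drift k (config \<omega>))\<bar>"
        by (intro tendsto_rabs tendsto_diff tendsto_const tendsto_sin) blast
      then show "(\<lambda>N. \<bar>sin (drift k (config \<omega>)) - sin (pdrift N k (config \<omega>))\<bar>) \<longlonglongrightarrow> 0" by simp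
    qed
    show "AE \<omega> in M. norm \<bar>sin (drift k (config \<omega>)) - sin (pdrift N k (config \<omega>))\<bar> \<le> 2" for N
    proof (rule AE_I2)
      fix \<omega>
      show "norm \<bar>sin (drift k (config \<omega>)) - sin (pdrift N k (config \<omega>))\<bar> \<le> 2"
        using abs_triangle_ineq4[of "sin (drift k (config \<omega>))" "sin (pdrift N k (config \<omega>))"]
          abs_sin_le_one[of "drift k (config \<omega>)"] abs_sin_le_one[of "pdrift N k (config \<omega>)"]
        unfolding real_norm_def abs_idempotent by linarith
    qed
  qed measurable
  then show ?thesis unfolding expectation_signal_psignal by simp
qed

text \<open>Signals that avoid the coordinates in \<open>K\<close> are functions of the noise with
  these set to 0. Checked on generators, this puts \<open>A\<close> into the field of the part of
  the noise that is independent of \<open>E\<close>.\<close>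

lemma prob_indep_depends_on:
  assumes E: "E \<in> sets noise_space" "depends_on K (\<lambda>z. z \<in> E)"
    and A: "A \<in> sigma_sets (space M) {(\<lambda>\<omega>. signal k (config \<omega>)) -` B \<inter> space M | k B. k \<in> L \<and> B \<in> sets borel}"
    and L: "\<And>k. k \<in> L \<Longrightarrow> depends_on (- K) (signal k)"
  shows "prob (A \<inter> (config -` E \<inter> space M)) = prob A * prob (config -` E \<inter> space M)"
proof -
  define only where "only K y = (\<lambda>i. if i \<in> K then y i else (0::real))" for K and y :: "int \<times> label \<Rightarrow> real"
  let ?c = "\<lambda>\<omega>. only (- K) (config \<omega>)" and ?d = "\<lambda>\<omega>. only K (config \<omega>)"
  have ind: "indep_var noise_space ?d noise_space ?c"
    using indep_var_restricted_config[of K] unfolding only_def .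
  let ?V = "vimage_algebra (space M) ?c noise_space"
  have cs: "?c \<in> space M \<rightarrow> space noise_space" by (auto simp: space_PiM)
  have "sigma_sets (space M) {(\<lambda>\<omega>. signal k (config \<omega>)) -` B \<inter> space M | k B. k \<in> L \<and> B \<in> sets borel} \<subseteq> sets ?V"
  proof -
    have "{(\<lambda>\<omega>. signal k (config \<omega>)) -` B \<inter> space M | k B. k \<in> L \<and> B \<in> sets borel} \<subseteq> sets ?V"
    proof
      fix S assume "S \<in> {(\<lambda>\<omega>. signal k (config \<omega>)) -` B \<inter> space M | k B. k \<in> L \<and> B \<in> sets borel}"
      then obtain k B where S: "S = (\<lambda>\<omega>. signal k (config \<omega>)) -` B \<inter> space M" "k \<in> L" "B \<in> sets borel" by blast
      have "signal k (config \<omega>) = signal k (?c \<omega>)" for \<omega>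
        by (rule depends_onD[OF L[OF S(2)]]) (simp add: only_def)
      then have "S = ?c -` (signal k -` B \<inter> space noise_space) \<inter> space M"
        unfolding S(1) using cs by auto
      moreover have "signal k -` B \<inter> space noise_space \<in> sets noise_space"
        by (rule measurable_sets[OF signal_measurable S(3)])
      ultimately show "S \<in> sets ?V" unfolding sets_vimage_algebra2[OF cs] by blast
    qed
    from sets.sigma_sets_subset[OF this] show ?thesis by simp
  qed
  then have "A \<in> sets ?V" using A by blast
  then obtain S where S: "S \<in> sets noise_space" "A = ?c -` S \<inter> space M"
    unfolding sets_vimage_algebra2[OF cs] by blast
  have "config \<omega> \<in> E \<longleftrightarrow> ?d \<omega> \<in> E" for \<omega>
    using depends_onD[OF E(2), of "config \<omega>" "?d \<omega>"] by (simp add: only_def)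
  then have eE: "config -` E \<inter> space M = ?d -` E \<inter> space M" by auto
  have "A \<inter> (?d -` E \<inter> space M) = (\<lambda>\<omega>. (?d \<omega>, ?c \<omega>)) -` (E \<times> S) \<inter> space M" unfolding S(2) by auto
  then show ?thesis unfolding eE using indep_varD[OF ind E(1) S(1)] unfolding S(2) by (simp add: mult.commute)
qed

text \<open>A full signal, even one in the future, reads infinitely many past sites, but each scale
  only through its own labels and within \<open>100 * len m\<close>. The truncated signs use scales
  below \<open>N\<close>, and at those scales the two ranges are too far apart to meet.\<close>

lemma signal_slots_far:
  assumes J: "\<And>j. j \<in> J \<Longrightarrow> \<bar>j\<bar> \<le> b" and k: "k \<le> - n \<or> n \<le> k" and n: "b + 100 * int (36 ^ N) < n"
  shows "depends_on (- (\<Union>j\<in>J. psignal_slots N j)) (signal k)"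
proof -
  have far: "(i, x) \<notin> psignal_slots N j" if j: "j \<in> J" and x: "(i, x) \<in> insert (k, Inl 0) (\<Union>m. level_slots m k)" for i x j
  proof
    assume p: "(i, x) \<in> psignal_slots N j"
    have fj: "100 * int (36 ^ N) < \<bar>k - j\<bar>" using J[OF j] k n by arith
    have kj: "k \<noteq> j"
    proof
      assume "k = j"
      then have "100 * int (36 ^ N) < 0" using fj by (simp only: diff_self abs_zero)
      then show False by simp
    qed
    have lN: "int (len m) \<le> int (36 ^ N)" if "m < N" for m using that by (simp add: len_def power_increasing)
    have "(i, x) = (j, Inl 0) \<or> (\<exists>m<N. (i, x) \<in> level_slots m j)"
      using p by (auto simp: psignal_slots_def)
    moreover have "(i, x) = (k, Inl 0) \<or> (\<exists>m. (i, x) \<in> level_slots m k)" using x by auto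
    ultimately show False
    proof (elim disjE exE conjE)
      assume "(i, x) = (j, Inl 0)" "(i, x) = (k, Inl 0)" then show False using kj by simp
    next
      fix m m' assume "m < N" "(i, x) \<in> level_slots m j" "(i, x) \<in> level_slots m' k"
      then have "m' = m" "j - 100 * int (len m) \<le> i" "i \<le> j" "k - 100 * int (len m) \<le> i" "i \<le> k" "m < N"
        by (auto simp: level_slots_def)
      then show False using fj lN[of m] by linarith
    qed (auto simp: level_slots_def)
  qed
  have sub: "insert (k, Inl 0) (\<Union>m. level_slots m k) \<subseteq> - (\<Union>j\<in>J. psignal_slots N j)"
    using far by auto
  have "depends_on (insert (k, Inl 0) (\<Union>m. level_slots m k)) (signal k)"
  proof (rule depends_onI)
    fix z z' :: "int \<times> label \<Rightarrow> real"
    assume eq: "\<And>x. x \<in> insert (k, Inl 0) (\<Union>m. level_slots m k) \<Longrightarrow> z x = z' x"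
    have "level m k z = level m k z'" for m
      by (rule depends_onD[OF level_depends_on]) (rule eq, blast)
    then have "drift k z = drift k z'" unfolding drift_def by (simp only:)
    moreover have "z (k, Inl 0) = z' (k, Inl 0)" by (rule eq) simp
    ultimately show "signal k z = signal k z'" unfolding signal_def by (simp only:)
  qed
  then show ?thesis using sub by (rule depends_on_mono)
qed

text \<open>For the truncated event independence is exact whatever \<open>N\<close> is, since a tail
  event is also generated by signals arbitrarily far out. Replacing the true event by the truncated
  one costs an error that vanishes as \<open>N\<close> grows.\<close>

lemma double_tail_indep:
  assumes A: "A \<in> double_tail M (\<lambda>k \<omega>. signal k (config \<omega>))"
    and J: "finite J" and B: "\<And>k. B k \<in> sets borel"
  shows "prob (A \<inter> {\<omega> \<in> space M. \<forall>k\<in>J. signal k (config \<omega>) \<in> B k}) =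
    prob A * prob {\<omega> \<in> space M. \<forall>k\<in>J. signal k (config \<omega>) \<in> B k}"
proof -
  let ?X = "\<lambda>k \<omega>. signal k (config \<omega>)"
  let ?gen = "\<lambda>L. {?X k -` B \<inter> space M | k B. k \<in> L \<and> B \<in> sets borel}"
  have Xm: "?X k \<in> borel_measurable M" for k
    by (rule measurable_compose[OF config_measurable signal_measurable])
  have gen_ev: "?gen L \<subseteq> events" for L
  proof
    fix S assume "S \<in> ?gen L"
    then obtain k C where "S = ?X k -` C \<inter> space M" "C \<in> sets borel" by blast
    then show "S \<in> events" using measurable_sets[OF Xm] by simp
  qed
  have tail: "A \<in> sigma_sets (space M) (?gen {k. k \<le> - int n \<or> int n \<le> k})" if n: "1 \<le> n" for n
  proof -
    let ?\<sigma> = "sigma_sets (space M) (?gen {k. k \<le> - int n \<or> int n \<le> k})"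
    have "generated_field M ?X K \<subseteq> ?\<sigma>" if K: "K \<subseteq> {k. k \<le> - int n \<or> int n \<le> k}" for K
      unfolding generated_field_def
    proof (rule sigma_sets_mono')
      show "?gen K \<subseteq> ?gen {k. k \<le> - int n \<or> int n \<le> k}" using K by blast
    qed
    from this[of "{..- int n}"] this[of "{int n..}"]
    have "generated_field M ?X {..- int n} \<union> generated_field M ?X {int n..} \<subseteq> ?\<sigma>"
      by (intro Un_least) auto
    then have "sigma_sets (space M) (generated_field M ?X {..- int n} \<union> generated_field M ?X {int n..}) \<subseteq> ?\<sigma>"
      by (rule sigma_sets_mono)
    moreover have "A \<in> sigma_sets (space M) (generated_field M ?X {..- int n} \<union> generated_field M ?X {int n..})"
      using A unfolding double_tail_def by (rule INT_D) (use n in simp)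
    ultimately show ?thesis by (rule subsetD)
  qed
  have Aev: "A \<in> events" using tail[of 1] sets.sigma_sets_subset[OF gen_ev] by blast
  define E where "E = {\<omega> \<in> space M. \<forall>k\<in>J. ?X k \<omega> \<in> B k}"
  define G where "G N = {z. \<forall>k\<in>J. psignal N k z \<in> B k}" for N
  define EN where "EN N = config -` G N \<inter> space M" for N
  define b where "b = Max (insert 0 (abs ` J))"
  have b: "\<bar>j\<bar> \<le> b" if "j \<in> J" for j unfolding b_def using J that by (intro Max_ge) auto
  have b0: "0 \<le> b" unfolding b_def using J by (intro Max_ge) auto
  have Gs: "G N \<in> sets noise_space" for N
  proof -
    have "{z \<in> space noise_space. \<forall>k\<in>J. psignal N k z \<in> B k} \<in> sets noise_space"
    proof (rule sets.sets_Collect_finite_All[OF _ J])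
      show "{z \<in> space noise_space. psignal N k z \<in> B k} \<in> sets noise_space" for k
        using measurable_sets[OF psignal_measurable B] by (simp add: vimage_def Int_def conj_commute)
    qed
    then show ?thesis by (simp add: G_def space_PiM)
  qed
  have indN: "prob (A \<inter> EN N) = prob A * prob (EN N)" for N
  proof -
    let ?n = "nat (b + 100 * int (36 ^ N) + 1)"
    have n: "1 \<le> ?n" "b + 100 * int (36 ^ N) < int ?n"
      using b0 of_nat_0_le_iff[of "36 ^ N", where 'a = int] by linarith+
    show ?thesis unfolding EN_def
    proof (rule prob_indep_depends_on[OF Gs _ tail[OF n(1)]])
      show "depends_on (\<Union>j\<in>J. psignal_slots N j) (\<lambda>z. z \<in> G N)"
      proof (rule depends_onI)
        fix z z' :: "int \<times> label \<Rightarrow> real"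
        assume eq: "\<And>x. x \<in> (\<Union>j\<in>J. psignal_slots N j) \<Longrightarrow> z x = z' x"
        have "psignal N j z = psignal N j z'" if "j \<in> J" for j
          by (rule depends_onD[OF psignal_depends_on]) (rule eq, use that in blast)
        then show "(z \<in> G N) = (z' \<in> G N)" by (simp add: G_def)
      qed
      show "depends_on (- (\<Union>j\<in>J. psignal_slots N j)) (signal k)" if "k \<in> {k. k \<le> - int ?n \<or> int ?n \<le> k}" for k
        by (rule signal_slots_far[OF b _ n(2)]) (use that in auto)
    qed
  qed
  have Eev: "E \<in> events"
  proof -
    have "{\<omega> \<in> space M. ?X k \<omega> \<in> B k} \<in> events" for k
      using measurable_sets[OF measurable_compose[OF config_measurable signal_measurable] B]
      by (simp add: vimage_def Int_def conj_commute)
    then show ?thesis unfolding E_def by (intro sets.sets_Collect_finite_All J)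
  qed
  have ENev: "EN N \<in> events" for N unfolding EN_def by (rule measurable_sets[OF config_measurable Gs])
  define err where "err N = (\<Sum>k\<in>J. LINT \<omega>|M. \<bar>?X k \<omega> - psignal N k (config \<omega>)\<bar>)" for N
  have close: "\<bar>prob (C \<inter> E) - prob (C \<inter> EN N)\<bar> \<le> err N" if C: "C \<in> events" for C N
  proof -
    have ints: "integrable M (\<lambda>\<omega>. \<bar>?X k \<omega> - psignal N k (config \<omega>)\<bar>)" for k
      by (rule integrable_const_bound[of _ 2]) (auto simp: signal_def psignal_def intro!: measurable_compose[OF config_measurable] borel_measurable_abs borel_measurable_diff signal_measurable psignal_measurable)
    have i1: "integrable M (indicator (C \<inter> E) :: _ \<Rightarrow> real)" "integrable M (indicator (C \<inter> EN N) :: _ \<Rightarrow> real)"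
      using C Eev ENev by (auto intro!: integrable_real_indicator simp: less_top[symmetric])
    have "prob (C \<inter> E) - prob (C \<inter> EN N) = (LINT \<omega>|M. indicator (C \<inter> E) \<omega> - indicator (C \<inter> EN N) \<omega>)"
      using i1 C Eev ENev by (simp add: Int_absorb2 sets.sets_into_space)
    then have "\<bar>prob (C \<inter> E) - prob (C \<inter> EN N)\<bar> \<le> (LINT \<omega>|M. \<bar>indicator (C \<inter> E) \<omega> - indicator (C \<inter> EN N) \<omega>\<bar>)"
      using integral_abs_bound by metis
    also have "\<dots> \<le> (LINT \<omega>|M. (\<Sum>k\<in>J. \<bar>?X k \<omega> - psignal N k (config \<omega>)\<bar>))"
    proof (rule integral_mono)
      show "integrable M (\<lambda>\<omega>. \<bar>indicator (C \<inter> E) \<omega> - indicator (C \<inter> EN N) \<omega>\<bar> :: real)"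
        using i1 by (intro integrable_abs Bochner_Integration.integrable_diff)
      show "integrable M (\<lambda>\<omega>. \<Sum>k\<in>J. \<bar>?X k \<omega> - psignal N k (config \<omega>)\<bar>)"
        by (rule Bochner_Integration.integrable_sum) (rule ints)
      fix \<omega> assume w: "\<omega> \<in> space M"
      show "\<bar>indicator (C \<inter> E) \<omega> - indicator (C \<inter> EN N) \<omega>\<bar> \<le> (\<Sum>k\<in>J. \<bar>?X k \<omega> - psignal N k (config \<omega>)\<bar>)"
      proof (cases "\<forall>k\<in>J. ?X k \<omega> = psignal N k (config \<omega>)")
        case True
        then have "\<omega> \<in> E \<longleftrightarrow> \<omega> \<in> EN N" using w by (simp add: E_def EN_def G_def)
        then show ?thesis by (auto simp: indicator_def intro: sum_nonneg)
      next
        case False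
        then obtain k where k: "k \<in> J" "?X k \<omega> \<noteq> psignal N k (config \<omega>)" by blast
        have "1 \<le> \<bar>?X k \<omega> - psignal N k (config \<omega>)\<bar>" using k(2) by (auto simp: signal_def psignal_def split: if_splits)
        also have "\<dots> \<le> (\<Sum>k\<in>J. \<bar>?X k \<omega> - psignal N k (config \<omega>)\<bar>)"
          by (rule member_le_sum[OF k(1)]) (use J in auto)
        finally show ?thesis by (auto simp: indicator_def)
      qed
    qed
    also have "\<dots> = err N" unfolding err_def by (rule Bochner_Integration.integral_sum) (rule ints)
    finally show ?thesis .
  qed
  have err0: "err \<longlonglongrightarrow> 0"
  proof -
    have "(\<lambda>N. \<Sum>k\<in>J. LINT \<omega>|M. \<bar>?X k \<omega> - psignal N k (config \<omega>)\<bar>) \<longlonglongrightarrow> (\<Sum>k\<in>J. 0)"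
      by (rule tendsto_sum) (rule psignal_converges)
    then show ?thesis by (simp add: err_def[abs_def])
  qed
  have bound: "\<bar>prob (A \<inter> E) - prob A * prob E\<bar> \<le> 2 * err N" for N
  proof -
    have sp: "space M \<inter> E = E" "space M \<inter> EN N = EN N" by (auto simp: E_def EN_def)
    have 1: "\<bar>prob (A \<inter> E) - prob (A \<inter> EN N)\<bar> \<le> err N" by (rule close[OF Aev])
    have 2: "\<bar>prob E - prob (EN N)\<bar> \<le> err N" using close[OF sets.top, of N] unfolding sp .
    have "\<bar>prob A * prob E - prob A * prob (EN N)\<bar> = prob A * \<bar>prob E - prob (EN N)\<bar>"
      by (simp add: right_diff_distrib[symmetric] abs_mult)
    also have "\<dots> \<le> 1 * \<bar>prob E - prob (EN N)\<bar>" by (rule mult_right_mono) auto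
    finally have 3: "\<bar>prob A * prob E - prob (A \<inter> EN N)\<bar> \<le> err N"
      unfolding indN mult_1 using 2 by (rule order_trans)
    have "\<bar>x - z\<bar> \<le> \<bar>x - y\<bar> + \<bar>z - y\<bar>" for x y z :: real by arith
    from order_trans[OF this add_mono[OF 1 3]] show ?thesis by simp
  qed
  have "\<bar>prob (A \<inter> E) - prob A * prob E\<bar> \<le> 2 * 0"
    by (rule LIMSEQ_le_const[OF tendsto_mult[OF tendsto_const err0]]) (use bound in auto)
  then show ?thesis unfolding E_def by simp
qed

text \<open>Finite-dimensional events form a generating system stable under intersection, and the
  tail event itself belongs to the field they generate; independence from them thus extends to
  independence from itself.\<close>

lemma double_tail_trivial:
  assumes A: "A \<in> double_tail M (\<lambda>k \<omega>. signal k (config \<omega>))"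
  shows "prob A = 0 \<or> prob A = 1"
proof -
  let ?X = "\<lambda>k \<omega>. signal k (config \<omega>)"
  define P where "P = {{\<omega> \<in> space M. \<forall>k\<in>{-j..j}. ?X k \<omega> \<in> B k} | j B. \<forall>k. B k \<in> sets borel}"
  have Xk: "{\<omega> \<in> space M. ?X k \<omega> \<in> S} \<in> events" if "S \<in> sets borel" for k S
    using measurable_sets[OF measurable_compose[OF config_measurable signal_measurable] that]
    by (simp add: vimage_def Int_def conj_commute)
  have Pev: "P \<subseteq> events"
  proof
    fix E assume "E \<in> P"
    then obtain j B where E: "E = {\<omega> \<in> space M. \<forall>k\<in>{-j..j}. ?X k \<omega> \<in> B k}" "\<forall>k. B k \<in> sets borel"
      unfolding P_def by blast
    show "E \<in> events" unfolding E(1) by (rule sets.sets_Collect_finite_All) (use Xk E(2) in auto)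
  qed
  have Int: "Int_stable P"
  proof (rule Int_stableI)
    fix E E' assume "E \<in> P" "E' \<in> P"
    then obtain j B j' B' where E: "E = {\<omega> \<in> space M. \<forall>k\<in>{-j..j}. ?X k \<omega> \<in> B k}" "\<forall>k. B k \<in> sets borel"
      "E' = {\<omega> \<in> space M. \<forall>k\<in>{-j'..j'}. ?X k \<omega> \<in> B' k}" "\<forall>k. B' k \<in> sets borel"
      unfolding P_def by blast
    \<comment> \<open>Both events are rewritten on the larger of the two ranges, with
      \<open>UNIV\<close> where one of them imposes nothing.\<close>
    define C where "C k = (if k \<in> {-j..j} then B k else UNIV) \<inter> (if k \<in> {-j'..j'} then B' k else UNIV)" for k
    have "E \<inter> E' = {\<omega> \<in> space M. \<forall>k\<in>{-max j j'..max j j'}. ?X k \<omega> \<in> C k}"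
    proof (intro set_eqI iffI)
      fix \<omega> assume w: "\<omega> \<in> {\<omega> \<in> space M. \<forall>k\<in>{-max j j'..max j j'}. ?X k \<omega> \<in> C k}"
      have "?X k \<omega> \<in> B k" if "k \<in> {-j..j}" for k
      proof -
        have "k \<in> {-max j j'..max j j'}" using that by auto
        then have "?X k \<omega> \<in> C k" using w by blast
        then show ?thesis using that by (simp add: C_def)
      qed
      moreover have "?X k \<omega> \<in> B' k" if "k \<in> {-j'..j'}" for k
      proof -
        have "k \<in> {-max j j'..max j j'}" using that by auto
        then have "?X k \<omega> \<in> C k" using w by blast
        then show ?thesis using that by (simp add: C_def)
      qed
      ultimately show "\<omega> \<in> E \<inter> E'" using w unfolding E by blast
    qed (auto simp: E C_def)
    moreover have "\<forall>k. C k \<in> sets borel" using E(2,4) by (auto simp: C_def)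
    ultimately show "E \<inter> E' \<in> P" unfolding P_def by blast
  qed
  have gen: "{?X k -` B \<inter> space M | k B. k \<in> L \<and> B \<in> sets borel} \<subseteq> P" for L
  proof
    fix E assume "E \<in> {?X k -` B \<inter> space M | k B. k \<in> L \<and> B \<in> sets borel}"
    then obtain k B where E: "E = ?X k -` B \<inter> space M" "B \<in> sets borel" by blast
    have "E = {\<omega> \<in> space M. \<forall>i\<in>{-\<bar>k\<bar>..\<bar>k\<bar>}. ?X i \<omega> \<in> (if i = k then B else UNIV)}"
      unfolding E(1) by auto
    moreover have "\<forall>i. (if i = k then B else UNIV) \<in> sets borel" using E(2) by auto
    ultimately show "E \<in> P" unfolding P_def by (intro CollectI exI[of _ "\<bar>k\<bar>"] exI[of _ "\<lambda>i. if i = k then B else UNIV"] conjI)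
  qed
  have AP: "A \<in> sigma_sets (space M) P"
  proof -
    have "generated_field M ?X K \<subseteq> sigma_sets (space M) P" for K
      unfolding generated_field_def by (rule sigma_sets_mono'[OF gen])
    then have "sigma_sets (space M) (generated_field M ?X {..- int 1} \<union> generated_field M ?X {int 1..}) \<subseteq> sigma_sets (space M) P"
      by (intro sigma_sets_mono) blast
    moreover have "A \<in> sigma_sets (space M) (generated_field M ?X {..- int 1} \<union> generated_field M ?X {int 1..})"
      using A unfolding double_tail_def by (rule INT_D) simp
    ultimately show ?thesis by (rule subsetD)
  qed
  have Aev: "A \<in> events" using AP sets.sigma_sets_subset[OF Pev] by blast
  have "indep_set {A} P"
    unfolding indep_set_def
  proof (rule indep_setsI)
    show "case_bool {A} P i \<subseteq> events" for i using Aev Pev by (cases i) auto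
  next
    fix D :: "bool \<Rightarrow> 'a set" and I assume I: "I \<noteq> {}" "I \<subseteq> UNIV" "finite I" "\<forall>i\<in>I. D i \<in> case_bool {A} P i"
    have two: "prob (D True \<inter> D False) = prob (D True) * prob (D False)" if "True \<in> I" "False \<in> I"
    proof -
      have "D True = A" "D False \<in> P" using I(4) that by (auto dest: bspec)
      then obtain j B where "D False = {\<omega> \<in> space M. \<forall>k\<in>{-j..j}. ?X k \<omega> \<in> B k}" "\<forall>k. B k \<in> sets borel"
        unfolding P_def by blast
      then show ?thesis using double_tail_indep[OF A, of "{-j..j}" B] \<open>D True = A\<close> by simp
    qed
    have "I \<in> Pow {True, False}" by auto
    then have "I = {True} \<or> I = {False} \<or> I = {True, False}" using I(1) unfolding Pow_insert Pow_empty by auto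
    then show "prob (\<Inter>i\<in>I. D i) = (\<Prod>i\<in>I. prob (D i))" using two by auto
  qed
  then have "indep_set (sigma_sets (space M) {A}) (sigma_sets (space M) P)"
    by (rule indep_set_sigma_sets) (use Int in \<open>auto simp: Int_stable_def\<close>)
  then have "prob (A \<inter> A) = prob A * prob A"
    by (rule indep_setD) (use AP in auto)
  then have "prob A * (prob A - 1) = 0" by (simp add: algebra_simps)
  then show ?thesis by simp
qed

end

section \<open>Coding the noise of a site by one real number\<close>

text \<open>For \<open>u\<close> in the unit interval, the binary digit at place
  \<open>j + 1\<close> after the point; as a difference of floors it is visibly measurable.\<close>

definition bit2 :: "real \<Rightarrow> nat \<Rightarrow> real" where
  "bit2 u j = real_of_int \<lfloor>2 ^ Suc j * u\<rfloor> - 2 * real_of_int \<lfloor>2 ^ j * u\<rfloor>"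

lemma bit2_cases: "bit2 u j = 0 \<or> bit2 u j = 1"
proof -
  have "\<lfloor>2 * x\<rfloor> = 2 * \<lfloor>x\<rfloor> \<or> \<lfloor>2 * x\<rfloor> = 2 * \<lfloor>x\<rfloor> + 1" for x :: real by linarith
  from this[of "2 ^ j * u"] have "\<lfloor>2 ^ Suc j * u\<rfloor> = 2 * \<lfloor>2 ^ j * u\<rfloor> \<or> \<lfloor>2 ^ Suc j * u\<rfloor> = 2 * \<lfloor>2 ^ j * u\<rfloor> + 1"
    by (simp only: power_Suc mult.assoc)
  then show ?thesis unfolding bit2_def by (elim disjE) simp_all
qed

lemma bit2_suminf:
  assumes "0 \<le> u" "u < 1"
  shows "(\<Sum>j. bit2 u j / 2 ^ Suc j) = u"
proof -
  have s: "(\<Sum>j<n. bit2 u j / 2 ^ Suc j) = real_of_int \<lfloor>2 ^ n * u\<rfloor> / 2 ^ n" for n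
  proof (induction n)
    case 0
    have "\<lfloor>u\<rfloor> = 0" using assms by linarith
    then show ?case by simp
  next
    case (Suc n)
    then show ?case by (simp add: bit2_def field_simps)
  qed
  have "(\<lambda>n. real_of_int \<lfloor>2 ^ n * u\<rfloor> / 2 ^ n) \<longlonglongrightarrow> u"
  proof (rule tendsto_sandwich)
    have "u - (1 / 2) ^ n \<le> real_of_int \<lfloor>2 ^ n * u\<rfloor> / 2 ^ n" for n
    proof -
      have "2 ^ n * u - 1 \<le> real_of_int \<lfloor>2 ^ n * u\<rfloor>" by linarith
      then have "(2 ^ n * u - 1) / 2 ^ n \<le> real_of_int \<lfloor>2 ^ n * u\<rfloor> / 2 ^ n" by (rule divide_right_mono) simp
      then show ?thesis by (simp add: diff_divide_distrib power_one_over)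
    qed
    then show "eventually (\<lambda>n. u - (1 / 2) ^ n \<le> real_of_int \<lfloor>2 ^ n * u\<rfloor> / 2 ^ n) sequentially" by simp
    have "real_of_int \<lfloor>2 ^ n * u\<rfloor> / 2 ^ n \<le> u" for n
    proof -
      have "real_of_int \<lfloor>2 ^ n * u\<rfloor> / 2 ^ n \<le> (2 ^ n * u) / 2 ^ n" by (rule divide_right_mono) auto
      then show ?thesis by simp
    qed
    then show "eventually (\<lambda>n. real_of_int \<lfloor>2 ^ n * u\<rfloor> / 2 ^ n \<le> u) sequentially" by simp
    have "(\<lambda>n. u - (1 / 2) ^ n) \<longlonglongrightarrow> u - 0"
      by (intro tendsto_diff tendsto_const LIMSEQ_realpow_zero) auto
    then show "(\<lambda>n. u - (1 / 2) ^ n) \<longlonglongrightarrow> u" by simp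
  qed auto
  then have "(\<lambda>j. bit2 u j / 2 ^ Suc j) sums u" unfolding sums_def s .
  then show ?thesis by (rule sums_unique[symmetric])
qed

definition digit4 :: "real \<Rightarrow> nat \<Rightarrow> real" where
  "digit4 c n = real_of_int \<lfloor>4 ^ Suc n * c\<rfloor> - 4 * real_of_int \<lfloor>4 ^ n * c\<rfloor>"

text \<open>Base 4 instead of 2, because digits 0 and 1 then determine the number uniquely: the remainder
  after any digit is below 1.\<close>

lemma digit4_suminf:
  fixes d :: "nat \<Rightarrow> real"
  assumes d: "\<And>n. d n = 0 \<or> d n = 1"
  shows "digit4 (\<Sum>i. d i / 4 ^ Suc i) n = d n"
proof -
  define c where "c k = (\<Sum>i. d (i + k) / 4 ^ Suc i)" for k
  have g: "(\<lambda>i. (1::real) / 4 ^ Suc i) sums (1 / 3)"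
    using sums_mult[OF geometric_sums[of "1/4::real"], of "1/4"] by (simp add: power_one_over)
  have b: "0 \<le> d (i + k) / 4 ^ Suc i" "d (i + k) / 4 ^ Suc i \<le> 1 / 4 ^ Suc i" for i k
    using d[of "i + k"] by (auto intro: divide_right_mono)
  have sm: "summable (\<lambda>i. d (i + k) / 4 ^ Suc i)" for k
    by (rule summable_comparison_test'[OF sums_summable[OF g], of 0])
      (simp only: real_norm_def abs_of_nonneg[OF b(1)] b(2))
  have c0: "0 \<le> c k" for k unfolding c_def by (rule suminf_nonneg[OF sm b(1)])
  have c1: "c k < 1" for k
  proof -
    have "c k \<le> (\<Sum>i. (1::real) / 4 ^ Suc i)" unfolding c_def
      by (rule suminf_le[OF b(2) sm sums_summable[OF g]])
    then show ?thesis using sums_unique[OF g] by simp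
  qed
  have rec: "4 * c k = d k + c (Suc k)" for k
  proof -
    have "c k = d k / 4 + (\<Sum>i. d (Suc i + k) / 4 ^ Suc (Suc i))"
      unfolding c_def using suminf_split_head[OF sm[of k]] by simp
    also have "(\<Sum>i. d (Suc i + k) / 4 ^ Suc (Suc i)) = (\<Sum>i. (1 / 4) * (d (i + Suc k) / 4 ^ Suc i))"
      by simp
    also have "\<dots> = 1 / 4 * c (Suc k)" unfolding c_def by (rule suminf_mult[OF sm])
    finally show ?thesis by simp
  qed
  have ex: "\<exists>N::int. 4 ^ n * c 0 = real_of_int N + c n" for n
  proof (induction n)
    case 0 show ?case by (rule exI[of _ 0]) simp
  next
    case (Suc n)
    then obtain N :: int where N: "4 ^ n * c 0 = real_of_int N + c n" by blast
    obtain e :: int where e: "d n = real_of_int e" using d[of n] by (metis of_int_0 of_int_1)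
    have "4 ^ Suc n * c 0 = 4 * (4 ^ n * c 0)" by simp
    also have "\<dots> = 4 * real_of_int N + 4 * c n" unfolding N by simp
    also have "\<dots> = real_of_int (4 * N + e) + c (Suc n)" unfolding rec by (simp add: e)
    finally show ?case by blast
  qed
  have fl: "4 ^ n * c 0 = real_of_int \<lfloor>4 ^ n * c 0\<rfloor> + c n" for n
  proof -
    obtain N :: int where N: "4 ^ n * c 0 = real_of_int N + c n" using ex by blast
    have "\<lfloor>4 ^ n * c 0\<rfloor> = N" unfolding N using c0[of n] c1[of n] by linarith
    then show ?thesis using N by simp
  qed
  have "4 ^ Suc n * c 0 = 4 * (4 ^ n * c 0)" by simp
  then have "real_of_int \<lfloor>4 ^ Suc n * c 0\<rfloor> + c (Suc n) = 4 * real_of_int \<lfloor>4 ^ n * c 0\<rfloor> + 4 * c n"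
    using fl[of n] fl[of "Suc n"] by linarith
  then have "digit4 (c 0) n = d n" unfolding digit4_def using rec[of n] by linarith
  then show ?thesis by (simp add: c_def)
qed

text \<open>A homeomorphism of the line onto the open unit interval, so that every real number
  acquires a binary expansion without integer part.\<close>

definition squash :: "real \<Rightarrow> real" where
  "squash t = 1 / 2 + t / (2 * (1 + \<bar>t\<bar>))"

definition unsquash :: "real \<Rightarrow> real" where
  "unsquash u = (2 * u - 1) / (1 - \<bar>2 * u - 1\<bar>)"

lemma squash_alt: "squash t = 1 / 2 + (t / (1 + \<bar>t\<bar>)) / 2"
  by (simp add: squash_def)

lemma squash_range: "0 \<le> squash t" "squash t < 1"
proof -
  have p: "0 < 1 + \<bar>t\<bar>" by simp
  have b: "\<bar>t / (1 + \<bar>t\<bar>)\<bar> < 1" using p by (simp add: abs_divide)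
  have "0 \<le> 1 / 2 + x / 2" "1 / 2 + x / 2 < 1" if "\<bar>x\<bar> < 1" for x :: real using that by auto
  from this[OF b] show "0 \<le> squash t" "squash t < 1" unfolding squash_alt .
qed

lemma unsquash_squash: "unsquash (squash t) = t"
proof -
  have p: "0 < 1 + \<bar>t\<bar>" by simp
  have "2 * (1 / 2 + x / 2) - 1 = x" for x :: real by simp
  then have 1: "2 * squash t - 1 = t / (1 + \<bar>t\<bar>)" unfolding squash_alt .
  have 2: "1 - \<bar>t / (1 + \<bar>t\<bar>)\<bar> = 1 / (1 + \<bar>t\<bar>)" using p by (simp add: abs_divide field_simps)
  show ?thesis unfolding unsquash_def 1 2 using p by simp
qed

text \<open>The bits of all labels form an array indexed by label and place; the pairing function
  lists it as one digit sequence of a single real number.\<close>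

definition enc :: "(label \<Rightarrow> real) \<Rightarrow> real" where
  "enc y = (\<Sum>n. bit2 (squash (y (from_nat (fst (prod_decode n))))) (snd (prod_decode n)) / 4 ^ Suc n)"

definition dec :: "real \<Rightarrow> label \<Rightarrow> real" where
  "dec c x = unsquash (\<Sum>j. digit4 c (prod_encode (to_nat x, j)) / 2 ^ Suc j)"

text \<open>Exact for every \<open>y\<close>, not just almost surely: the digits of the code are
  recovered one by one, and the binary digits of a squashed value sum back to it.\<close>

lemma dec_enc: "dec (enc y) x = y x"
proof -
  have "digit4 (enc y) n = bit2 (squash (y (from_nat (fst (prod_decode n))))) (snd (prod_decode n))" for n
    unfolding enc_def by (rule digit4_suminf) (rule bit2_cases)
  then have "dec (enc y) x = unsquash (\<Sum>j. bit2 (squash (y x)) j / 2 ^ Suc j)"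
    unfolding dec_def by simp
  then show ?thesis by (simp only: bit2_suminf[OF squash_range] unsquash_squash)
qed

lemma enc_measurable:
  assumes "\<And>x. (\<lambda>w. g w x) \<in> borel_measurable N"
  shows "(\<lambda>w. enc (g w)) \<in> borel_measurable N"
proof -
  have b: "(\<lambda>u. bit2 u j) \<in> borel_measurable borel" for j unfolding bit2_def by measurable
  have s: "squash \<in> borel_measurable borel" unfolding squash_def[abs_def] by measurable
  have "(\<lambda>w. bit2 (squash (g w x)) j) \<in> borel_measurable N" for x j
    by (rule measurable_compose[OF measurable_compose[OF assms s] b])
  then show ?thesis unfolding enc_def by (intro borel_measurable_suminf borel_measurable_divide) auto
qed

lemma dec_measurable: "(\<lambda>c. dec c x) \<in> borel_measurable borel"
proof -
  have d: "(\<lambda>c. digit4 c n) \<in> borel_measurable borel" for n unfolding digit4_def by measurable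
  have u: "unsquash \<in> borel_measurable borel" unfolding unsquash_def[abs_def] by measurable
  show ?thesis unfolding dec_def
    by (rule measurable_compose[OF _ u]) (intro borel_measurable_suminf borel_measurable_divide d, simp)
qed

section \<open>The product space of the noise and the space of coded sequences\<close>

definition law :: "label \<Rightarrow> real measure" where
  "law x = (case x of Inl m \<Rightarrow> uniform_measure lborel {0..1} | Inr p \<Rightarrow> std_normal_distribution)"

lemma law_simps: "law (Inl m) = uniform_measure lborel {0..1}" "law (Inr p) = std_normal_distribution"
  by (simp_all add: law_def)

lemma prob_space_law: "prob_space (law x)"
  unfolding law_def by (cases x) (auto intro: prob_space_uniform_measure prob_space_normal_density)

lemma sets_law [measurable_cong, simp]: "sets (law x) = sets borel"
  unfolding law_def by (cases x) auto

definition base :: "(int \<times> label \<Rightarrow> real) measure" where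
  "base = PiM UNIV (\<lambda>i. law (snd i))"

lemma sets_base [measurable_cong, simp]: "sets base = sets noise_space"
  unfolding base_def by (rule sets_PiM_cong) auto

lemma prob_space_base: "prob_space base"
  unfolding base_def by (rule prob_space_PiM) (rule prob_space_law)

lemma distr_base_component: "distr base borel (\<lambda>z. z i) = law (snd i)"
proof -
  have "distr base borel (\<lambda>z. z i) = distr (PiM UNIV (\<lambda>i. law (snd i))) (law (snd i)) (\<lambda>z. z i)"
    unfolding base_def by (rule distr_cong) auto
  also have "\<dots> = law (snd i)" by (rule distr_PiM_component) (auto intro: prob_space_law)
  finally show ?thesis .
qed

lemma shift_measurable: "shift d \<in> measurable noise_space noise_space"
proof (rule measurable_PiM_single')
  fix i :: "int \<times> label"
  show "(\<lambda>z. shift d z i) \<in> borel_measurable noise_space"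
    unfolding shift_def case_prod_beta by (rule component_measurable)
qed auto

text \<open>The law of a coordinate depends on its label and not on its site, so a shift reindexes
  the product injectively without changing any factor.\<close>

lemma distr_base_shift: "distr base noise_space (shift d) = base"
proof -
  define f where "f i = (fst i + d, snd i)" for i :: "int \<times> label"
  have "distr (PiM UNIV (\<lambda>i. law (snd i))) (PiM UNIV (\<lambda>i. law (snd (f i)))) (\<lambda>z. \<lambda>n\<in>UNIV. z (f n)) =
      PiM UNIV (\<lambda>i. law (snd (f i)))"
    by (rule distr_PiM_reindex) (auto simp: inj_on_def f_def prod_eq_iff intro: prob_space_law)
  moreover have "(\<lambda>z. \<lambda>n\<in>UNIV. z (f n)) = shift d" by (auto simp: fun_eq_iff shift_def f_def)
  moreover have "(\<lambda>i. law (snd (f i))) = (\<lambda>i. law (snd i))" by (simp add: f_def)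
  ultimately have "distr base base (shift d) = base" unfolding base_def by simp
  moreover have "distr base base (shift d) = distr base noise_space (shift d)" by (rule distr_cong) auto
  ultimately show ?thesis by simp
qed

lemma noise_base: "noise base (\<lambda>i z. z i)"
proof -
  interpret prob_space base by (rule prob_space_base)
  have m: "(\<lambda>z. z i) \<in> borel_measurable base" for i
    using component_measurable[of i] by (simp add: measurable_cong_sets[OF sets_base refl])
  show ?thesis
  proof (unfold_locales)
    have "distr base noise_space (\<lambda>z. \<lambda>i\<in>UNIV. z i) = base"
      by (simp add: restrict_UNIV distr_id2)
    also have "base = PiM UNIV (\<lambda>i. distr base borel (\<lambda>z. z i))"
      unfolding distr_base_component by (simp add: base_def)
    finally show "indep_vars (\<lambda>_. borel) (\<lambda>i z. z i) UNIV"
      using m by (subst indep_vars_iff_distr_eq_PiM') auto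
  qed (simp_all add: distr_base_component law_simps)
qed

lemma (in noise) distr_config: "distr M noise_space config = base"
proof -
  have "distr M noise_space (\<lambda>\<omega>. \<lambda>i\<in>UNIV. Z i \<omega>) = PiM UNIV (\<lambda>i. distr M borel (Z i))"
    using indep by (subst (asm) indep_vars_iff_distr_eq_PiM') auto
  also have "(\<lambda>i. distr M borel (Z i)) = (\<lambda>i. law (snd i))"
  proof
    fix i
    show "distr M borel (Z i) = law (snd i)"
    proof (cases i)
      case (Pair j x)
      then show ?thesis by (cases x) (simp_all add: coin_unif gauss_normal law_simps)
    qed
  qed
  finally show ?thesis by (simp add: base_def config_def[abs_def] restrict_UNIV)
qed

text \<open>Inherited from the shift-invariant law of the noise, because \<open>signal\<close>
  commutes with shifts.\<close>

lemma (in noise) strictly_stationary_X: "strictly_stationary M X"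
  unfolding strictly_stationary_def
proof (intro conjI allI)
  show "X k \<in> borel_measurable M" for k by (rule X_measurable)
  have sm: "(\<lambda>z k. signal k z) \<in> measurable noise_space (\<Pi>\<^sub>M k\<in>(UNIV::int set). borel)"
    by (rule measurable_PiM_single') (auto intro: signal_measurable)
  fix m :: int
  have "distr M (\<Pi>\<^sub>M k\<in>(UNIV::int set). borel) (\<lambda>\<omega> k. X (k + m) \<omega>) =
      distr M (\<Pi>\<^sub>M k\<in>(UNIV::int set). borel) ((\<lambda>z k. signal k z) \<circ> (shift m \<circ> config))"
    by (simp add: comp_def signal_shift)
  also have "\<dots> = distr (distr (distr M noise_space config) noise_space (shift m)) (\<Pi>\<^sub>M k\<in>(UNIV::int set). borel) (\<lambda>z k. signal k z)"
    by (simp add: distr_distr[OF sm] distr_distr[OF shift_measurable config_measurable]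
        measurable_comp[OF config_measurable shift_measurable])
  also have "\<dots> = distr (distr M noise_space config) (\<Pi>\<^sub>M k\<in>(UNIV::int set). borel) (\<lambda>z k. signal k z)"
    unfolding distr_config distr_base_shift ..
  also have "\<dots> = distr M (\<Pi>\<^sub>M k\<in>(UNIV::int set). borel) (\<lambda>\<omega> k. X k \<omega>)"
    by (simp add: distr_distr[OF sm config_measurable] comp_def)
  finally show "distr M (\<Pi>\<^sub>M k\<in>(UNIV::int set). borel) (\<lambda>\<omega> k. X (k + m) \<omega>) =
      distr M (\<Pi>\<^sub>M k\<in>(UNIV::int set). borel) (\<lambda>\<omega> k. X k \<omega>)" .
qed

definition emb :: "(int \<times> label \<Rightarrow> real) \<Rightarrow> int \<Rightarrow> real" where
  "emb z k = enc (\<lambda>x. z (k, x))"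

abbreviation seq_space :: "(int \<Rightarrow> real) measure" where
  "seq_space \<equiv> PiM UNIV (\<lambda>_. borel)"

lemma emb_component_measurable: "(\<lambda>z. emb z k) \<in> borel_measurable noise_space"
  unfolding emb_def by (rule enc_measurable) (rule component_measurable)

lemma emb_measurable: "emb \<in> measurable noise_space seq_space"
  by (rule measurable_PiM_single') (auto intro: emb_component_measurable)

text \<open>The law of the sequence of site codes. Its coordinates serve as the i.i.d. sequence, and
  decoding them returns the full noise.\<close>

definition coded :: "(int \<Rightarrow> real) measure" where
  "coded = distr base seq_space emb"

definition decoded :: "int \<times> label \<Rightarrow> (int \<Rightarrow> real) \<Rightarrow> real" where
  "decoded i \<omega> = dec (\<omega> (fst i)) (snd i)"

lemma decoded_emb: "decoded i (emb z) = z i"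
  by (simp add: decoded_def emb_def dec_enc)

lemma decoded_measurable: "decoded i \<in> borel_measurable seq_space"
proof -
  have "(\<lambda>\<omega>. \<omega> (fst i)) \<in> borel_measurable seq_space" by (rule measurable_component_singleton) simp
  then show ?thesis unfolding decoded_def[abs_def] by (rule measurable_compose[OF _ dec_measurable])
qed

lemma emb_measurable_base: "emb \<in> measurable base seq_space"
  using emb_measurable by (simp add: measurable_cong_sets[OF sets_base refl])

lemma noise_coded: "noise coded decoded"
proof -
  interpret prob_space base by (rule prob_space_base)
  interpret C: prob_space coded unfolding coded_def by (rule prob_space_distr[OF emb_measurable_base])
  have sets_coded: "sets coded = sets seq_space" by (simp add: coded_def)
  have m: "decoded i \<in> borel_measurable coded" for i
    using decoded_measurable by (simp add: measurable_cong_sets[OF sets_coded refl])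
  have all: "(\<lambda>\<omega>. \<lambda>i\<in>UNIV. decoded i \<omega>) \<in> measurable seq_space noise_space"
    by (rule measurable_PiM_single') (auto intro: decoded_measurable)
  have comp: "distr coded borel (decoded i) = law (snd i)" for i
    unfolding coded_def distr_distr[OF decoded_measurable emb_measurable_base]
    by (simp add: comp_def decoded_emb distr_base_component)
  show ?thesis
  proof (unfold_locales)
    have "distr coded noise_space (\<lambda>\<omega>. \<lambda>i\<in>UNIV. decoded i \<omega>) = distr base noise_space (\<lambda>z. z)"
      unfolding coded_def distr_distr[OF all emb_measurable_base]
      by (simp add: comp_def decoded_emb restrict_UNIV)
    also have "\<dots> = base" by (simp add: distr_id2)
    also have "base = PiM UNIV (\<lambda>i. distr coded borel (decoded i))"
      unfolding comp by (simp add: base_def)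
    finally show "C.indep_vars (\<lambda>_. borel) decoded UNIV"
      using m by (subst C.indep_vars_iff_distr_eq_PiM') auto
  qed (simp_all add: comp law_simps)
qed

text \<open>Codes of different sites read disjoint coordinates of the product space, which makes
  \<open>coded\<close> a product measure; its factors agree because a shift carries every site to
  site 0.\<close>

lemma iid_coded: "iid coded (\<lambda>k \<omega>. \<omega> k)"
  unfolding iid_def
proof (intro conjI allI)
  interpret B: noise base "\<lambda>i z. z i" by (rule noise_base)
  interpret C: noise coded decoded by (rule noise_coded)
  have sets_coded: "sets coded = sets seq_space" by (simp add: coded_def)
  have c: "(\<lambda>\<omega>. \<omega> k) \<in> borel_measurable seq_space" for k :: int
    by (rule measurable_component_singleton) simp
  then have cm: "(\<lambda>\<omega>. \<omega> k) \<in> borel_measurable coded" for k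
    by (simp add: measurable_cong_sets[OF sets_coded refl])
  have comp: "distr coded borel (\<lambda>\<omega>. \<omega> k) = distr base borel (\<lambda>z. emb z k)" for k
    unfolding coded_def distr_distr[OF c emb_measurable_base] by (simp add: comp_def)
  have cfg: "B.config z = z" for z by (simp add: B.config_def)
  have "B.indep_vars (\<lambda>_. borel) (\<lambda>k z. emb (B.config z) k) UNIV"
  proof (rule B.indep_vars_depends_on[where K = "\<lambda>k. {(k, x) | x. True}"])
    show "(\<lambda>z. emb z k) \<in> borel_measurable noise_space" for k by (rule emb_component_measurable)
    show "depends_on {(k, x) | x. True} (\<lambda>z. emb z k)" for k
    proof (rule depends_onI)
      fix z z' :: "int \<times> label \<Rightarrow> real" assume eq: "\<And>x. x \<in> {(k, x) | x. True} \<Longrightarrow> z x = z' x"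
      have "(\<lambda>x. z (k, x)) = (\<lambda>x. z' (k, x))" by (rule ext, rule eq) blast
      then show "emb z k = emb z' k" by (simp add: emb_def)
    qed
    show "disjoint_family_on (\<lambda>k. {(k, x) | x. True}) (UNIV :: int set)"
      by (auto simp: disjoint_family_on_def)
  qed
  then have "B.indep_vars (\<lambda>_. borel) (\<lambda>k z. emb z k) UNIV" unfolding cfg .
  then have "distr base seq_space (\<lambda>z. \<lambda>k\<in>UNIV. emb z k) = PiM UNIV (\<lambda>k. distr base borel (\<lambda>z. emb z k))"
    using measurable_compose[OF emb_measurable_base c]
    by (subst (asm) B.indep_vars_iff_distr_eq_PiM') auto
  then have prod: "coded = PiM UNIV (\<lambda>k. distr coded borel (\<lambda>\<omega>. \<omega> k))"
    unfolding comp by (simp add: coded_def restrict_UNIV)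
  have "distr coded seq_space (\<lambda>\<omega>. \<lambda>k\<in>UNIV. \<omega> k) = coded"
    by (simp add: restrict_UNIV distr_id2 sets_coded)
  then show "prob_space.indep_vars coded (\<lambda>_. borel) (\<lambda>k \<omega>. \<omega> k) UNIV"
    using prod cm by (subst C.indep_vars_iff_distr_eq_PiM') auto
  fix j k :: int
  have e: "distr base borel (\<lambda>z. emb z k) = distr base borel (\<lambda>z. emb z 0)" for k
  proof -
    have sb: "shift k \<in> measurable base noise_space"
      using shift_measurable by (simp add: measurable_cong_sets[OF sets_base refl])
    have "distr base borel (\<lambda>z. emb z k) = distr base borel ((\<lambda>z. emb z 0) \<circ> shift k)"
      by (simp add: comp_def emb_def)
    also have "\<dots> = distr (distr base noise_space (shift k)) borel (\<lambda>z. emb z 0)"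
      by (rule distr_distr[OF emb_component_measurable sb, symmetric])
    finally show ?thesis unfolding distr_base_shift .
  qed
  show "distr coded borel (\<lambda>\<omega>. \<omega> j) = distr coded borel (\<lambda>\<omega>. \<omega> k)"
    unfolding comp by (rule trans[OF e e[symmetric]])
qed

text \<open>Entry \<open>i\<close> of \<open>y\<close> codes the noise at site \<open>- i\<close>. A
  positive site is filled with the entry of site 0, since \<open>nat\<close> truncates;
  \<open>signal 0\<close> never reads such sites.\<close>

definition causal_code :: "(nat \<Rightarrow> real) \<Rightarrow> real" where
  "causal_code y = signal 0 (\<lambda>i. dec (y (nat (- fst i))) (snd i))"

lemma causal_code_measurable: "causal_code \<in> borel_measurable (\<Pi>\<^sub>M i\<in>(UNIV::nat set). borel)"
proof -
  have "(\<lambda>y i. dec (y (nat (- fst i))) (snd i)) \<in> measurable (\<Pi>\<^sub>M i\<in>(UNIV::nat set). borel) noise_space"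
  proof (rule measurable_PiM_single')
    fix i :: "int \<times> label"
    have "(\<lambda>y. y (nat (- fst i))) \<in> borel_measurable (\<Pi>\<^sub>M i\<in>(UNIV::nat set). borel)"
      by (rule measurable_component_singleton) simp
    then show "(\<lambda>y. dec (y (nat (- fst i))) (snd i)) \<in> borel_measurable (\<Pi>\<^sub>M i\<in>(UNIV::nat set). borel)"
      by (rule measurable_compose[OF _ dec_measurable])
  qed auto
  then show ?thesis unfolding causal_code_def[abs_def] by (rule measurable_compose[OF _ signal_measurable])
qed

lemma signal_eq_causal_code:
  "signal k (\<lambda>i. dec (\<omega> (fst i)) (snd i)) = causal_code (\<lambda>i. \<omega> (k - int i))"
proof -
  have "signal k (\<lambda>i. dec (\<omega> (fst i)) (snd i)) = signal 0 (shift k (\<lambda>i. dec (\<omega> (fst i)) (snd i)))"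
    by (simp add: signal_shift)
  also have "\<dots> = causal_code (\<lambda>i. \<omega> (k - int i))"
    unfolding causal_code_def
  proof (rule depends_onD[OF signal_depends_on])
    fix i :: "int \<times> label" assume "i \<in> past_slots 0"
    then obtain j x where i: "i = (j, x)" "j \<le> 0" by (auto simp: past_slots_def)
    then show "shift k (\<lambda>i. dec (\<omega> (fst i)) (snd i)) i = dec (\<omega> (k - int (nat (- fst i)))) (snd i)"
      by (simp add: add.commute)
  qed
  finally show ?thesis .
qed

theorem theorem1p1:
  shows "\<exists>(M :: (int \<Rightarrow> real) measure) (X :: int \<Rightarrow> (int \<Rightarrow> real) \<Rightarrow> real).
    prob_space M \<and> strictly_stationary M X \<and>
    \<comment> \<open>(A)\<close>
    ((\<forall>k. \<forall>\<omega>\<in>space M. X k \<omega> \<in> {-1, 1}) \<and>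
     \<P>(\<omega> in M. X 0 \<omega> = -1) = 1/2 \<and> \<P>(\<omega> in M. X 0 \<omega> = 1) = 1/2 \<and>
     prob_space.expectation M (X 0) = 0 \<and>
     prob_space.expectation M (\<lambda>\<omega>. (X 0 \<omega>)^2) = 1) \<and>
    \<comment> \<open>(B)\<close>
    (\<forall>K::int set. card K = 5 \<longrightarrow> prob_space.indep_vars M (\<lambda>_. borel) X K) \<and>
    \<comment> \<open>(C)\<close>
    (\<exists>(\<eta> :: int \<Rightarrow> (int \<Rightarrow> real) \<Rightarrow> real) (f :: (nat \<Rightarrow> real) \<Rightarrow> real).
       iid M \<eta> \<and>
       f \<in> borel_measurable (\<Pi>\<^sub>M i\<in>(UNIV::nat set). borel) \<and> (\<forall>x. f x \<in> {-1, 1}) \<and>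
       (\<forall>k. AE \<omega> in M. X k \<omega> = f (\<lambda>i. \<eta> (k - int i) \<omega>))) \<and>
    \<comment> \<open>(D)\<close>
    (\<forall>A\<in>double_tail M X. measure M A = 0 \<or> measure M A = 1) \<and>
    \<comment> \<open>(E)\<close>
    limsup (\<lambda>n. ereal (prob_space.expectation M (\<lambda>\<omega>. (partial_sum X n \<omega> / sqrt (real n))^6))) < 15 \<and>
    \<comment> \<open>(F)\<close>
    (\<forall>Q::nat set. Q \<subseteq> {1..} \<and> infinite Q \<longrightarrow>
       (\<exists>T \<mu>. T \<subseteq> Q \<and> infinite T \<and>
          real_distribution \<mu> \<and> nondegenerate \<mu> \<and> \<not> normal_law \<mu> \<and>
          converges_in_distribution_along M (\<lambda>n \<omega>. partial_sum X n \<omega> / sqrt (real n)) T \<mu>))"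
proof -
  interpret noise coded decoded by (rule noise_coded)
  have X_eq: "signal k (config \<omega>) = causal_code (\<lambda>i. \<omega> (k - int i))" for k \<omega>
    unfolding config_def decoded_def by (rule signal_eq_causal_code)
  have code_values: "causal_code x \<in> {-1, 1}" for x
    by (simp add: causal_code_def signal_def)
  have square: "expectation (\<lambda>\<omega>. (X 0 \<omega>)\<^sup>2) = 1"
  proof -
    have "(X 0 \<omega>)\<^sup>2 = 1" for \<omega> by (simp add: signal_def)
    then show ?thesis by (simp only: integral_const) (simp add: prob_space)
  qed
  show ?thesis
  proof (rule exI[of _ coded], rule exI[of _ X], intro conjI)
    show "prob_space coded" by (rule prob_space_axioms)
    show "strictly_stationary coded X" by (rule strictly_stationary_X)
    show "\<forall>k. \<forall>\<omega>\<in>space coded. X k \<omega> \<in> {-1, 1}" by (simp add: signal_def)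
    show "\<P>(\<omega> in coded. X 0 \<omega> = -1) = 1 / 2" "\<P>(\<omega> in coded. X 0 \<omega> = 1) = 1 / 2"
      by (rule prob_X)+
    show "expectation (X 0) = 0" by (rule expectation_X)
    show "expectation (\<lambda>\<omega>. (X 0 \<omega>)\<^sup>2) = 1" by (rule square)
    show "\<forall>K::int set. card K = 5 \<longrightarrow> indep_vars (\<lambda>_. borel) X K" using indep_vars_five by blast
    \<comment> \<open>The coordinates themselves are the i.i.d. sequence, and since decoding is
      pointwise the required equality holds at every point.\<close>
    show "\<exists>(\<eta> :: int \<Rightarrow> (int \<Rightarrow> real) \<Rightarrow> real) (f :: (nat \<Rightarrow> real) \<Rightarrow> real).
       iid coded \<eta> \<and>
       f \<in> borel_measurable (\<Pi>\<^sub>M i\<in>(UNIV::nat set). borel) \<and> (\<forall>x. f x \<in> {-1, 1}) \<and>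
       (\<forall>k. AE \<omega> in coded. X k \<omega> = f (\<lambda>i. \<eta> (k - int i) \<omega>))"
      using iid_coded causal_code_measurable code_values X_eq
      by (intro exI[of _ "\<lambda>k \<omega>. \<omega> k"] exI[of _ causal_code] conjI allI AE_I2)
    show "\<forall>A\<in>double_tail coded X. measure coded A = 0 \<or> measure coded A = 1"
      using double_tail_trivial by blast
    show "limsup (\<lambda>n. ereal (expectation (\<lambda>\<omega>. (partial_sum X n \<omega> / sqrt (real n)) ^ 6))) < 15"
      by (rule limsup_six)
    show "\<forall>Q::nat set. Q \<subseteq> {1..} \<and> infinite Q \<longrightarrow>
       (\<exists>T \<mu>. T \<subseteq> Q \<and> infinite T \<and>
          real_distribution \<mu> \<and> nondegenerate \<mu> \<and> \<not> normal_law \<mu> \<and>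
          converges_in_distribution_along coded (\<lambda>n \<omega>. partial_sum X n \<omega> / sqrt (real n)) T \<mu>)"
      using subsequence_limit by blast
  qed
qed

end
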